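(* Let $M$ be a smooth connected $m$-manifold without boundary ($m\ge 1$), possibly noncompact, let $f:M\to\mathbb{R}$ be a Morse function, let $v$ be an $f$-gradient, and let $q:M\to M/\!\sim$ be the quotient map onto the orbit space of $v$. Then $q$ has path lifting. More specifically, let $\alpha:[0,1]\to M/\!\sim$ be continuous, let $e_0\in q^{-1}(\alpha(0))$, and let $e_1\in q^{-1}(\alpha(1))$. Then there exists a continuous function $\widetilde{\alpha}:[0,1]\to M$ such that $q\circ\widetilde{\alpha}=\alpha$, $\widetilde{\alpha}(0)=e_0$, and $\widetilde{\alpha}(1)=e_1$.
   Context: Smooth means $C^\infty$. Manifolds are Hausdorff with a countable basis. A Morse function is a smooth function all of whose critical points are non-degenerate; $S(f)$ denotes the set of critical points of $f$. For a smooth vector field $v:M\to TM$, let $v(f):M\to\mathbb{R}$ be the smooth function $v(f)(p)=df_p(v(p))$. The vector field $v$ is an $f$-gradient if: (1) $v(f)>0$ on $M-S(f)$; and (2) each $p\in S(f)$ is a non-degenerate minimum of $v(f)$ (that is, $p$ is a local minimum of $v(f)$ which is a non-degenerate critical point of $v(f)$). For $p\in M$, $[p]$ denotes the orbit of $p$, i.e. the image in $M$ of the maximal integral curve of $v$ through $p$. The orbits are the classes of an equivalence relation $\sim$ on $M$. The orbit space $M/\!\sim$ carries the quotient topology: $U\subset M/\!\sim$ is open if and only if $q^{-1}(U)\subset M$ is open, where $q:M\to M/\!\sim$, $q(p)=[p]$. The orbit space is typically non-Hausdorff. *)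

theory Defs
  imports "HOL-Analysis.Analysis"
begin

section \<open>Smooth maps between open subsets of Euclidean spaces\<close>

text \<open>These are meant for open \<open>S\<close>, where being \<open>C\<^sup>k\<close> is the same as having all directional
  derivatives of class \<open>C\<^sup>k\<^sup>-\<^sup>1\<close> (in addition to being differentiable).\<close>

primrec Ck_on :: "nat \<Rightarrow> 'a::real_normed_vector set \<Rightarrow> ('a \<Rightarrow> 'b::real_normed_vector) \<Rightarrow> bool" where
  "Ck_on 0 S g \<longleftrightarrow> continuous_on S g"
| "Ck_on (Suc k) S g \<longleftrightarrow>
     (\<forall>x\<in>S. g differentiable (at x)) \<and> (\<forall>u. Ck_on k S (\<lambda>x. frechet_derivative g (at x) u))"

definition smooth_on :: "'a::real_normed_vector set \<Rightarrow> ('a \<Rightarrow> 'b::real_normed_vector) \<Rightarrow> bool" where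
  "smooth_on S g \<longleftrightarrow> (\<forall>k. Ck_on k S g)"

definition hessian :: "(real^'m \<Rightarrow> real) \<Rightarrow> real^'m \<Rightarrow> real^'m^'m" where
  "hessian g y =
     (\<chi> i j. frechet_derivative (\<lambda>x. frechet_derivative g (at x) (axis j 1)) (at y) (axis i 1))"


section \<open>Smooth manifolds\<close>

text \<open>A chart is a pair of its domain and its coordinate map.  The underlying space of a manifold is
  \<open>topspace M\<close>; functions on it are total functions whose values elsewhere are irrelevant.\<close>

type_synonym ('a, 'm) chart = "'a set \<times> ('a \<Rightarrow> real^'m)"

definition chart_inv :: "('a, 'm::finite) chart \<Rightarrow> real^'m \<Rightarrow> 'a" where
  "chart_inv c = inv_into (fst c) (snd c)"

definition is_chart :: "'a topology \<Rightarrow> ('a, 'm::finite) chart \<Rightarrow> bool" where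
  "is_chart M c \<longleftrightarrow> openin M (fst c) \<and> open (snd c ` fst c) \<and>
     homeomorphic_map (subtopology M (fst c)) (top_of_set (snd c ` fst c)) (snd c)"

definition transition :: "('a, 'm::finite) chart \<Rightarrow> ('a, 'm) chart \<Rightarrow> real^'m \<Rightarrow> real^'m" where
  "transition c d = snd d \<circ> chart_inv c"

text \<open>A smooth manifold without boundary of dimension \<open>CARD('m)\<close>.  The smooth structure is given by an
  arbitrary (not necessarily maximal) smooth atlas \<open>A\<close>.\<close>

definition smooth_manifold :: "'a topology \<Rightarrow> ('a, 'm::finite) chart set \<Rightarrow> bool" where
  "smooth_manifold M A \<longleftrightarrow>
     Hausdorff_space M \<and> second_countable M \<and>
     (\<forall>c\<in>A. is_chart M c) \<and> (\<Union>c\<in>A. fst c) = topspace M \<and>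
     (\<forall>c\<in>A. \<forall>d\<in>A. smooth_on (snd c ` (fst c \<inter> fst d)) (transition c d))"

definition smooth_function :: "('a, 'm::finite) chart set \<Rightarrow> ('a \<Rightarrow> real) \<Rightarrow> bool" where
  "smooth_function A f \<longleftrightarrow> (\<forall>c\<in>A. smooth_on (snd c ` fst c) (f \<circ> chart_inv c))"

text \<open>A tangent vector at \<open>p\<close> is given by its coordinate vectors \<open>w c\<close> in all charts \<open>c\<close> around \<open>p\<close>;
  these are related by the derivatives of the coordinate changes.  Extensionality (a fixed value at
  the other charts) makes this a faithful representation of the \<open>m\<close>-dimensional tangent space.\<close>

type_synonym ('a, 'm) tangent_vector = "('a, 'm) chart \<Rightarrow> real^'m"

definition tangent_space ::
  "('a, 'm::finite) chart set \<Rightarrow> 'a \<Rightarrow> ('a, 'm) tangent_vector set" where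
  "tangent_space A p =
     {w \<in> extensional {c \<in> A. p \<in> fst c}.
        \<forall>c\<in>A. \<forall>d\<in>A. p \<in> fst c \<and> p \<in> fst d \<longrightarrow>
          w d = frechet_derivative (transition c d) (at (snd c p)) (w c)}"

text \<open>\<open>df\<^sub>p(w)\<close>, computed in some chart around \<open>p\<close>; see \<open>differential_in_chart\<close> below for the
  independence of the chart.\<close>

definition differential ::
  "('a, 'm::finite) chart set \<Rightarrow> ('a \<Rightarrow> real) \<Rightarrow> 'a \<Rightarrow> ('a, 'm) tangent_vector \<Rightarrow> real" where
  "differential A f p w =
     (let c = (SOME c. c \<in> A \<and> p \<in> fst c)
      in frechet_derivative (f \<circ> chart_inv c) (at (snd c p)) (w c))"

definition smooth_vector_field ::
  "'a topology \<Rightarrow> ('a, 'm::finite) chart set \<Rightarrow> ('a \<Rightarrow> ('a, 'm) tangent_vector) \<Rightarrow> bool" where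
  "smooth_vector_field M A v \<longleftrightarrow>
     (\<forall>p\<in>topspace M. v p \<in> tangent_space A p) \<and>
     (\<forall>c\<in>A. smooth_on (snd c ` fst c) (\<lambda>y. v (chart_inv c y) c))"

definition directional_derivative ::
  "('a, 'm::finite) chart set \<Rightarrow> ('a \<Rightarrow> ('a, 'm) tangent_vector) \<Rightarrow> ('a \<Rightarrow> real) \<Rightarrow> 'a \<Rightarrow> real" where
  "directional_derivative A v f p = differential A f p (v p)"


section \<open>Morse functions and their gradients\<close>

definition critical_points ::
  "'a topology \<Rightarrow> ('a, 'm::finite) chart set \<Rightarrow> ('a \<Rightarrow> real) \<Rightarrow> 'a set" where
  "critical_points M A f = {p \<in> topspace M. \<forall>w\<in>tangent_space A p. differential A f p w = 0}"

text \<open>At a critical point, invertibility of the Hessian matrix does not depend on the chart.\<close>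

definition nondegenerate_critical_point ::
  "'a topology \<Rightarrow> ('a, 'm::finite) chart set \<Rightarrow> ('a \<Rightarrow> real) \<Rightarrow> 'a \<Rightarrow> bool" where
  "nondegenerate_critical_point M A f p \<longleftrightarrow>
     p \<in> critical_points M A f \<and>
     (\<forall>c\<in>A. p \<in> fst c \<longrightarrow> invertible (hessian (f \<circ> chart_inv c) (snd c p)))"

definition morse_function ::
  "'a topology \<Rightarrow> ('a, 'm::finite) chart set \<Rightarrow> ('a \<Rightarrow> real) \<Rightarrow> bool" where
  "morse_function M A f \<longleftrightarrow>
     smooth_function A f \<and>
     (\<forall>p\<in>critical_points M A f. nondegenerate_critical_point M A f p)"

definition local_minimum :: "'a topology \<Rightarrow> ('a \<Rightarrow> real) \<Rightarrow> 'a \<Rightarrow> bool" where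
  "local_minimum M g p \<longleftrightarrow> (\<exists>W. openin M W \<and> p \<in> W \<and> (\<forall>x\<in>W. g p \<le> g x))"

definition is_gradient ::
  "'a topology \<Rightarrow> ('a, 'm::finite) chart set \<Rightarrow> ('a \<Rightarrow> real) \<Rightarrow>
   ('a \<Rightarrow> ('a, 'm) tangent_vector) \<Rightarrow> bool" where
  "is_gradient M A f v \<longleftrightarrow>
     smooth_vector_field M A v \<and>
     (\<forall>p\<in>topspace M - critical_points M A f. directional_derivative A v f p > 0) \<and>
     (\<forall>p\<in>critical_points M A f.
        local_minimum M (directional_derivative A v f) p \<and>
        nondegenerate_critical_point M A (directional_derivative A v f) p)"


section \<open>Orbits and the orbit space\<close>

definition integral_curve ::
  "'a topology \<Rightarrow> ('a, 'm::finite) chart set \<Rightarrow> ('a \<Rightarrow> ('a, 'm) tangent_vector) \<Rightarrow>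
   real set \<Rightarrow> (real \<Rightarrow> 'a) \<Rightarrow> bool" where
  "integral_curve M A v J \<gamma> \<longleftrightarrow>
     open J \<and> is_interval J \<and> continuous_map (top_of_set J) M \<gamma> \<and>
     (\<forall>t\<in>J. \<forall>c\<in>A. \<gamma> t \<in> fst c \<longrightarrow> ((snd c \<circ> \<gamma>) has_vector_derivative v (\<gamma> t) c) (at t))"

definition maximal_integral_curve ::
  "'a topology \<Rightarrow> ('a, 'm::finite) chart set \<Rightarrow> ('a \<Rightarrow> ('a, 'm) tangent_vector) \<Rightarrow>
   real set \<Rightarrow> (real \<Rightarrow> 'a) \<Rightarrow> bool" where
  "maximal_integral_curve M A v J \<gamma> \<longleftrightarrow>
     integral_curve M A v J \<gamma> \<and>
     (\<forall>J' \<gamma>'. integral_curve M A v J' \<gamma>' \<and> J \<subseteq> J' \<and> (\<forall>t\<in>J. \<gamma>' t = \<gamma> t) \<longrightarrow> J' = J)"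

text \<open>For a smooth vector field there is exactly one maximal integral curve starting at \<open>p\<close> (up to
  irrelevant values outside its domain), so the union is just the image of that curve.\<close>

definition orbit ::
  "'a topology \<Rightarrow> ('a, 'm::finite) chart set \<Rightarrow> ('a \<Rightarrow> ('a, 'm) tangent_vector) \<Rightarrow> 'a \<Rightarrow> 'a set" where
  "orbit M A v p = \<Union>{\<gamma> ` J | J \<gamma>. maximal_integral_curve M A v J \<gamma> \<and> 0 \<in> J \<and> \<gamma> 0 = p}"

definition orbit_space ::
  "'a topology \<Rightarrow> ('a, 'm::finite) chart set \<Rightarrow> ('a \<Rightarrow> ('a, 'm) tangent_vector) \<Rightarrow>
   'a set topology" where
  "orbit_space M A v =
     topology (\<lambda>U. U \<subseteq> orbit M A v ` topspace M \<and> openin M {p \<in> topspace M. orbit M A v p \<in> U})"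

definition path_lifting :: "'a topology \<Rightarrow> 'b topology \<Rightarrow> ('a \<Rightarrow> 'b) \<Rightarrow> bool" where
  "path_lifting X Y q \<longleftrightarrow>
     (\<forall>\<alpha> e\<^sub>0. pathin Y \<alpha> \<and> e\<^sub>0 \<in> topspace X \<and> q e\<^sub>0 = \<alpha> 0 \<longrightarrow>
        (\<exists>\<beta>. pathin X \<beta> \<and> (\<forall>t\<in>{0..1}. q (\<beta> t) = \<alpha> t) \<and> \<beta> 0 = e\<^sub>0))"


section \<open>Well-definedness of the above notions\<close>

lemma openin_orbit_space:
  "openin (orbit_space M A v) U \<longleftrightarrow>
     U \<subseteq> orbit M A v ` topspace M \<and> openin M {p \<in> topspace M. orbit M A v p \<in> U}"
proof -
  let ?q = "orbit M A v"
  have "istopology (\<lambda>U. U \<subseteq> ?q ` topspace M \<and> openin M {p \<in> topspace M. ?q p \<in> U})"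
    unfolding istopology_def
  proof (intro conjI allI impI)
    fix S T
    assume "S \<subseteq> ?q ` topspace M \<and> openin M {p \<in> topspace M. ?q p \<in> S}"
      and "T \<subseteq> ?q ` topspace M \<and> openin M {p \<in> topspace M. ?q p \<in> T}"
    moreover have "{p \<in> topspace M. ?q p \<in> S \<inter> T} =
        {p \<in> topspace M. ?q p \<in> S} \<inter> {p \<in> topspace M. ?q p \<in> T}" by auto
    ultimately show "S \<inter> T \<subseteq> ?q ` topspace M" "openin M {p \<in> topspace M. ?q p \<in> S \<inter> T}"
      by auto
  next
    fix K
    assume *: "\<forall>U\<in>K. U \<subseteq> ?q ` topspace M \<and> openin M {p \<in> topspace M. ?q p \<in> U}"
    then show "\<Union>K \<subseteq> ?q ` topspace M" by auto
    have "{p \<in> topspace M. ?q p \<in> \<Union>K} = (\<Union>U\<in>K. {p \<in> topspace M. ?q p \<in> U})" by auto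
    with * show "openin M {p \<in> topspace M. ?q p \<in> \<Union>K}" by auto
  qed
  then show ?thesis
    unfolding orbit_space_def by (simp add: topology_inverse')
qed

lemma topspace_orbit_space: "topspace (orbit_space M A v) = orbit M A v ` topspace M"
proof
  show "topspace (orbit_space M A v) \<subseteq> orbit M A v ` topspace M"
    using openin_topspace[of "orbit_space M A v"] unfolding openin_orbit_space by blast
  have "{p \<in> topspace M. orbit M A v p \<in> orbit M A v ` topspace M} = topspace M" by auto
  then have "openin (orbit_space M A v) (orbit M A v ` topspace M)"
    unfolding openin_orbit_space by simp
  then show "orbit M A v ` topspace M \<subseteq> topspace (orbit_space M A v)"
    by (rule openin_subset)
qed

lemma quotient_map_orbit: "quotient_map M (orbit_space M A v) (orbit M A v)"
  unfolding quotient_map_def topspace_orbit_space by (auto simp: openin_orbit_space)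

lemma smooth_on_differentiable: "smooth_on S g \<Longrightarrow> x \<in> S \<Longrightarrow> g differentiable (at x)"
  unfolding smooth_on_def by (drule spec[of _ "Suc 0"]) auto

lemma differential_in_chart:
  assumes M: "smooth_manifold M A" and f: "smooth_function A f"
    and c: "c \<in> A" "p \<in> fst c" and w: "w \<in> tangent_space A p"
  shows "differential A f p w = frechet_derivative (f \<circ> chart_inv c) (at (snd c p)) (w c)"
proof -
  define d where "d = (SOME d. d \<in> A \<and> p \<in> fst d)"
  have d: "d \<in> A" "p \<in> fst d"
    using someI[of "\<lambda>d. d \<in> A \<and> p \<in> fst d" c] c unfolding d_def by auto
  have chart: "is_chart M c" "is_chart M d"
    using M c d by (auto simp: smooth_manifold_def)
  have sub: "fst c \<subseteq> topspace M" "fst d \<subseteq> topspace M"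
    using chart by (auto simp: is_chart_def dest: openin_subset)
  have inj: "inj_on (snd c) (fst c)" "inj_on (snd d) (fst d)"
    using chart sub
    by (auto simp: is_chart_def dest!: homeomorphic_imp_injective_map simp: Int_absorb1)
  have inv: "chart_inv c (snd c x) = x" if "x \<in> fst c" for x
    using that inj by (simp add: chart_inv_def)
  have invd: "chart_inv d (snd d x) = x" if "x \<in> fst d" for x
    using that inj by (simp add: chart_inv_def)
  define S where "S = snd d ` (fst d \<inter> fst c)"
  have "openin (subtopology M (fst d)) (fst d \<inter> fst c)"
    using chart by (auto simp: is_chart_def intro: openin_subtopology_Int2)
  then have "openin (top_of_set (snd d ` fst d)) S"
    using chart(2) unfolding is_chart_def S_def
    by (meson homeomorphic_imp_open_map open_map_def)
  then have "open S"
    using chart(2) by (auto simp: is_chart_def dest: openin_open_trans)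
  have pS: "snd d p \<in> S" using c d by (auto simp: S_def)
  have eq: "(f \<circ> chart_inv d) y = ((f \<circ> chart_inv c) \<circ> transition d c) y" if "y \<in> S" for y
    using that by (auto simp: S_def transition_def inv invd)
  have dt: "transition d c differentiable (at (snd d p))"
    using M c d pS unfolding smooth_manifold_def S_def by (blast intro: smooth_on_differentiable)
  have tp: "transition d c (snd d p) = snd c p"
    using c d by (simp add: transition_def invd)
  have df: "(f \<circ> chart_inv c) differentiable (at (transition d c (snd d p)))"
    using f c unfolding tp smooth_function_def by (blast intro: smooth_on_differentiable)
  have "((f \<circ> chart_inv c) \<circ> transition d c has_derivative
         frechet_derivative (f \<circ> chart_inv c) (at (snd c p)) \<circ>
         frechet_derivative (transition d c) (at (snd d p))) (at (snd d p))"
    using diff_chain_at[OF dt[unfolded frechet_derivative_works] df[unfolded frechet_derivative_works]]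
    unfolding tp .
  then have "(f \<circ> chart_inv d has_derivative
         frechet_derivative (f \<circ> chart_inv c) (at (snd c p)) \<circ>
         frechet_derivative (transition d c) (at (snd d p))) (at (snd d p))"
    by (rule has_derivative_transform_within_open[OF _ \<open>open S\<close> pS]) (rule eq[symmetric])
  then have "frechet_derivative (f \<circ> chart_inv d) (at (snd d p)) =
         frechet_derivative (f \<circ> chart_inv c) (at (snd c p)) \<circ>
         frechet_derivative (transition d c) (at (snd d p))"
    by (rule frechet_derivative_at[symmetric])
  moreover have "w c = frechet_derivative (transition d c) (at (snd d p)) (w d)"
    using w c d unfolding tangent_space_def by blast
  ultimately show ?thesis
    unfolding differential_def d_def[symmetric] by (simp add: Let_def)
qed

end

theory Submission
  imports Defs
begin

text \<open>
  The point of the proof is that a lift of a path in the orbit space is determined by one real-valued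
  function.  Along a nonconstant orbit \<open>f\<close> is strictly increasing, so a point of such an orbit is known
  once its level is known, and the levels of an orbit form an interval.  Over the times at which \<open>\<alpha>\<close>
  is a regular orbit, lifting \<open>\<alpha>\<close> therefore means choosing a level \<open>c(t) \<in> f(\<alpha>(t))\<close> continuously in
  \<open>t\<close>.  A short piece of the flow around a regular point \<open>x\<close> of \<open>\<alpha>(t)\<close> meets all nearby levels, and
  the quotient map is open (\<open>openin_saturation\<close>), so the orbits \<open>\<alpha>(s)\<close> with \<open>s\<close> close to \<open>t\<close> have points
  close to \<open>x\<close> at all levels close to \<open>f(x)\<close> (\<open>path_meets_nearby_levels\<close>).  Hence a constant level is
  admissible for a short time, and local constant choices are averaged to a global one by a partition
  of unity (\<open>continuous_selection_real\<close>), because the sets of admissible levels are convex.  Continuity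
  of the resulting lift is again \<open>path_meets_nearby_levels\<close>.

  At a critical point \<open>p\<close> the Hessian of \<open>f\<close> is invertible, which makes \<open>p\<close> isolated among the critical
  points; and \<open>v(f)\<close> has a minimum at \<open>p\<close>, which forces \<open>v(p) = 0\<close>, since the derivative of \<open>v(f)\<close> at \<open>p\<close>
  is the Hessian applied to \<open>v(p)\<close>.  So the orbit of \<open>p\<close> is \<open>{p}\<close>, and a lift has to take the value \<open>p\<close>
  whenever \<open>\<alpha>(t) = {p}\<close>.  What remains is to keep the lift close to \<open>p\<close> at times \<open>t\<close> close to these.
  Such an \<open>\<alpha>(t)\<close> does pass close to \<open>p\<close>, but demanding that the lift be close to \<open>p\<close> must not destroy the
  convexity of the set of levels.  It does not, by a gain estimate: leaving a neighbourhood \<open>N\<close> of \<open>p\<close>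
  from near its centre costs a fixed increase of \<open>f\<close> (\<open>escape_gain\<close>), whereas \<open>f\<close> oscillates
  arbitrarily little on a small neighbourhood \<open>B\<close> of \<open>p\<close>.  Every orbit segment with both ends in \<open>B\<close>
  therefore stays in \<open>N\<close>.  The union of these segments, \<open>orbit_hull B\<close>, is convex along orbits by
  construction, and shrinks to \<open>p\<close> with \<open>B\<close> (\<open>small_orbit_hull\<close>).  Requiring the lift to lie in smaller
  and smaller hulls as \<open>t\<close> approaches the critical times thus fits into the selection argument.

  The prescribed endpoints are two more convex conditions on the level.  As lifts exist with any
  endpoints, local lifts can be concatenated, and the interval is exhausted by bisection.
\<close>

section \<open>Ordinary differential equations\<close>

lemma smooth_on_imp_lipschitz_on_cball:
  fixes V :: "'a::euclidean_space \<Rightarrow> 'b::euclidean_space"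
  assumes "smooth_on S V" and sub: "cball p R \<subseteq> S"
  obtains L where "L-lipschitz_on (cball p R) V"
proof -
  have "Ck_on (Suc 0) S V"
    using assms(1) by (simp add: smooth_on_def)
  then have diff: "\<And>x. x \<in> S \<Longrightarrow> V differentiable (at x)"
    and cont: "\<And>u. continuous_on S (\<lambda>x. frechet_derivative V (at x) u)"
    by auto
  have "\<exists>B. \<forall>x\<in>cball p R. norm (frechet_derivative V (at x) u) \<le> B" for u
  proof (cases "cball p R = {}")
    case False
    have "compact ((\<lambda>x. frechet_derivative V (at x) u) ` cball p R)"
      using continuous_on_subset[OF cont sub] by (intro compact_continuous_image) auto
    then show ?thesis
      by (auto dest: compact_imp_bounded simp: bounded_iff)
  qed auto
  then obtain B where B: "\<And>u x. x \<in> cball p R \<Longrightarrow> norm (frechet_derivative V (at x) u) \<le> B u"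
    by metis
  have "(\<Sum>b\<in>Basis. max 0 (B b))-lipschitz_on (cball p R) V"
  proof (rule bounded_derivative_imp_lipschitz)
    fix x assume x: "x \<in> cball p R"
    then have d: "(V has_derivative frechet_derivative V (at x)) (at x)"
      using diff sub by (auto simp: frechet_derivative_works[symmetric])
    then show "(V has_derivative frechet_derivative V (at x)) (at x within cball p R)"
      by (rule has_derivative_at_withinI)
    have "onorm (frechet_derivative V (at x)) \<le> (\<Sum>b\<in>Basis. norm (frechet_derivative V (at x) b))"
      using d by (intro onorm_componentwise) (rule has_derivative_bounded_linear)
    also have "\<dots> \<le> (\<Sum>b\<in>Basis. max 0 (B b))"
      using B[OF x] by (intro sum_mono) (auto simp: le_max_iff_disj)
    finally show "onorm (frechet_derivative V (at x)) \<le> (\<Sum>b\<in>Basis. max 0 (B b))" .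
  qed (auto intro: sum_nonneg)
  then show ?thesis by (rule that)
qed

lemma vector_derivative_bound:
  fixes u :: "real \<Rightarrow> 'a::real_normed_vector"
  assumes S: "convex S"
    and der: "\<And>t. t \<in> S \<Longrightarrow> (u has_vector_derivative u' t) (at t within S)"
    and bound: "\<And>t. t \<in> S \<Longrightarrow> norm (u' t) \<le> B"
    and "s \<in> S" "t \<in> S"
  shows "norm (u s - u t) \<le> B * \<bar>s - t\<bar>"
proof -
  have "norm (u s - u t) \<le> B * norm (s - t)"
  proof (rule differentiable_bound[OF S])
    show "(u has_derivative (\<lambda>h. h *\<^sub>R u' x)) (at x within S)" if "x \<in> S" for x
      using der[OF that] by (simp add: has_vector_derivative_def)
    show "onorm (\<lambda>h. h *\<^sub>R u' x) \<le> B" if "x \<in> S" for x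
      using bound[OF that] by (simp add: onorm_scaleR_left[OF bounded_linear_ident] onorm_id)
  qed (use assms in auto)
  then show ?thesis by simp
qed

lemma ode_solutions_agree_locally:
  fixes V :: "'a::real_normed_vector \<Rightarrow> 'a"
  assumes V: "L-lipschitz_on X V" and "d > 0"
    and u: "\<And>t. \<bar>t - t0\<bar> < d \<Longrightarrow> (u has_vector_derivative V (u t)) (at t)"
           "\<And>t. \<bar>t - t0\<bar> < d \<Longrightarrow> u t \<in> X"
    and w: "\<And>t. \<bar>t - t0\<bar> < d \<Longrightarrow> (w has_vector_derivative V (w t)) (at t)"
           "\<And>t. \<bar>t - t0\<bar> < d \<Longrightarrow> w t \<in> X"
    and eq: "u t0 = w t0"
  obtains e where "e > 0" "\<And>t. \<bar>t - t0\<bar> < e \<Longrightarrow> u t = w t"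
proof -
  have L: "L \<ge> 0" using V by (rule lipschitz_on_nonneg)
  \<comment> \<open>over so short a time the equation at most halves the largest distance of the two solutions\<close>
  define e where "e = min (d / 2) (1 / (2 * (L + 1)))"
  have e: "e > 0" "e < d" and "e \<le> 1 / (2 * (L + 1))"
    using L \<open>d > 0\<close> by (auto simp: e_def)
  have "L * e \<le> L * (1 / (2 * (L + 1)))"
    by (rule mult_left_mono) fact+
  also have "\<dots> \<le> 1 / 2"
    using L by (simp add: field_simps)
  finally have Le: "L * e \<le> 1 / 2" .
  define S where "S = cball t0 e"
  have S: "\<bar>t - t0\<bar> < d" if "t \<in> S" for t
    using that e by (auto simp: S_def dist_real_def)
  have der: "((\<lambda>t. u t - w t) has_vector_derivative V (u t) - V (w t)) (at t within S)"
    if "t \<in> S" for t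
    using u(1) w(1) S[OF that]
    by (intro has_vector_derivative_diff) (auto intro: has_vector_derivative_at_within)
  have "continuous_on S (\<lambda>t. norm (u t - w t))"
    using der by (intro continuous_on_norm)
      (auto simp: continuous_on_eq_continuous_within intro: has_vector_derivative_continuous)
  moreover have "compact S" "S \<noteq> {}" using e by (auto simp: S_def)
  ultimately obtain tm where tm: "tm \<in> S"
    and max: "\<And>t. t \<in> S \<Longrightarrow> norm (u t - w t) \<le> norm (u tm - w tm)"
    using continuous_attains_sup[of S "\<lambda>t. norm (u t - w t)"] by metis
  define m where "m = norm (u tm - w tm)"
  have "norm ((u tm - w tm) - (u t0 - w t0)) \<le> (L * m) * \<bar>tm - t0\<bar>"
  proof (rule vector_derivative_bound[where S = S])
    fix t assume t: "t \<in> S"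
    have "norm (V (u t) - V (w t)) \<le> L * norm (u t - w t)"
      using lipschitz_onD[OF V, of "u t" "w t"] u w S[OF t] by (simp add: dist_norm)
    also have "\<dots> \<le> L * m"
      using max[OF t] L by (auto simp: m_def intro: mult_left_mono)
    finally show "norm (V (u t) - V (w t)) \<le> L * m" .
  qed (use der tm e in \<open>auto simp: S_def\<close>)
  also have "\<dots> \<le> (L * m) * e"
    using tm L by (intro mult_left_mono) (auto simp: S_def dist_real_def m_def)
  also have "\<dots> = m * (L * e)" by simp
  also have "\<dots> \<le> m * (1 / 2)"
    using Le by (intro mult_left_mono) (auto simp: m_def)
  finally have "m \<le> 0"
    using eq by (simp add: m_def)
  then have "u t = w t" if "t \<in> S" for t
    using max[OF that] by (simp add: m_def)
  then show ?thesis
    using e by (intro that[of e]) (auto simp: S_def dist_real_def)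
qed

text \<open>Picard iteration: on the bounded continuous functions the integral operator contracts by \<open>L * \<epsilon> \<le> 1 / 2\<close>.
  Time is clamped to \<open>[-\<epsilon>, \<epsilon>]\<close>, so that one function space on the whole line serves all initial values,
  and the contraction also bounds the dependence of the fixed point on the initial value.\<close>

lemma global_flow_of_bounded_lipschitz:
  fixes W :: "'a::euclidean_space \<Rightarrow> 'a"
  assumes W: "L-lipschitz_on UNIV W" and B: "\<And>y. norm (W y) \<le> B"
    and "\<epsilon> > 0" and L\<epsilon>: "L * \<epsilon> \<le> 1 / 2"
  obtains \<phi> where
    "\<And>x. \<phi> 0 x = x"
    "\<And>x t. \<bar>t\<bar> < \<epsilon> \<Longrightarrow> ((\<lambda>t. \<phi> t x) has_vector_derivative W (\<phi> t x)) (at t)"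
    "continuous_on UNIV (\<lambda>(t, x). \<phi> t x)"
proof -
  have L: "L \<ge> 0" using W by (rule lipschitz_on_nonneg)
  have B0: "B \<ge> 0" using B[of 0] norm_ge_zero[of "W 0"] by linarith
  have contW: "continuous_on UNIV W" using W by (rule lipschitz_on_continuous_on)
  define I where "I = {-\<epsilon>..\<epsilon>}"
  define clamp where "clamp t = max (-\<epsilon>) (min t \<epsilon>)" for t
  have clamp: "clamp t \<in> I" "\<bar>t\<bar> \<le> \<epsilon> \<Longrightarrow> clamp t = t" for t
    using \<open>\<epsilon> > 0\<close> by (auto simp: clamp_def I_def)
  have "0 \<in> I" and "convex I" using \<open>\<epsilon> > 0\<close> by (auto simp: I_def)
  \<comment> \<open>the integral from \<open>0\<close> to \<open>t\<close>, for \<open>t\<close> of either sign\<close>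
  define P where "P u t = integral {-\<epsilon>..t} (\<lambda>s. W (apply_bcontfun u s)) -
    integral {-\<epsilon>..0} (\<lambda>s. W (apply_bcontfun u s))" for u :: "real \<Rightarrow>\<^sub>C 'a" and t
  have contWu: "continuous_on T (\<lambda>s. W (apply_bcontfun u s))" for T and u :: "real \<Rightarrow>\<^sub>C 'a"
    by (rule continuous_on_compose2[OF contW]) auto
  have P: "(P u has_vector_derivative W (apply_bcontfun u t)) (at t within I)" if "t \<in> I" for u t
  proof -
    have "(P u has_vector_derivative W (apply_bcontfun u t) - 0) (at t within I)"
      unfolding P_def[abs_def] using that contWu
      by (intro has_vector_derivative_diff has_vector_derivative_const)
        (auto simp: I_def intro: integral_has_vector_derivative)
    then show ?thesis by simp
  qed
  have P0: "P u 0 = 0" for u by (simp add: P_def)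
  have Pbound: "norm (P u s - P u t) \<le> B * \<bar>s - t\<bar>" if "s \<in> I" "t \<in> I" for u s t
    using vector_derivative_bound[OF \<open>convex I\<close> P B] that by blast
  have contP: "continuous_on I (P u)" for u
    using P by (auto simp: continuous_on_eq_continuous_within intro: has_vector_derivative_continuous)
  define T where "T x u = Bcontfun (\<lambda>t. x + P u (clamp t))" for x u
  have T: "apply_bcontfun (T x u) t = x + P u (clamp t)" for x u t
  proof -
    have "continuous_on UNIV (\<lambda>t. x + P u (clamp t))"
      unfolding clamp_def using clamp[unfolded clamp_def]
      by (intro continuous_intros continuous_on_compose2[OF contP]) auto
    moreover have "norm (x + P u (clamp t)) \<le> norm x + B * \<epsilon>" for t
    proof -
      have "norm (P u (clamp t)) \<le> B * \<bar>clamp t\<bar>"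
        using Pbound[OF clamp(1) \<open>0 \<in> I\<close>, of u t] by (simp add: P0)
      also have "\<dots> \<le> B * \<epsilon>"
        using B0 clamp(1)[of t] by (intro mult_left_mono) (auto simp: I_def)
      finally show ?thesis using norm_triangle_ineq[of x "P u (clamp t)"] by linarith
    qed
    ultimately have "(\<lambda>t. x + P u (clamp t)) \<in> bcontfun"
      by (rule bcontfun_normI)
    then show ?thesis by (simp add: T_def Bcontfun_inverse)
  qed
  have contraction: "dist (T x u) (T y w) \<le> dist x y + 1/2 * dist u w" for x y u w
  proof (rule dist_bound)
    fix t
    have "norm ((P u (clamp t) - P w (clamp t)) - (P u 0 - P w 0)) \<le> (L * dist u w) * \<bar>clamp t - 0\<bar>"
    proof (rule vector_derivative_bound[OF \<open>convex I\<close>])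
      show "((\<lambda>t. P u t - P w t) has_vector_derivative
          W (apply_bcontfun u t) - W (apply_bcontfun w t)) (at t within I)" if "t \<in> I" for t
        using that by (intro has_vector_derivative_diff P)
      show "norm (W (apply_bcontfun u t) - W (apply_bcontfun w t)) \<le> L * dist u w" for t
      proof -
        have "dist (W (apply_bcontfun u t)) (W (apply_bcontfun w t)) \<le>
          L * dist (apply_bcontfun u t) (apply_bcontfun w t)"
          using W by (rule lipschitz_onD) auto
        also have "\<dots> \<le> L * dist u w"
          using L by (intro mult_left_mono dist_bounded)
        finally show ?thesis by (simp add: dist_norm)
      qed
    qed (use clamp \<open>0 \<in> I\<close> in auto)
    also have "\<dots> \<le> (L * dist u w) * \<epsilon>"
      using L clamp(1)[of t] by (intro mult_left_mono) (auto simp: I_def)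
    also have "\<dots> = (L * \<epsilon>) * dist u w" by simp
    also have "\<dots> \<le> 1/2 * dist u w"
      using L\<epsilon> by (intro mult_right_mono) auto
    finally have "norm (P u (clamp t) - P w (clamp t)) \<le> 1/2 * dist u w"
      by (simp add: P0)
    moreover have "norm ((x + P u (clamp t)) - (y + P w (clamp t))) \<le>
        norm (x - y) + norm (P u (clamp t) - P w (clamp t))"
      using norm_triangle_ineq[of "x - y" "P u (clamp t) - P w (clamp t)"]
      by (simp add: algebra_simps)
    ultimately show "dist (apply_bcontfun (T x u) t) (apply_bcontfun (T y w) t)
        \<le> dist x y + 1/2 * dist u w"
      unfolding T dist_norm[where 'a = 'a] by linarith
  qed
  have "\<exists>!u. T x u = u" for x
    using contraction[of x _ x] by (intro banach_fix_type[of "1/2"]) auto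
  then obtain u where u: "\<And>x. T x (u x) = u x" by metis
  have ut: "apply_bcontfun (u x) t = x + P (u x) (clamp t)" for x t
    using T[of x "u x"] by (simp add: u)
  have lip: "dist (u x) (u y) \<le> 2 * dist x y" for x y
    using contraction[of x "u x" y "u y"] by (simp add: u)
  show ?thesis
  proof (rule that[of "\<lambda>t x. apply_bcontfun (u x) t"])
    show "apply_bcontfun (u x) 0 = x" for x
      using \<open>\<epsilon> > 0\<close> by (simp add: ut clamp P0)
    show "((\<lambda>t. apply_bcontfun (u x) t) has_vector_derivative W (apply_bcontfun (u x) t)) (at t)"
      if "\<bar>t\<bar> < \<epsilon>" for x t
    proof -
      have t: "t \<in> {-\<epsilon><..<\<epsilon>}" using that by auto
      have "(P (u x) has_vector_derivative W (apply_bcontfun (u x) t)) (at t within {-\<epsilon><..<\<epsilon>})"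
        using t by (intro has_vector_derivative_within_subset[OF P]) (auto simp: I_def)
      then have "(P (u x) has_vector_derivative W (apply_bcontfun (u x) t)) (at t)"
        using at_within_open[OF t] by simp
      then have "((\<lambda>t. x + P (u x) t) has_vector_derivative 0 + W (apply_bcontfun (u x) t)) (at t)"
        by (intro has_vector_derivative_add has_vector_derivative_const)
      then have "((\<lambda>t. x + P (u x) t) has_vector_derivative W (apply_bcontfun (u x) t)) (at t)"
        by simp
      then show ?thesis
        by (rule has_vector_derivative_transform_within_open[where S = "{-\<epsilon><..<\<epsilon>}"])
          (use t in \<open>auto simp: ut clamp\<close>)
    qed
    show "continuous_on UNIV (\<lambda>(t, x). apply_bcontfun (u x) t)"
      unfolding continuous_on_iff
    proof (intro ballI allI impI)
      fix z :: "real \<times> 'a" and e :: real assume "e > 0"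
      obtain t x where z: "z = (t, x)" by force
      have "isCont (apply_bcontfun (u x)) t"
        using continuous_on_apply_bcontfun[of UNIV "u x"]
          continuous_on_eq_continuous_at[OF open_UNIV, of "apply_bcontfun (u x)"] by blast
      then obtain d where d: "d > 0"
        "\<And>s. dist s t < d \<Longrightarrow> dist (apply_bcontfun (u x) s) (apply_bcontfun (u x) t) < e / 2"
        using \<open>e > 0\<close> unfolding continuous_at_eps_delta dist_norm
        by (metis half_gt_zero real_norm_def)
      have "dist (apply_bcontfun (u y) s) (apply_bcontfun (u x) t) < e"
        if "dist (s, y) (t, x) < min d (e / 4)" for s y
      proof -
        have "dist s t < d" "dist y x < e / 4"
          using that dist_fst_le[of "(s, y)" "(t, x)"] dist_snd_le[of "(s, y)" "(t, x)"] by auto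
        moreover have "dist (apply_bcontfun (u y) s) (apply_bcontfun (u x) s) \<le> 2 * dist y x"
          using dist_bounded[of "u y" s "u x"] lip[of y x] by linarith
        ultimately show ?thesis
          using d(2)[of s] dist_triangle[of "apply_bcontfun (u y) s" "apply_bcontfun (u x) t"
              "apply_bcontfun (u x) s"] by linarith
      qed
      then show "\<exists>d>0. \<forall>z'\<in>UNIV. dist z' z < d \<longrightarrow>
          dist (case z' of (t, x) \<Rightarrow> apply_bcontfun (u x) t)
            (case z of (t, x) \<Rightarrow> apply_bcontfun (u x) t) < e"
        using d(1) \<open>e > 0\<close> unfolding z by (intro exI[of _ "min d (e / 4)"]) auto
    qed
  qed
qed

text \<open>Composing \<open>V\<close> with the nearest-point retraction onto the ball makes it bounded and Lipschitz everywhere;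
  for short times the solutions do not notice the change.\<close>

lemma local_flow_of_lipschitz:
  fixes V :: "'a::euclidean_space \<Rightarrow> 'a"
  assumes V: "L-lipschitz_on (cball p R) V" and "R > 0"
  obtains \<epsilon> r \<phi> where "\<epsilon> > 0" "r > 0" "r \<le> R"
    "\<And>x. \<phi> 0 x = x"
    "\<And>x t. x \<in> ball p r \<Longrightarrow> \<bar>t\<bar> < \<epsilon> \<Longrightarrow> \<phi> t x \<in> ball p R"
    "\<And>x t. x \<in> ball p r \<Longrightarrow> \<bar>t\<bar> < \<epsilon> \<Longrightarrow>
       ((\<lambda>t. \<phi> t x) has_vector_derivative V (\<phi> t x)) (at t)"
    "continuous_on UNIV (\<lambda>(t, x). \<phi> t x)"
proof -
  have L: "L \<ge> 0" using V by (rule lipschitz_on_nonneg)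
  let ?K = "cball p R"
  have K: "closed ?K" "convex ?K" "?K \<noteq> {}" using \<open>R > 0\<close> by auto
  define \<pi> where "\<pi> = closest_point ?K"
  have \<pi>: "\<pi> y \<in> ?K" for y
    unfolding \<pi>_def using K by (intro closest_point_in_set) auto
  have "1-lipschitz_on UNIV \<pi>"
    unfolding \<pi>_def using closest_point_lipschitz[OF K(2,1,3)] by (intro lipschitz_onI) auto
  then have "(L * 1)-lipschitz_on UNIV (V \<circ> \<pi>)"
    using \<pi> by (intro lipschitz_on_compose lipschitz_on_subset[OF V]) auto
  then have lip: "L-lipschitz_on UNIV (V \<circ> \<pi>)" by simp
  have "compact (V ` ?K)"
    using lipschitz_on_continuous_on[OF V] by (intro compact_continuous_image) auto
  then obtain B where B: "B > 0" "\<And>y. y \<in> ?K \<Longrightarrow> norm (V y) \<le> B"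
    by (auto dest!: compact_imp_bounded simp: bounded_pos)
  define \<epsilon> where "\<epsilon> = min (R / (2 * B)) (1 / (2 * (L + 1)))"
  have \<epsilon>: "\<epsilon> > 0" using L B \<open>R > 0\<close> by (auto simp: \<epsilon>_def)
  have "L * \<epsilon> \<le> L * (1 / (2 * (L + 1)))"
    unfolding \<epsilon>_def using L by (intro mult_left_mono) auto
  also have "\<dots> \<le> 1 / 2" using L by (simp add: field_simps)
  finally have L\<epsilon>: "L * \<epsilon> \<le> 1 / 2" .
  have B\<epsilon>: "B * \<epsilon> \<le> R / 2"
  proof -
    have "B * \<epsilon> \<le> B * (R / (2 * B))" unfolding \<epsilon>_def using B by (intro mult_left_mono) auto
    then show ?thesis using B by simp
  qed
  have bd: "norm ((V \<circ> \<pi>) y) \<le> B" for y using B(2) \<pi> by simp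
  obtain \<phi> where \<phi>: "\<And>x. \<phi> 0 x = x"
    "\<And>x t. \<bar>t\<bar> < \<epsilon> \<Longrightarrow> ((\<lambda>t. \<phi> t x) has_vector_derivative (V \<circ> \<pi>) (\<phi> t x)) (at t)"
    "continuous_on UNIV (\<lambda>(t, x). \<phi> t x)"
    using global_flow_of_bounded_lipschitz[OF lip bd \<epsilon> L\<epsilon>] by blast
  have stay: "\<phi> t x \<in> ball p R" if x: "x \<in> ball p (R / 2)" and t: "\<bar>t\<bar> < \<epsilon>" for x t
  proof -
    have "norm (\<phi> t x - \<phi> 0 x) \<le> B * \<bar>t - 0\<bar>"
    proof (rule vector_derivative_bound[where S = "{-\<epsilon><..<\<epsilon>}"])
      show "((\<lambda>t. \<phi> t x) has_vector_derivative (V \<circ> \<pi>) (\<phi> s x)) (at s within {-\<epsilon><..<\<epsilon>})"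
        if "s \<in> {-\<epsilon><..<\<epsilon>}" for s
        using that by (intro has_vector_derivative_at_within[OF \<phi>(2)]) auto
      show "norm ((V \<circ> \<pi>) (\<phi> s x)) \<le> B" for s by (rule bd)
    qed (use t \<epsilon> in auto)
    also have "\<dots> \<le> B * \<epsilon>" using t B by (intro mult_left_mono) auto
    finally have "norm (\<phi> t x - x) \<le> R / 2" using B\<epsilon> by (simp add: \<phi>)
    then show ?thesis
      using x dist_triangle[of "\<phi> t x" p x] by (simp add: dist_norm norm_minus_commute)
  qed
  show ?thesis
  proof (rule that[of \<epsilon> "R / 2" \<phi>])
    fix x t assume *: "x \<in> ball p (R / 2)" "\<bar>t\<bar> < \<epsilon>"
    then have "\<pi> (\<phi> t x) = \<phi> t x"
      unfolding \<pi>_def using stay by (intro closest_point_self) (meson ball_subset_cball subsetD)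
    then show "((\<lambda>t. \<phi> t x) has_vector_derivative V (\<phi> t x)) (at t)"
      using \<phi>(2)[OF *(2), of x] by simp
  qed (use \<epsilon> \<open>R > 0\<close> \<phi> stay in auto)
qed

section \<open>The flow of a vector field on a manifold\<close>

locale manifold_with_field =
  fixes M :: "'a topology" and A :: "('a, 'm::finite) chart set"
    and v :: "'a \<Rightarrow> ('a, 'm) tangent_vector"
  assumes manifold: "smooth_manifold M A" and field: "smooth_vector_field M A v"
begin

lemma Hausdorff: "Hausdorff_space M"
  using manifold by (simp add: smooth_manifold_def)

lemma obtain_chart:
  assumes "p \<in> topspace M" obtains c where "c \<in> A" "p \<in> fst c"
  using assms manifold unfolding smooth_manifold_def by blast

context
  fixes c assumes c: "c \<in> A"
begin

lemma chart: "is_chart M c"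
  using c manifold by (simp add: smooth_manifold_def)

lemma chart_openin: "openin M (fst c)"
  and chart_image_open: "open (snd c ` fst c)"
  using chart by (auto simp: is_chart_def)

lemma chart_subset: "fst c \<subseteq> topspace M"
  using chart_openin by (rule openin_subset)

lemma chart_homeomorphic: "homeomorphic_map (subtopology M (fst c)) (top_of_set (snd c ` fst c)) (snd c)"
  using chart by (simp add: is_chart_def)

lemma chart_inj: "inj_on (snd c) (fst c)"
  using homeomorphic_imp_injective_map[OF chart_homeomorphic] chart_subset
  by (simp add: Int_absorb1)

lemma chart_inv_left: "x \<in> fst c \<Longrightarrow> chart_inv c (snd c x) = x"
  using chart_inj by (simp add: chart_inv_def)

lemma chart_inv_right: "y \<in> snd c ` fst c \<Longrightarrow> snd c (chart_inv c y) = y"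
  and chart_inv_in: "y \<in> snd c ` fst c \<Longrightarrow> chart_inv c y \<in> fst c"
  by (auto simp: chart_inv_def f_inv_into_f inv_into_into)

lemma openin_chart_vimage:
  assumes "open T" shows "openin M {x \<in> fst c. snd c x \<in> T}"
proof -
  have "openin (top_of_set (snd c ` fst c)) (snd c ` fst c \<inter> T)"
    using assms by auto
  then have "openin (subtopology M (fst c))
      {x \<in> topspace (subtopology M (fst c)). snd c x \<in> snd c ` fst c \<inter> T}"
    by (rule openin_continuous_map_preimage[OF homeomorphic_imp_continuous_map[OF chart_homeomorphic]])
  moreover have "{x \<in> topspace (subtopology M (fst c)). snd c x \<in> snd c ` fst c \<inter> T} =
      {x \<in> fst c. snd c x \<in> T}"
    using chart_subset by auto
  ultimately show ?thesis
    using chart_openin by (simp add: openin_open_subtopology)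
qed

lemma open_chart_image:
  assumes "openin M N" shows "open (snd c ` (fst c \<inter> N))"
proof -
  have "openin (subtopology M (fst c)) (fst c \<inter> N)"
    using assms by (rule openin_subtopology_Int2)
  then have "openin (top_of_set (snd c ` fst c)) (snd c ` (fst c \<inter> N))"
    using homeomorphic_imp_open_map[OF chart_homeomorphic] unfolding open_map_def by blast
  then show ?thesis
    using chart_image_open by (rule openin_open_trans)
qed

lemma chart_cball:
  assumes "openin M N" "p \<in> N" "p \<in> fst c"
  obtains R where "R > 0" "cball (snd c p) R \<subseteq> snd c ` (fst c \<inter> N)"
  using open_chart_image[OF assms(1)] assms unfolding open_contains_cball by blast

lemma field_smooth: "smooth_on (snd c ` fst c) (\<lambda>y. v (chart_inv c y) c)"
  using field c by (simp add: smooth_vector_field_def)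

end

lemma integral_curve_open: "integral_curve M A v J \<gamma> \<Longrightarrow> open J"
  and integral_curve_interval: "integral_curve M A v J \<gamma> \<Longrightarrow> is_interval J"
  and integral_curve_continuous: "integral_curve M A v J \<gamma> \<Longrightarrow> continuous_map (top_of_set J) M \<gamma>"
  and integral_curve_derivative: "integral_curve M A v J \<gamma> \<Longrightarrow> t \<in> J \<Longrightarrow> c \<in> A \<Longrightarrow> \<gamma> t \<in> fst c \<Longrightarrow>
    ((snd c \<circ> \<gamma>) has_vector_derivative v (\<gamma> t) c) (at t)"
  by (auto simp: integral_curve_def)

lemma integral_curve_in: "integral_curve M A v J \<gamma> \<Longrightarrow> t \<in> J \<Longrightarrow> \<gamma> t \<in> topspace M"
  using continuous_map_image_subset_topspace[OF integral_curve_continuous] by fastforce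

lemma curve_preimage_open:
  assumes "continuous_map (top_of_set J) M \<gamma>" "open J" "openin M N"
  shows "open {t \<in> J. \<gamma> t \<in> N}"
  using openin_continuous_map_preimage[OF assms(1,3)] assms(2) by (auto dest: openin_open_trans)

lemma curve_stays_near:
  fixes J :: "real set"
  assumes "continuous_map (top_of_set J) M \<gamma>" "open J" "openin M N" "t \<in> J" "\<gamma> t \<in> N"
  obtains e where "e > 0" "\<And>s. \<bar>s - t\<bar> < e \<Longrightarrow> s \<in> J \<and> \<gamma> s \<in> N"
proof -
  obtain e where "e > 0" "ball t e \<subseteq> {t \<in> J. \<gamma> t \<in> N}"
    using curve_preimage_open[OF assms(1-3)] assms(4,5) unfolding open_contains_ball by blast
  then show ?thesis
    by (intro that[of e]) (auto simp: subset_iff dist_real_def abs_minus_commute)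
qed

text \<open>The tangent vectors of a field transform with the derivatives of the coordinate changes, so the
  differential equation has to be verified in one chart only.\<close>

lemma integral_curveI:
  assumes J: "open J" "is_interval J" and cont: "continuous_map (top_of_set J) M \<gamma>"
    and der: "\<And>t. t \<in> J \<Longrightarrow> \<exists>c\<in>A. \<gamma> t \<in> fst c \<and>
      ((snd c \<circ> \<gamma>) has_vector_derivative v (\<gamma> t) c) (at t)"
  shows "integral_curve M A v J \<gamma>"
  unfolding integral_curve_def
proof (intro conjI ballI impI J cont)
  fix t d assume t: "t \<in> J" and d: "d \<in> A" "\<gamma> t \<in> fst d"
  obtain c where c: "c \<in> A" "\<gamma> t \<in> fst c"
    and derc: "((snd c \<circ> \<gamma>) has_vector_derivative v (\<gamma> t) c) (at t)"
    using der[OF t] by blast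
  define D where "D = frechet_derivative (transition c d) (at (snd c (\<gamma> t)))"
  have "transition c d differentiable (at (snd c (\<gamma> t)))"
    using manifold c d unfolding smooth_manifold_def by (blast intro: smooth_on_differentiable)
  then have D: "(transition c d has_derivative D) (at ((snd c \<circ> \<gamma>) t))"
    by (simp add: D_def frechet_derivative_works)
  have "v (\<gamma> t) \<in> tangent_space A (\<gamma> t)"
    using field c chart_subset unfolding smooth_vector_field_def by blast
  then have vd: "v (\<gamma> t) d = D (v (\<gamma> t) c)"
    using c d unfolding tangent_space_def D_def by blast
  have "((transition c d \<circ> (snd c \<circ> \<gamma>)) has_derivative D \<circ> (\<lambda>h. h *\<^sub>R v (\<gamma> t) c)) (at t)"
    using diff_chain_at[OF derc[unfolded has_vector_derivative_def] D] .
  moreover have "D \<circ> (\<lambda>h. h *\<^sub>R v (\<gamma> t) c) = (\<lambda>h. h *\<^sub>R v (\<gamma> t) d)"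
    unfolding vd o_def using linear_scale[OF has_derivative_linear[OF D]] by metis
  ultimately have der': "((transition c d \<circ> (snd c \<circ> \<gamma>)) has_vector_derivative v (\<gamma> t) d) (at t)"
    by (simp add: has_vector_derivative_def)
  have "openin M (fst c \<inter> fst d)"
    using c d chart_openin by blast
  then have "open {s \<in> J. \<gamma> s \<in> fst c \<inter> fst d}"
    by (rule curve_preimage_open[OF cont J(1)])
  then show "((snd d \<circ> \<gamma>) has_vector_derivative v (\<gamma> t) d) (at t)"
    by (rule has_vector_derivative_transform_within_open[OF der'])
      (use t c d in \<open>auto simp: transition_def chart_inv_left\<close>)
qed

lemma integral_curves_agree_locally:
  assumes "integral_curve M A v J1 \<gamma>1" "integral_curve M A v J2 \<gamma>2"
    and t: "t \<in> J1" "t \<in> J2" and eq: "\<gamma>1 t = \<gamma>2 t"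
  obtains e where "e > 0" "\<And>s. \<bar>s - t\<bar> < e \<Longrightarrow> \<gamma>1 s = \<gamma>2 s"
proof -
  obtain c where c: "c \<in> A" "\<gamma>1 t \<in> fst c"
    using obtain_chart integral_curve_in[OF assms(1) t(1)] by blast
  let ?V = "\<lambda>y. v (chart_inv c y) c"
  obtain R where R: "R > 0" "cball (snd c (\<gamma>1 t)) R \<subseteq> snd c ` fst c"
    using chart_cball[OF c(1) openin_topspace integral_curve_in[OF assms(1) t(1)] c(2)]
    by (metis chart_subset[OF c(1)] Int_absorb2)
  obtain L where L: "L-lipschitz_on (cball (snd c (\<gamma>1 t)) R) ?V"
    using smooth_on_imp_lipschitz_on_cball[OF field_smooth[OF c(1)] R(2)] .
  let ?N = "{x \<in> fst c. snd c x \<in> ball (snd c (\<gamma>1 t)) R}"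
  have N: "openin M ?N" "\<gamma>1 t \<in> ?N" "\<gamma>2 t \<in> ?N"
    using openin_chart_vimage[OF c(1) open_ball] c R eq by auto
  obtain e1 where e1: "e1 > 0" "\<And>s. \<bar>s - t\<bar> < e1 \<Longrightarrow> s \<in> J1 \<and> \<gamma>1 s \<in> ?N"
    using curve_stays_near[OF integral_curve_continuous[OF assms(1)] integral_curve_open[OF assms(1)] N(1)
        t(1) N(2)] by blast
  obtain e2 where e2: "e2 > 0" "\<And>s. \<bar>s - t\<bar> < e2 \<Longrightarrow> s \<in> J2 \<and> \<gamma>2 s \<in> ?N"
    using curve_stays_near[OF integral_curve_continuous[OF assms(2)] integral_curve_open[OF assms(2)] N(1)
        t(2) N(3)] by blast
  obtain e where e: "e > 0" "\<And>s. \<bar>s - t\<bar> < e \<Longrightarrow> (snd c \<circ> \<gamma>1) s = (snd c \<circ> \<gamma>2) s"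
  proof (rule ode_solutions_agree_locally[OF L, of "min e1 e2" t "snd c \<circ> \<gamma>1" "snd c \<circ> \<gamma>2"])
    fix s assume "\<bar>s - t\<bar> < min e1 e2"
    then have s: "s \<in> J1" "\<gamma>1 s \<in> ?N" "s \<in> J2" "\<gamma>2 s \<in> ?N" using e1 e2 by auto
    show "((snd c \<circ> \<gamma>1) has_vector_derivative ?V ((snd c \<circ> \<gamma>1) s)) (at s)"
      using integral_curve_derivative[OF assms(1) s(1) c(1)] s(2)
      by (simp add: chart_inv_left[OF c(1)])
    show "((snd c \<circ> \<gamma>2) has_vector_derivative ?V ((snd c \<circ> \<gamma>2) s)) (at s)"
      using integral_curve_derivative[OF assms(2) s(3) c(1)] s(4)
      by (simp add: chart_inv_left[OF c(1)])
    show "(snd c \<circ> \<gamma>1) s \<in> cball (snd c (\<gamma>1 t)) R" "(snd c \<circ> \<gamma>2) s \<in> cball (snd c (\<gamma>1 t)) R"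
      using s by auto
  qed (use e1 e2 eq in auto)
  show ?thesis
  proof (rule that[of "Min {e, e1, e2}"])
    fix s assume "\<bar>s - t\<bar> < Min {e, e1, e2}"
    then show "\<gamma>1 s = \<gamma>2 s"
      using e(2)[of s] e1(2)[of s] e2(2)[of s] chart_inj[OF c(1)] by (auto simp: inj_on_def)
  qed (use e e1 e2 in auto)
qed

lemma integral_curves_agree:
  assumes "integral_curve M A v J1 \<gamma>1" "integral_curve M A v J2 \<gamma>2"
    and t0: "t0 \<in> J1" "t0 \<in> J2" and eq: "\<gamma>1 t0 = \<gamma>2 t0" and t: "t \<in> J1" "t \<in> J2"
  shows "\<gamma>1 t = \<gamma>2 t"
proof -
  let ?J = "J1 \<inter> J2"
  let ?E = "{t \<in> ?J. \<gamma>1 t = \<gamma>2 t}"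
  have "connected ?J"
    using integral_curve_interval[OF assms(1)] integral_curve_interval[OF assms(2)]
    by (intro is_interval_connected is_interval_Int)
  moreover have "closedin (top_of_set ?J) ?E"
  proof -
    have "continuous_map (top_of_set ?J) M \<gamma>1" "continuous_map (top_of_set ?J) M \<gamma>2"
      using integral_curve_continuous[OF assms(1)] integral_curve_continuous[OF assms(2)]
      by (auto elim: continuous_map_from_subtopology_mono)
    from closedin_continuous_maps_eq[OF Hausdorff this] show ?thesis by simp
  qed
  moreover have "openin (top_of_set ?J) ?E"
  proof -
    have "open ?E"
      unfolding open_contains_ball
    proof
      fix s assume s: "s \<in> ?E"
      obtain e where e: "e > 0" "\<And>r. \<bar>r - s\<bar> < e \<Longrightarrow> \<gamma>1 r = \<gamma>2 r"
        using integral_curves_agree_locally[OF assms(1,2), of s] s by auto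
      have "open ?J"
        using integral_curve_open[OF assms(1)] integral_curve_open[OF assms(2)] by blast
      then obtain e' where "e' > 0" "ball s e' \<subseteq> ?J"
        using s unfolding open_contains_ball by blast
      then show "\<exists>e>0. ball s e \<subseteq> ?E"
        using e by (intro exI[of _ "min e e'"]) (auto simp: subset_iff dist_real_def abs_minus_commute)
    qed
    then show ?thesis by (auto intro: open_subset)
  qed
  ultimately have "?E = {} \<or> ?E = ?J"
    unfolding connected_clopen by blast
  then show ?thesis using t0 eq t by blast
qed

lemma integral_curve_shift:
  assumes "integral_curve M A v J \<gamma>"
  shows "integral_curve M A v {t. s + t \<in> J} (\<lambda>t. \<gamma> (s + t))"
  unfolding integral_curve_def
proof (intro conjI ballI impI)
  have eq: "{t. s + t \<in> J} = (+) (- s) ` J"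
    by (force simp: image_iff)
  show "open {t. s + t \<in> J}"
    unfolding eq using integral_curve_open[OF assms] by (rule open_translation)
  show "is_interval {t. s + t \<in> J}"
    unfolding eq using integral_curve_interval[OF assms] by auto
  have "continuous_map (top_of_set {t. s + t \<in> J}) (top_of_set J) (\<lambda>t. s + t)"
    by (auto intro!: continuous_intros)
  then show "continuous_map (top_of_set {t. s + t \<in> J}) M (\<lambda>t. \<gamma> (s + t))"
    using continuous_map_compose[OF _ integral_curve_continuous[OF assms], unfolded o_def] by blast
  fix t c assume "t \<in> {t. s + t \<in> J}" "c \<in> A" "\<gamma> (s + t) \<in> fst c"
  then have "((snd c \<circ> \<gamma>) has_vector_derivative v (\<gamma> (s + t)) c) (at (s + t))"
    using integral_curve_derivative[OF assms] by auto
  moreover have "((\<lambda>t. s + t) has_vector_derivative 1) (at t)"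
    by (auto intro!: derivative_eq_intros)
  ultimately show "((snd c \<circ> (\<lambda>t. \<gamma> (s + t))) has_vector_derivative v (\<gamma> (s + t)) c) (at t)"
    using vector_diff_chain_at[of "\<lambda>t. s + t" 1 t "snd c \<circ> \<gamma>"] by (simp add: o_def)
qed

text \<open>The last property is the joint continuity of the flow, stated by neighbourhoods.\<close>

lemma local_flow:
  assumes p: "p \<in> topspace M"
  obtains \<epsilon> U \<phi> where "\<epsilon> > 0" "openin M U" "p \<in> U"
    "\<And>x. x \<in> U \<Longrightarrow> \<phi> 0 x = x"
    "\<And>x. x \<in> U \<Longrightarrow> integral_curve M A v {-\<epsilon><..<\<epsilon>} (\<lambda>t. \<phi> t x)"
    "\<And>t0 x0 N. \<lbrakk>\<bar>t0\<bar> < \<epsilon>; x0 \<in> U; openin M N; \<phi> t0 x0 \<in> N\<rbrakk> \<Longrightarrow>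
       \<exists>\<eta>>0. \<exists>U'. openin M U' \<and> x0 \<in> U' \<and> U' \<subseteq> U \<and> (\<forall>t x. \<bar>t - t0\<bar> < \<eta> \<longrightarrow> x \<in> U' \<longrightarrow> \<phi> t x \<in> N)"
proof -
  obtain c where c: "c \<in> A" "p \<in> fst c" using obtain_chart[OF p] .
  let ?V = "\<lambda>y. v (chart_inv c y) c" and ?p = "snd c p"
  obtain R where R: "R > 0" "cball ?p R \<subseteq> snd c ` fst c"
    using chart_cball[OF c(1) openin_topspace p c(2)]
    by (metis chart_subset[OF c(1)] Int_absorb2)
  obtain L where L: "L-lipschitz_on (cball ?p R) ?V"
    using smooth_on_imp_lipschitz_on_cball[OF field_smooth[OF c(1)] R(2)] .
  obtain \<epsilon> r \<psi> where \<epsilon>: "\<epsilon> > 0" and r: "r > 0" "r \<le> R" and \<psi>0: "\<And>x. \<psi> 0 x = x"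
    and stay: "\<And>x t. x \<in> ball ?p r \<Longrightarrow> \<bar>t\<bar> < \<epsilon> \<Longrightarrow> \<psi> t x \<in> ball ?p R"
    and der: "\<And>x t. x \<in> ball ?p r \<Longrightarrow> \<bar>t\<bar> < \<epsilon> \<Longrightarrow>
       ((\<lambda>t. \<psi> t x) has_vector_derivative ?V (\<psi> t x)) (at t)"
    and cont: "continuous_on UNIV (\<lambda>(t, x). \<psi> t x)"
    by (rule local_flow_of_lipschitz[OF L R(1)]) blast
  define U where "U = {x \<in> fst c. snd c x \<in> ball ?p r}"
  define \<phi> where "\<phi> t x = chart_inv c (\<psi> t (snd c x))" for t x
  have R': "y \<in> snd c ` fst c" if "y \<in> ball ?p R" for y
    using R(2) that ball_subset_cball by blast
  have coord: "snd c (\<phi> t x) = \<psi> t (snd c x)" "\<phi> t x \<in> fst c" if "x \<in> U" "\<bar>t\<bar> < \<epsilon>" for t x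
    using that stay[of "snd c x" t] chart_inv_right[OF c(1) R'] chart_inv_in[OF c(1) R']
    by (auto simp: U_def \<phi>_def)
  have openU: "openin M U" unfolding U_def by (rule openin_chart_vimage[OF c(1) open_ball])
  have joint: "\<exists>\<eta>>0. \<exists>U'. openin M U' \<and> x0 \<in> U' \<and> U' \<subseteq> U \<and> (\<forall>t x. \<bar>t - t0\<bar> < \<eta> \<longrightarrow> x \<in> U' \<longrightarrow> \<phi> t x \<in> N)"
    if t0: "\<bar>t0\<bar> < \<epsilon>" and x0: "x0 \<in> U" and N: "openin M N" "\<phi> t0 x0 \<in> N" for t0 x0 N
  proof -
    let ?T = "snd c ` (fst c \<inter> N)"
    have "open ?T" using open_chart_image[OF c(1) N(1)] .
    then have "open ((\<lambda>(t, x). \<psi> t x) -` ?T)"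
      using cont by (rule open_vimage)
    moreover have "\<psi> t0 (snd c x0) \<in> ?T"
      using coord[OF x0 t0] N(2) by (metis IntI imageI)
    then have "(t0, snd c x0) \<in> (\<lambda>(t, x). \<psi> t x) -` ?T" by simp
    ultimately obtain e where e: "e > 0" "ball (t0, snd c x0) e \<subseteq> (\<lambda>(t, x). \<psi> t x) -` ?T"
      unfolding open_contains_ball by meson
    define \<eta> where "\<eta> = min (e / 2) (\<epsilon> - \<bar>t0\<bar>)"
    define U' where "U' = U \<inter> {x \<in> fst c. snd c x \<in> ball (snd c x0) (e / 2)}"
    show ?thesis
    proof (intro exI[of _ \<eta>] exI[of _ U'] conjI allI impI)
      show "\<eta> > 0" using e t0 by (auto simp: \<eta>_def)
      show "openin M U'" unfolding U'_def using openU openin_chart_vimage[OF c(1)] by blast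
      show "x0 \<in> U'" "U' \<subseteq> U" using x0 e by (auto simp: U'_def U_def)
      fix t x assume t: "\<bar>t - t0\<bar> < \<eta>" and x: "x \<in> U'"
      have "dist (t0, snd c x0) (t, snd c x) \<le> dist t0 t + dist (snd c x0) (snd c x)"
        unfolding dist_prod_def by (simp add: sqrt_sum_squares_le_sum)
      also have "\<dots> < e" using t x by (auto simp: \<eta>_def U'_def dist_real_def abs_minus_commute)
      finally have "\<psi> t (snd c x) \<in> ?T" using e(2) by auto
      then obtain z where z: "z \<in> fst c" "z \<in> N" "\<psi> t (snd c x) = snd c z" by auto
      have "\<bar>t\<bar> < \<epsilon>" using t by (auto simp: \<eta>_def)
      then show "\<phi> t x \<in> N" using z chart_inv_left[OF c(1) z(1)] by (simp add: \<phi>_def)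
    qed
  qed
  show ?thesis
  proof (rule that[of \<epsilon> U \<phi>, OF \<epsilon> openU _ _ _ joint])
    show "p \<in> U" using c r by (auto simp: U_def)
    show "\<phi> 0 x = x" if "x \<in> U" for x
      using that by (auto simp: \<phi>_def \<psi>0 U_def chart_inv_left[OF c(1)])
    show "integral_curve M A v {-\<epsilon><..<\<epsilon>} (\<lambda>t. \<phi> t x)" if x: "x \<in> U" for x
    proof (rule integral_curveI)
      show "continuous_map (top_of_set {-\<epsilon><..<\<epsilon>}) M (\<lambda>t. \<phi> t x)"
        unfolding continuous_map_def
      proof (intro conjI allI impI)
        show "(\<lambda>t. \<phi> t x) \<in> topspace (top_of_set {-\<epsilon><..<\<epsilon>}) \<rightarrow> topspace M"
          using coord(2)[OF x] chart_subset[OF c(1)] by (auto simp: abs_less_iff subset_iff)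
        fix N assume N: "openin M N"
        have "open {t \<in> {-\<epsilon><..<\<epsilon>}. \<phi> t x \<in> N}"
          unfolding open_contains_ball
        proof
          fix t0 assume t0: "t0 \<in> {t \<in> {-\<epsilon><..<\<epsilon>}. \<phi> t x \<in> N}"
          then obtain \<eta> where "\<eta> > 0" "\<And>t. \<bar>t - t0\<bar> < \<eta> \<Longrightarrow> \<phi> t x \<in> N"
            using joint[of t0 x N] x N unfolding mem_Collect_eq greaterThanLessThan_iff abs_less_iff
            by (metis minus_less_iff)
          then show "\<exists>e>0. ball t0 e \<subseteq> {t \<in> {-\<epsilon><..<\<epsilon>}. \<phi> t x \<in> N}"
            using t0 by (intro exI[of _ "min \<eta> (\<epsilon> - \<bar>t0\<bar>)"])
              (auto simp: dist_real_def abs_minus_commute)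
        qed
        then show "openin (top_of_set {-\<epsilon><..<\<epsilon>}) {t \<in> topspace (top_of_set {-\<epsilon><..<\<epsilon>}). \<phi> t x \<in> N}"
          by (auto intro: open_subset)
      qed
      fix t assume t: "t \<in> {-\<epsilon><..<\<epsilon>}"
      then have "((\<lambda>t. \<psi> t (snd c x)) has_vector_derivative v (\<phi> t x) c) (at t)"
        using der[of "snd c x" t] x by (auto simp: U_def \<phi>_def)
      then have "((snd c \<circ> (\<lambda>t. \<phi> t x)) has_vector_derivative v (\<phi> t x) c) (at t)"
        by (rule has_vector_derivative_transform_within_open[where S = "{-\<epsilon><..<\<epsilon>}"])
          (use t coord[OF x] in auto)
      then show "\<exists>c\<in>A. \<phi> t x \<in> fst c \<and> ((snd c \<circ> (\<lambda>t. \<phi> t x)) has_vector_derivative v (\<phi> t x) c) (at t)"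
        using c coord(2)[OF x] t by (intro bexI[of _ c]) (auto simp: abs_less_iff)
    qed auto
  qed
qed

text \<open>By uniqueness, all integral curves starting at \<open>x\<close> are restrictions of \<open>flow x\<close>, whose domain is the
  union of theirs; this is the maximal integral curve.\<close>

definition flow_domain :: "'a \<Rightarrow> real set" where
  "flow_domain x = \<Union>{J. \<exists>\<gamma>. integral_curve M A v J \<gamma> \<and> 0 \<in> J \<and> \<gamma> 0 = x}"

definition flow :: "'a \<Rightarrow> real \<Rightarrow> 'a" where
  "flow x t = (SOME y. \<exists>J \<gamma>. integral_curve M A v J \<gamma> \<and> 0 \<in> J \<and> t \<in> J \<and> \<gamma> 0 = x \<and> \<gamma> t = y)"

lemma flow_eq_integral_curve:
  assumes "integral_curve M A v J \<gamma>" "0 \<in> J" "\<gamma> 0 = x" "t \<in> J"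
  shows "t \<in> flow_domain x" "flow x t = \<gamma> t"
proof -
  show "t \<in> flow_domain x"
    using assms unfolding flow_domain_def by blast
  have "\<exists>J \<gamma>. integral_curve M A v J \<gamma> \<and> 0 \<in> J \<and> t \<in> J \<and> \<gamma> 0 = x \<and> \<gamma> t = flow x t"
    unfolding flow_def by (rule someI[of _ "\<gamma> t"]) (use assms in blast)
  then show "flow x t = \<gamma> t"
    using integral_curves_agree[OF _ assms(1)] assms(2-4) by metis
qed

lemma flow_domainE:
  assumes "t \<in> flow_domain x"
  obtains J \<gamma> where "integral_curve M A v J \<gamma>" "0 \<in> J" "\<gamma> 0 = x" "t \<in> J" "J \<subseteq> flow_domain x"
    "\<And>s. s \<in> J \<Longrightarrow> flow x s = \<gamma> s"
proof -
  obtain J \<gamma> where J: "integral_curve M A v J \<gamma>" "0 \<in> J" "\<gamma> 0 = x" "t \<in> J"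
    using assms unfolding flow_domain_def by blast
  show ?thesis
    using that[OF J] flow_eq_integral_curve[OF J(1-3)] by blast
qed

lemma zero_in_flow_domain: "x \<in> topspace M \<Longrightarrow> 0 \<in> flow_domain x"
  and flow_zero: "x \<in> topspace M \<Longrightarrow> flow x 0 = x"
proof -
  assume "x \<in> topspace M"
  then obtain \<epsilon> :: real and \<phi> where "\<epsilon> > 0" "\<phi> 0 x = x" "integral_curve M A v {-\<epsilon><..<\<epsilon>} (\<lambda>t. \<phi> t x)"
    by (rule local_flow) blast
  then show "0 \<in> flow_domain x" "flow x 0 = x"
    using flow_eq_integral_curve[of "{-\<epsilon><..<\<epsilon>}" "\<lambda>t. \<phi> t x" x 0] by auto
qed

lemma flow_integral_curve: "integral_curve M A v (flow_domain x) (flow x)"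
proof (rule integral_curveI)
  show op: "open (flow_domain x)"
    unfolding flow_domain_def by (rule open_Union) (auto dest: integral_curve_open)
  have "is_interval (flow_domain x)"
    unfolding is_interval_connected_1 flow_domain_def
    by (rule connected_Union) (auto dest: integral_curve_interval is_interval_connected)
  then show "is_interval (flow_domain x)" .
  show "continuous_map (top_of_set (flow_domain x)) M (flow x)"
    unfolding continuous_map_def
  proof (intro conjI allI impI)
    show "flow x \<in> topspace (top_of_set (flow_domain x)) \<rightarrow> topspace M"
      using integral_curve_in by (auto elim: flow_domainE)
    fix N assume N: "openin M N"
    have "open {t \<in> flow_domain x. flow x t \<in> N}"
    proof (subst open_subopen, intro ballI)
      fix t assume t: "t \<in> {t \<in> flow_domain x. flow x t \<in> N}"
      then have "t \<in> flow_domain x" by simp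
      then obtain J \<gamma> where J: "integral_curve M A v J \<gamma>" "t \<in> J" "J \<subseteq> flow_domain x"
        "\<And>s. s \<in> J \<Longrightarrow> flow x s = \<gamma> s"
        by (rule flow_domainE) blast
      have "open {s \<in> J. \<gamma> s \<in> N}"
        using curve_preimage_open integral_curve_continuous[OF J(1)] integral_curve_open[OF J(1)] N
        by blast
      then show "\<exists>T. open T \<and> t \<in> T \<and> T \<subseteq> {t \<in> flow_domain x. flow x t \<in> N}"
        using J t by (intro exI[of _ "{s \<in> J. \<gamma> s \<in> N}"]) auto
    qed
    then show "openin (top_of_set (flow_domain x)) {t \<in> topspace (top_of_set (flow_domain x)). flow x t \<in> N}"
      by (auto intro: open_subset)
  qed
  fix t assume t: "t \<in> flow_domain x"
  then obtain J \<gamma> where J: "integral_curve M A v J \<gamma>" "t \<in> J" "J \<subseteq> flow_domain x"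
    "\<And>s. s \<in> J \<Longrightarrow> flow x s = \<gamma> s"
    by (rule flow_domainE) blast
  obtain c where c: "c \<in> A" "\<gamma> t \<in> fst c"
    using obtain_chart integral_curve_in[OF J(1,2)] by blast
  have "((snd c \<circ> flow x) has_vector_derivative v (\<gamma> t) c) (at t)"
    by (rule has_vector_derivative_transform_within_open
        [OF integral_curve_derivative[OF J(1,2) c] integral_curve_open[OF J(1)] J(2)])
      (simp add: J(4))
  then show "\<exists>c\<in>A. flow x t \<in> fst c \<and> ((snd c \<circ> flow x) has_vector_derivative v (flow x t) c) (at t)"
    using c J by auto
qed

lemma flow_in: "t \<in> flow_domain x \<Longrightarrow> flow x t \<in> topspace M"
  using integral_curve_in[OF flow_integral_curve] .

lemma flow_shift_aux:
  assumes "s \<in> flow_domain x" "s + t \<in> flow_domain x"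
  shows "t \<in> flow_domain (flow x s)" "flow (flow x s) t = flow x (s + t)"
  using flow_eq_integral_curve[OF integral_curve_shift[OF flow_integral_curve[of x], of s], of "flow x s" t] assms
  by auto

lemma flow_shift:
  assumes x: "x \<in> topspace M" and s: "s \<in> flow_domain x"
  shows "t \<in> flow_domain (flow x s) \<longleftrightarrow> s + t \<in> flow_domain x"
    and "s + t \<in> flow_domain x \<Longrightarrow> flow (flow x s) t = flow x (s + t)"
proof -
  have bwd: "- s \<in> flow_domain (flow x s)" "flow (flow x s) (- s) = x"
    using flow_shift_aux[OF s, of "- s"] zero_in_flow_domain[OF x] flow_zero[OF x] by auto
  show "t \<in> flow_domain (flow x s) \<longleftrightarrow> s + t \<in> flow_domain x"
    using flow_shift_aux[OF s, of t] flow_shift_aux(1)[OF bwd(1), of "s + t"] bwd(2) by auto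
  show "s + t \<in> flow_domain x \<Longrightarrow> flow (flow x s) t = flow x (s + t)"
    using flow_shift_aux[OF s] by blast
qed

section \<open>Orbits\<close>

abbreviation orb :: "'a \<Rightarrow> 'a set" where "orb \<equiv> orbit M A v"

lemma orbit_eq_flow_image:
  assumes x: "x \<in> topspace M"
  shows "orb x = flow x ` flow_domain x"
proof
  have "maximal_integral_curve M A v (flow_domain x) (flow x)"
    unfolding maximal_integral_curve_def
  proof (intro conjI allI impI flow_integral_curve)
    fix J \<gamma> assume *: "integral_curve M A v J \<gamma> \<and> flow_domain x \<subseteq> J \<and> (\<forall>t\<in>flow_domain x. \<gamma> t = flow x t)"
    then have "0 \<in> J" "\<gamma> 0 = x" using zero_in_flow_domain[OF x] flow_zero[OF x] by auto
    then show "J = flow_domain x" using * flow_eq_integral_curve(1) by blast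
  qed
  then show "flow x ` flow_domain x \<subseteq> orb x"
    unfolding orbit_def using zero_in_flow_domain[OF x] flow_zero[OF x] by blast
  show "orb x \<subseteq> flow x ` flow_domain x"
  proof
    fix y assume "y \<in> orb x"
    then obtain J \<gamma> t where "maximal_integral_curve M A v J \<gamma>" "0 \<in> J" "\<gamma> 0 = x" "t \<in> J" "y = \<gamma> t"
      unfolding orbit_def by blast
    then show "y \<in> flow x ` flow_domain x"
      using flow_eq_integral_curve[of J \<gamma> x t] unfolding maximal_integral_curve_def by (metis imageI)
  qed
qed

lemma in_orbit_self: "x \<in> topspace M \<Longrightarrow> x \<in> orb x"
  using zero_in_flow_domain flow_zero by (force simp: orbit_eq_flow_image)

lemma orbit_flow:
  assumes x: "x \<in> topspace M" and s: "s \<in> flow_domain x"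
  shows "orb (flow x s) = orb x"
proof -
  have "flow (flow x s) ` flow_domain (flow x s) = flow x ` flow_domain x"
  proof
    show "flow (flow x s) ` flow_domain (flow x s) \<subseteq> flow x ` flow_domain x"
      using flow_shift[OF x s] by auto
    show "flow x ` flow_domain x \<subseteq> flow (flow x s) ` flow_domain (flow x s)"
    proof
      fix y assume "y \<in> flow x ` flow_domain x"
      then obtain t where "t \<in> flow_domain x" "y = flow x t" by blast
      then show "y \<in> flow (flow x s) ` flow_domain (flow x s)"
        using flow_shift[OF x s, of "t - s"] by (auto intro!: image_eqI[of _ _ "t - s"])
    qed
  qed
  then show ?thesis using orbit_eq_flow_image[OF x] orbit_eq_flow_image[OF flow_in[OF s]] by simp
qed

lemma orbit_integral_curve:
  assumes "integral_curve M A v J \<gamma>" "s \<in> J" "t \<in> J"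
  shows "orb (\<gamma> s) = orb (\<gamma> t)"
proof -
  have "integral_curve M A v {r. s + r \<in> J} (\<lambda>r. \<gamma> (s + r))"
    using integral_curve_shift[OF assms(1)] .
  from flow_eq_integral_curve[OF this _ _, of "\<gamma> s" "t - s"] assms
  have "t - s \<in> flow_domain (\<gamma> s)" "flow (\<gamma> s) (t - s) = \<gamma> t" by auto
  then show ?thesis
    using orbit_flow[of "\<gamma> s" "t - s"] integral_curve_in[OF assms(1,2)] by simp
qed

lemma stationary_orbit:
  assumes p: "p \<in> topspace M" and v: "\<And>c. c \<in> A \<Longrightarrow> p \<in> fst c \<Longrightarrow> v p c = 0"
  shows "orb p = {p}"
proof -
  have "integral_curve M A v UNIV (\<lambda>t. p)"
    unfolding integral_curve_def using p v by (auto simp: o_def)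
  from flow_eq_integral_curve(2)[OF this, of p] have "flow p t = p" for t
    by auto
  then show ?thesis
    using zero_in_flow_domain[OF p] by (auto simp: orbit_eq_flow_image[OF p])
qed

text \<open>The interior of the saturation of an open set is invariant under the flow for short times, by
  continuity of the local flow; as flow lines are connected, it contains every orbit that it meets.\<close>

lemma openin_saturation:
  assumes U: "openin M U"
  shows "openin M {y \<in> topspace M. orb y \<in> orb ` U}"
proof -
  let ?S = "{y \<in> topspace M. orb y \<in> orb ` U}"
  define I where "I = M interior_of ?S"
  have I: "openin M I" "I \<subseteq> ?S" by (auto simp: I_def interior_of_subset)
  have "U \<subseteq> I"
    unfolding I_def using U openin_subset[OF U] by (intro interior_of_maximal) auto
  have invariant: "\<exists>e>0. \<forall>s. \<bar>s - t\<bar> < e \<longrightarrow> (s \<in> flow_domain x \<and> (flow x s \<in> I \<longleftrightarrow> flow x t \<in> I))"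
    if t: "t \<in> flow_domain x" for x t
  proof -
    define p where "p = flow x t"
    have p: "p \<in> topspace M" using flow_in[OF t] by (simp add: p_def)
    obtain \<epsilon> V \<phi> where \<epsilon>: "\<epsilon> > 0" "openin M V" "p \<in> V" and \<phi>0: "\<And>x. x \<in> V \<Longrightarrow> \<phi> 0 x = x"
      and \<phi>: "\<And>x. x \<in> V \<Longrightarrow> integral_curve M A v {-\<epsilon><..<\<epsilon>} (\<lambda>t. \<phi> t x)"
      and joint: "\<And>t0 x0 N. \<lbrakk>\<bar>t0\<bar> < \<epsilon>; x0 \<in> V; openin M N; \<phi> t0 x0 \<in> N\<rbrakk> \<Longrightarrow>
       \<exists>\<eta>>0. \<exists>U'. openin M U' \<and> x0 \<in> U' \<and> U' \<subseteq> V \<and> (\<forall>t x. \<bar>t - t0\<bar> < \<eta> \<longrightarrow> x \<in> U' \<longrightarrow> \<phi> t x \<in> N)"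
      by (rule local_flow[OF p]) blast
    obtain e where e: "e > 0" "\<And>s. \<bar>s - t\<bar> < e \<Longrightarrow> s \<in> flow_domain x \<and> flow x s \<in> V"
      using curve_stays_near[OF integral_curve_continuous[OF flow_integral_curve]
          integral_curve_open[OF flow_integral_curve] \<epsilon>(2) t] \<epsilon>(3) p_def by metis
    have transfer: "flow x r \<in> I"
      if rr: "\<bar>r - t\<bar> < e" "\<bar>r' - t\<bar> < e" "\<bar>r' - r\<bar> < \<epsilon>" "flow x r' \<in> I" for r r'
    proof -
      define z where "z = flow x r"
      have z: "z \<in> V" "r \<in> flow_domain x" "r' \<in> flow_domain x" using e(2) rr by (auto simp: z_def)
      have "integral_curve M A v {t. r + t \<in> flow_domain x} (\<lambda>t. flow x (r + t))"
        by (rule integral_curve_shift[OF flow_integral_curve])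
      then have "(\<lambda>t. \<phi> t z) (r' - r) = (\<lambda>t. flow x (r + t)) (r' - r)"
        by (rule integral_curves_agree[OF \<phi>[OF z(1)], where ?t0.0 = 0])
          (use z rr(3) \<epsilon>(1) \<phi>0 in \<open>auto simp: z_def abs_less_iff\<close>)
      then have "\<phi> (r' - r) z \<in> I" using rr by simp
      then obtain U' where U': "openin M U'" "z \<in> U'" "U' \<subseteq> V" "\<And>x. x \<in> U' \<Longrightarrow> \<phi> (r' - r) x \<in> I"
        using joint[OF rr(3) z(1) I(1)] by fastforce
      have "U' \<subseteq> ?S"
      proof
        fix y assume y: "y \<in> U'"
        then have "orb y = orb (\<phi> (r' - r) y)"
          using orbit_integral_curve[OF \<phi>[of y], of 0 "r' - r"] \<phi>0[of y] U'(3) \<epsilon>(1) rr(3)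
          by (simp add: subset_iff abs_less_iff)
        also have "\<dots> \<in> orb ` U" using U'(4)[OF y] I(2) by blast
        finally show "y \<in> ?S" using y U'(1) openin_subset by blast
      qed
      then have "U' \<subseteq> I" unfolding I_def using U'(1) by (intro interior_of_maximal)
      then show ?thesis using U'(2) by (auto simp: z_def)
    qed
    show ?thesis
    proof (intro exI[of _ "min e \<epsilon>"] conjI allI impI)
      fix s assume "\<bar>s - t\<bar> < min e \<epsilon>"
      then have s: "\<bar>s - t\<bar> < e" "\<bar>s - t\<bar> < \<epsilon>" "\<bar>t - s\<bar> < \<epsilon>" "\<bar>t - t\<bar> < e"
        using e(1) by auto
      show "s \<in> flow_domain x" using e(2)[OF s(1)] by simp
      show "flow x s \<in> I \<longleftrightarrow> flow x t \<in> I"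
        using transfer[OF s(1,4,3)] transfer[OF s(4,1,2)] by blast
    qed (use e(1) \<epsilon>(1) in simp)
  qed
  have "?S \<subseteq> I"
  proof
    fix y assume "y \<in> ?S"
    then obtain x where y: "y \<in> topspace M" and x: "x \<in> U" "orb y = orb x" by auto
    then have "x \<in> topspace M" using openin_subset[OF U] by blast
    then obtain s where s: "s \<in> flow_domain x" "y = flow x s"
      using in_orbit_self[OF y] x(2) by (auto simp: orbit_eq_flow_image)
    let ?D = "flow_domain x"
    let ?E = "{t \<in> ?D. flow x t \<in> I}"
    have "open {t \<in> ?D. Q (flow x t \<in> I)}" for Q
      unfolding open_dist dist_real_def
    proof
      fix t assume "t \<in> {t \<in> ?D. Q (flow x t \<in> I)}"
      then have t: "t \<in> ?D" "Q (flow x t \<in> I)" by auto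
      show "\<exists>e>0. \<forall>s. \<bar>s - t\<bar> < e \<longrightarrow> s \<in> {t \<in> ?D. Q (flow x t \<in> I)}"
        using invariant[OF t(1)]
      proof (elim exE conjE, intro exI conjI allI impI)
        fix e s :: real
        assume "\<forall>s. \<bar>s - t\<bar> < e \<longrightarrow> s \<in> ?D \<and> (flow x s \<in> I \<longleftrightarrow> flow x t \<in> I)" "\<bar>s - t\<bar> < e"
        then have "s \<in> ?D" "(flow x s \<in> I) = (flow x t \<in> I)" by blast+
        then show "s \<in> {t \<in> ?D. Q (flow x t \<in> I)}"
          using t(2) by simp
      qed
    qed
    from this[of "\<lambda>b. b"] this[of Not]
    have "open {t \<in> ?D. flow x t \<in> I}" "open {t \<in> ?D. flow x t \<notin> I}" by auto
    moreover have "connected ?D"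
      using integral_curve_interval[OF flow_integral_curve] by (rule is_interval_connected)
    moreover have "0 \<in> ?E"
      using zero_in_flow_domain flow_zero \<open>x \<in> topspace M\<close> x(1) \<open>U \<subseteq> I\<close> by auto
    ultimately have "{t \<in> ?D. flow x t \<notin> I} = {}"
      using connectedD[of ?D "{t \<in> ?D. flow x t \<in> I}" "{t \<in> ?D. flow x t \<notin> I}"] by blast
    then show "y \<in> I" using s by blast
  qed
  then have "?S = I" using I(2) by blast
  then show ?thesis using I(1) by simp
qed

end

section \<open>Nondegenerate critical points in Euclidean space\<close>

lemma smooth_partial_differentiable:
  assumes "smooth_on S F" "y \<in> S"
  shows "(\<lambda>x. frechet_derivative F (at x) u) differentiable (at y)"
proof -
  have "Ck_on (Suc (Suc 0)) S F"
    using assms(1) unfolding smooth_on_def by blast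
  then show ?thesis using assms(2) by auto
qed

lemma frechet_derivative_eq_sum_partials:
  fixes F :: "real^'m \<Rightarrow> real"
  assumes "F differentiable (at y)"
  shows "frechet_derivative F (at y) u = (\<Sum>j\<in>UNIV. u $ j * frechet_derivative F (at y) (axis j 1))"
proof -
  have lin: "linear (frechet_derivative F (at y))"
    using assms by (rule linear_frechet_derivative)
  have "frechet_derivative F (at y) u = frechet_derivative F (at y) (\<Sum>j\<in>UNIV. u $ j *\<^sub>R axis j 1)"
    using basis_expansion[of u] by (simp add: scalar_mult_eq_scaleR)
  also have "\<dots> = (\<Sum>j\<in>UNIV. u $ j * frechet_derivative F (at y) (axis j 1))"
    by (simp add: linear_sum[OF lin] linear_scale[OF lin])
  finally show ?thesis .
qed

lemma derivative_along_field_has_derivative: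
  fixes F :: "real^'m \<Rightarrow> real" and V :: "real^'m \<Rightarrow> real^'m"
  assumes F: "smooth_on S F" and V: "smooth_on S V" and "open S" and y: "y \<in> S"
  shows "((\<lambda>y. frechet_derivative F (at y) (V y)) has_derivative
    (\<lambda>h. \<Sum>j\<in>UNIV. V y $ j * frechet_derivative (\<lambda>x. frechet_derivative F (at x) (axis j 1)) (at y) h
      + (frechet_derivative V (at y) h) $ j * frechet_derivative F (at y) (axis j 1))) (at y)"
proof -
  have dV: "(V has_derivative frechet_derivative V (at y)) (at y)"
    using smooth_on_differentiable[OF V y] by (simp add: frechet_derivative_works)
  have dVj: "((\<lambda>y. V y $ j) has_derivative (\<lambda>h. frechet_derivative V (at y) h $ j)) (at y)" for j
    using bounded_linear.has_derivative[OF bounded_linear_vec_nth dV] .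
  have dF: "((\<lambda>x. frechet_derivative F (at x) u) has_derivative
      frechet_derivative (\<lambda>x. frechet_derivative F (at x) u) (at y)) (at y)" for u
    using smooth_partial_differentiable[OF F y] by (simp add: frechet_derivative_works)
  have "((\<lambda>y. \<Sum>j\<in>UNIV. V y $ j * frechet_derivative F (at y) (axis j 1)) has_derivative
    (\<lambda>h. \<Sum>j\<in>UNIV. V y $ j * frechet_derivative (\<lambda>x. frechet_derivative F (at x) (axis j 1)) (at y) h
      + (frechet_derivative V (at y) h) $ j * frechet_derivative F (at y) (axis j 1))) (at y)"
    by (intro has_derivative_sum has_derivative_mult dVj dF)
  then show ?thesis
    by (rule has_derivative_transform_within_open[OF _ \<open>open S\<close> y])
      (rule frechet_derivative_eq_sum_partials[symmetric, OF smooth_on_differentiable[OF F]])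
qed

text \<open>At a critical point of \<open>F\<close> the derivative of \<open>V(F)\<close> is the Hessian of \<open>F\<close> applied to \<open>V\<close>; it vanishes at
  a minimum of \<open>V(F)\<close>.\<close>

lemma field_vanishes_at_nondegenerate_minimum:
  fixes F :: "real^'m::finite \<Rightarrow> real" and V :: "real^'m \<Rightarrow> real^'m"
  assumes F: "smooth_on S F" and V: "smooth_on S V" and S: "open S" and y: "y \<in> S"
    and crit: "\<And>u. frechet_derivative F (at y) u = 0"
    and T: "open T" "y \<in> T"
    and min: "\<And>z. z \<in> T \<Longrightarrow> frechet_derivative F (at y) (V y) \<le> frechet_derivative F (at z) (V z)"
    and inv: "invertible (hessian F y)"
  shows "V y = 0"
proof -
  have "(\<lambda>h. \<Sum>j\<in>UNIV. V y $ j * frechet_derivative (\<lambda>x. frechet_derivative F (at x) (axis j 1)) (at y) h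
      + (frechet_derivative V (at y) h) $ j * frechet_derivative F (at y) (axis j 1)) = (\<lambda>h. 0)"
    by (rule differential_zero_maxmin[OF T(2,1) derivative_along_field_has_derivative[OF F V S y]])
      (use min in blast)
  then have "(\<Sum>j\<in>UNIV. V y $ j *
      frechet_derivative (\<lambda>x. frechet_derivative F (at x) (axis j 1)) (at y) h) = 0" for h
    by (simp add: crit fun_eq_iff)
  then have "hessian F y *v V y = 0"
    by (simp add: vec_eq_iff matrix_vector_mult_def hessian_def mult.commute)
  then show ?thesis
    using inj_matrix_vector_mult[OF inv] by (metis injD matrix_vector_mult_0_right)
qed

text \<open>The gradient map has an injective derivative at a nondegenerate critical point, namely the transposed
  Hessian, and so does not return to \<open>0\<close> nearby.\<close>

lemma nondegenerate_critical_point_isolated: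
  fixes F :: "real^'m::finite \<Rightarrow> real"
  assumes F: "smooth_on S F" and y: "y \<in> S"
    and crit: "\<And>u. frechet_derivative F (at y) u = 0"
    and inv: "invertible (hessian F y)"
  obtains e where "e > 0"
    "\<And>z. dist z y < e \<Longrightarrow> z \<noteq> y \<Longrightarrow> \<exists>u. frechet_derivative F (at z) u \<noteq> 0"
proof -
  define D where "D j = frechet_derivative (\<lambda>x. frechet_derivative F (at x) (axis j 1)) (at y)" for j
  define L where "L h = (\<chi> j. D j h)" for h
  define grad where "grad z = (\<chi> j. frechet_derivative F (at z) (axis j 1))" for z
  have dF: "((\<lambda>x. frechet_derivative F (at x) (axis j 1)) has_derivative D j) (at y)" for j
    using smooth_partial_differentiable[OF F y] by (simp add: frechet_derivative_works D_def)
  have dgrad: "(grad has_derivative L) (at y)"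
    unfolding grad_def[abs_def] L_def[abs_def]
    by (rule has_derivative_componentwise_within[THEN iffD2])
      (auto simp: Basis_vec_def inner_axis dF)
  then have lin: "linear L" by (rule has_derivative_linear)
  have "L h = transpose (hessian F y) *v h" for h
  proof -
    have "D j h = (\<Sum>i\<in>UNIV. h $ i * D j (axis i 1))" for j
      unfolding D_def
      by (rule frechet_derivative_eq_sum_partials[OF smooth_partial_differentiable[OF F y]])
    then show ?thesis
      by (simp add: L_def vec_eq_iff matrix_vector_mult_def transpose_def hessian_def D_def mult.commute)
  qed
  moreover have "inj ((*v) (transpose (hessian F y)))"
    using inv by (intro inj_matrix_vector_mult) (simp add: invertible_det_nz det_transpose)
  ultimately have "inj L" by (simp add: inj_def)
  then obtain B where B: "B > 0" "\<And>h. B * norm h \<le> norm (L h)"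
    using linear_inj_bounded_below_pos[OF lin] by blast
  have grad0: "grad y = 0" by (simp add: grad_def crit vec_eq_iff)
  obtain e where e: "e > 0"
    "\<And>z. norm (z - y) < e \<Longrightarrow> norm (grad z - grad y - L (z - y)) \<le> B / 2 * norm (z - y)"
    using dgrad B(1) unfolding has_derivative_at_alt by (metis half_gt_zero)
  show ?thesis
  proof (rule that[OF e(1)])
    fix z assume z: "dist z y < e" "z \<noteq> y"
    have "grad z \<noteq> 0"
    proof
      assume "grad z = 0"
      then have "norm (L (z - y)) \<le> B / 2 * norm (z - y)"
        using e(2)[of z] z(1) by (simp add: grad0 dist_norm)
      then have "B * norm (z - y) \<le> B / 2 * norm (z - y)"
        using B(2)[of "z - y"] by linarith
      then show False using B(1) z(2) by (simp add: field_simps)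
    qed
    then show "\<exists>u. frechet_derivative F (at z) u \<noteq> 0"
      by (auto simp: grad_def vec_eq_iff)
  qed
qed

section \<open>Selections and crossings on the real line\<close>

text \<open>Local constant selections are averaged with a subordinate partition of unity.\<close>

lemma continuous_selection_real:
  fixes S :: "real set" and G :: "real \<Rightarrow> real set"
  assumes conv: "\<And>t. t \<in> S \<Longrightarrow> convex (G t)"
    and loc: "\<And>t0. t0 \<in> S \<Longrightarrow> \<exists>c. \<exists>d>0. \<forall>t\<in>S. \<bar>t - t0\<bar> < d \<longrightarrow> c \<in> G t"
  obtains h where "continuous_on S h" "\<And>t. t \<in> S \<Longrightarrow> h t \<in> G t"
proof -
  define \<B> where "\<B> = {T. open T \<and> (\<exists>c. \<forall>t\<in>S \<inter> T. c \<in> G t)}"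
  have "S \<subseteq> \<Union>\<B>"
  proof
    fix t0 assume "t0 \<in> S"
    then obtain c d where d: "d > 0" "\<forall>t\<in>S. \<bar>t - t0\<bar> < d \<longrightarrow> c \<in> G t" using loc by blast
    then have "ball t0 d \<in> \<B>"
      unfolding \<B>_def by (auto simp: dist_real_def abs_minus_commute intro!: exI[of _ c])
    then show "t0 \<in> \<Union>\<B>" using d(1) by (auto intro!: bexI[of _ "ball t0 d"])
  qed
  then obtain \<C> where cover: "S \<subseteq> \<Union>\<C>"
    and fine: "\<And>U. U \<in> \<C> \<Longrightarrow> open U \<and> (\<exists>T. T \<in> \<B> \<and> U \<subseteq> T)"
    and fin: "\<And>x. x \<in> S \<Longrightarrow> \<exists>V. open V \<and> x \<in> V \<and> finite {U. U \<in> \<C> \<and> (U \<inter> V \<noteq> {})}"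
    by (rule paracompact) (auto simp: \<B>_def)
  have "\<exists>c. \<forall>t\<in>S \<inter> U. c \<in> G t" if "U \<in> \<C>" for U
    using fine[OF that] unfolding \<B>_def by blast
  then obtain c where c: "\<And>U t. U \<in> \<C> \<Longrightarrow> t \<in> S \<Longrightarrow> t \<in> U \<Longrightarrow> c U \<in> G t" by (metis IntI)
  obtain H :: "[real set, real] \<Rightarrow> real"
    where Hcont: "\<And>U. U \<in> \<C> \<Longrightarrow> continuous_on S (H U) \<and> (\<forall>x\<in>S. 0 \<le> H U x)"
      and H0: "\<And>x U. \<lbrakk>U \<in> \<C>; x \<in> S; x \<notin> U\<rbrakk> \<Longrightarrow> H U x = 0"
      and H1: "\<And>x. x \<in> S \<Longrightarrow> supp_sum (\<lambda>W. H W x) \<C> = 1"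
      and Hfin: "\<And>x. x \<in> S \<Longrightarrow> \<exists>V. open V \<and> x \<in> V \<and> finite {U \<in> \<C>. \<exists>x\<in>V. H U x \<noteq> 0}"
    by (rule subordinate_partition_of_unity[OF cover _ fin]) (use fine in auto)
  define h where "h t = supp_sum (\<lambda>U. H U t *\<^sub>R c U) \<C>" for t
  show ?thesis
  proof (rule that[of h])
    show "h t \<in> G t" if t: "t \<in> S" for t
    proof -
      have "finite {U \<in> \<C>. H U t \<noteq> 0}"
        using Hfin[OF t] by (auto elim: rev_finite_subset)
      moreover have "0 \<le> H U t \<and> (H U t = 0 \<or> c U \<in> G t)" if "U \<in> \<C>" for U
        using that t Hcont H0 c by blast
      ultimately show ?thesis
        unfolding h_def using H1[OF t]
        by (intro convex_supp_sum[OF conv[OF t]]) (auto simp: support_on_def)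
    qed
    show "continuous_on S h"
      unfolding continuous_on_eq_continuous_within
    proof
      fix a assume a: "a \<in> S"
      obtain V where V: "open V" "a \<in> V" "finite {U \<in> \<C>. \<exists>x\<in>V. H U x \<noteq> 0}"
        using Hfin[OF a] by blast
      let ?\<U> = "{U \<in> \<C>. \<exists>x\<in>V. H U x \<noteq> 0}"
      have eq: "(\<Sum>U\<in>?\<U>. H U x *\<^sub>R c U) = h x" if "x \<in> S \<inter> V" for x
        unfolding h_def supp_sum_def support_on_def
        by (rule sum.mono_neutral_right[OF V(3)]) (use that in auto)
      show "continuous (at a within S) h"
      proof (rule continuous_transform_within_openin[where S = "S \<inter> V"])
        show "continuous (at a within S) (\<lambda>x. \<Sum>U\<in>?\<U>. H U x *\<^sub>R c U)"
          using Hcont a by (intro continuous_intros) (auto simp: continuous_on_eq_continuous_within)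
      qed (use V a eq in auto)
    qed
  qed
qed

lemma last_crossing:
  fixes h :: "real \<Rightarrow> real"
  assumes h: "continuous_on {a..b} h" and "a \<le> b" "h a \<le> c" "c \<le> h b"
  obtains t where "a \<le> t" "t \<le> b" "h t = c" "\<And>r. t \<le> r \<Longrightarrow> r \<le> b \<Longrightarrow> c \<le> h r"
proof -
  let ?Z = "{t \<in> {a..b}. h t = c}"
  have "closed ?Z"
    using continuous_closed_preimage_constant[OF h closed_atLeastAtMost] by auto
  then have "compact ?Z"
    by (rule compact_eq_bounded_closed[THEN iffD2, OF conjI[rotated]])
      (auto intro: bounded_subset[OF bounded_closed_interval])
  moreover have "?Z \<noteq> {}"
    using IVT'[of h a c b] assms by auto
  ultimately obtain t where t: "t \<in> ?Z" "\<And>r. r \<in> ?Z \<Longrightarrow> r \<le> t"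
    using compact_attains_sup[of ?Z] by metis
  show ?thesis
  proof (rule that)
    fix r assume r: "t \<le> r" "r \<le> b"
    show "c \<le> h r"
    proof (rule ccontr)
      assume "\<not> c \<le> h r"
      moreover have "continuous_on {r..b} h"
        using h by (rule continuous_on_subset) (use r t in auto)
      ultimately obtain s where "r \<le> s" "s \<le> b" "h s = c"
        using IVT'[of h r c b] assms(4) r by auto
      moreover from this have "s \<le> t" using t r by auto
      ultimately have "r = t" using r by simp
      then show False using \<open>\<not> c \<le> h r\<close> t by simp
    qed
  qed (use t in auto)
qed

section \<open>Gradient fields of Morse functions\<close>

context manifold_with_field
begin

text \<open>A coordinate vector extends to a tangent vector through the derivatives of the coordinate changes,
  by the chain rule.\<close>

lemma tangent_vector_with_coordinate:
  assumes c: "c \<in> A" "p \<in> fst c"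
  obtains w where "w \<in> tangent_space A p" "w c = u"
proof -
  define w where "w = restrict (\<lambda>d. frechet_derivative (transition c d) (at (snd c p)) u) {d \<in> A. p \<in> fst d}"
  have smooth: "smooth_on (snd d ` (fst d \<inter> fst e)) (transition d e)" if "d \<in> A" "e \<in> A" for d e
    using manifold that by (simp add: smooth_manifold_def)
  have dtrans: "(transition d e has_derivative frechet_derivative (transition d e) (at (snd d p))) (at (snd d p))"
    if "d \<in> A" "p \<in> fst d" "e \<in> A" "p \<in> fst e" for d e
    using smooth_on_differentiable[OF smooth[OF that(1,3)], of "snd d p"] that
    by (simp add: frechet_derivative_works)
  have chain: "w e = frechet_derivative (transition d e) (at (snd d p)) (w d)"
    if d: "d \<in> A" "p \<in> fst d" and e: "e \<in> A" "p \<in> fst e" for d e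
  proof -
    have cd: "transition c d (snd c p) = snd d p"
      using c by (simp add: transition_def chart_inv_left)
    let ?N = "fst d \<inter> fst e"
    have "openin M ?N" using d e chart_openin by blast
    then have op: "open (snd c ` (fst c \<inter> ?N))" by (rule open_chart_image[OF c(1)])
    have "((transition d e \<circ> transition c d) has_derivative
        frechet_derivative (transition d e) (at (snd d p)) \<circ> frechet_derivative (transition c d) (at (snd c p)))
        (at (snd c p))"
      using diff_chain_at[OF dtrans[OF c d]] dtrans[OF d e] cd by simp
    then have "(transition c e has_derivative
        frechet_derivative (transition d e) (at (snd d p)) \<circ> frechet_derivative (transition c d) (at (snd c p)))
        (at (snd c p))"
    proof (rule has_derivative_transform_within_open[OF _ op])
      show "(transition d e \<circ> transition c d) y = transition c e y" if y: "y \<in> snd c ` (fst c \<inter> ?N)" for y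
        using y c d by (auto simp: transition_def chart_inv_left)
    qed (use c d e in auto)
    from frechet_derivative_at[OF this, symmetric] show ?thesis
      using d e by (simp add: w_def)
  qed
  have "w c = u"
  proof -
    have "((\<lambda>y. y) has_derivative (\<lambda>h. h)) (at (snd c p))"
      by (rule has_derivative_ident)
    then have "(transition c c has_derivative (\<lambda>h. h)) (at (snd c p))"
      by (rule has_derivative_transform_within_open[OF _ chart_image_open[OF c(1)]])
        (use c in \<open>auto simp: transition_def chart_inv_left\<close>)
    then have "frechet_derivative (transition c c) (at (snd c p)) = (\<lambda>h. h)"
      by (rule frechet_derivative_at[symmetric])
    then show ?thesis using c by (simp add: w_def)
  qed
  moreover have "w \<in> tangent_space A p"
    unfolding tangent_space_def mem_Collect_eq
  proof (intro conjI ballI impI)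
    show "w \<in> extensional {d \<in> A. p \<in> fst d}" by (simp add: w_def)
  qed (use chain in blast)
  ultimately show ?thesis using that by blast
qed

lemma continuous_map_if_continuous_in_charts:
  fixes g :: "'a \<Rightarrow> real"
  assumes g: "\<And>c. c \<in> A \<Longrightarrow> continuous_on (snd c ` fst c) (g \<circ> chart_inv c)"
  shows "continuous_map M euclideanreal g"
  unfolding continuous_map_def
proof (intro conjI allI impI)
  fix T :: "real set" assume "openin euclidean T"
  then have T: "open T" by simp
  show "openin M {x \<in> topspace M. g x \<in> T}"
  proof (subst openin_subopen, intro ballI)
    fix x assume x: "x \<in> {x \<in> topspace M. g x \<in> T}"
    then obtain c where c: "c \<in> A" "x \<in> fst c" using obtain_chart by blast
    let ?S = "snd c ` fst c"
    have "open (?S \<inter> (g \<circ> chart_inv c) -` T)"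
      by (rule continuous_open_preimage[OF g[OF c(1)] chart_image_open[OF c(1)] T])
    from openin_chart_vimage[OF c(1) this]
    show "\<exists>N. openin M N \<and> x \<in> N \<and> N \<subseteq> {x \<in> topspace M. g x \<in> T}"
      using c x chart_subset[OF c(1)]
      by (intro exI[of _ "{x \<in> fst c. snd c x \<in> ?S \<inter> (g \<circ> chart_inv c) -` T}"] conjI)
        (auto simp: chart_inv_left dest: inj_onD[OF chart_inj[OF c(1)]])
  qed
qed auto

end

locale gradient_field = manifold_with_field M A v
  for M :: "'a topology" and A :: "('a, 'm::finite) chart set" and v +
  fixes f :: "'a \<Rightarrow> real"
  assumes morse: "morse_function M A f" and gradient: "is_gradient M A f v"
begin

abbreviation crit :: "'a set" where "crit \<equiv> critical_points M A f"

definition slope :: "'a \<Rightarrow> real" where "slope = directional_derivative A v f"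

lemma f_smooth: "c \<in> A \<Longrightarrow> smooth_on (snd c ` fst c) (f \<circ> chart_inv c)"
  using morse by (simp add: morse_function_def smooth_function_def)

lemma slope_in_chart:
  assumes c: "c \<in> A" "p \<in> fst c"
  shows "slope p = frechet_derivative (f \<circ> chart_inv c) (at (snd c p)) (v p c)"
proof -
  have "v p \<in> tangent_space A p"
    using field chart_subset[OF c(1)] c(2) unfolding smooth_vector_field_def by blast
  then show ?thesis
    unfolding slope_def directional_derivative_def
    using differential_in_chart[OF manifold _ c] morse by (simp add: morse_function_def)
qed

lemma slope_pos: "p \<in> topspace M \<Longrightarrow> p \<notin> crit \<Longrightarrow> slope p > 0"
  using gradient by (simp add: is_gradient_def slope_def)

lemma critical_in_chart:
  assumes c: "c \<in> A" "p \<in> fst c"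
  shows "p \<in> crit \<longleftrightarrow> (\<forall>u. frechet_derivative (f \<circ> chart_inv c) (at (snd c p)) u = 0)"
proof -
  have *: "differential A f p w = frechet_derivative (f \<circ> chart_inv c) (at (snd c p)) (w c)"
    if "w \<in> tangent_space A p" for w
    using differential_in_chart[OF manifold _ c that] morse by (simp add: morse_function_def)
  have "p \<in> topspace M" using c chart_subset by blast
  then show ?thesis
    unfolding critical_points_def using * tangent_vector_with_coordinate[OF c]
    by (auto; metis)
qed

lemma slope_critical: "p \<in> crit \<Longrightarrow> slope p = 0"
proof -
  assume p: "p \<in> crit"
  then obtain c where "c \<in> A" "p \<in> fst c"
    using obtain_chart by (auto simp: critical_points_def)
  then show ?thesis using slope_in_chart critical_in_chart p by simp
qed

lemma slope_nonneg: "p \<in> topspace M \<Longrightarrow> slope p \<ge> 0"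
  using slope_pos slope_critical by (cases "p \<in> crit") (auto simp: less_imp_le)

lemma hessian_invertible: "p \<in> crit \<Longrightarrow> c \<in> A \<Longrightarrow> p \<in> fst c \<Longrightarrow>
    invertible (hessian (f \<circ> chart_inv c) (snd c p))"
  using morse by (simp add: morse_function_def nondegenerate_critical_point_def)

lemma field_zero_at_critical_point:
  assumes p: "p \<in> crit" and c: "c \<in> A" "p \<in> fst c"
  shows "v p c = 0"
proof -
  let ?F = "f \<circ> chart_inv c" and ?V = "\<lambda>y. v (chart_inv c y) c"
  obtain W where W: "openin M W" "p \<in> W" "\<And>x. x \<in> W \<Longrightarrow> slope p \<le> slope x"
    using gradient p unfolding is_gradient_def local_minimum_def slope_def by blast
  have "?V (snd c p) = 0"
  proof (rule field_vanishes_at_nondegenerate_minimum[OF f_smooth[OF c(1)] field_smooth[OF c(1)]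
        chart_image_open[OF c(1)]])
    show "open (snd c ` (fst c \<inter> W))" by (rule open_chart_image[OF c(1) W(1)])
    show "frechet_derivative ?F (at (snd c p)) (?V (snd c p)) \<le> frechet_derivative ?F (at z) (?V z)"
      if z: "z \<in> snd c ` (fst c \<inter> W)" for z
    proof -
      obtain x where x: "z = snd c x" "x \<in> fst c" "x \<in> W" using z by blast
      show ?thesis
        using W(3)[OF x(3)] unfolding x(1) slope_in_chart[OF c] slope_in_chart[OF c(1) x(2)]
          chart_inv_left[OF c] chart_inv_left[OF c(1) x(2)] .
    qed
    show "invertible (hessian ?F (snd c p))" using hessian_invertible p c by blast
    show "frechet_derivative ?F (at (snd c p)) u = 0" for u
      using critical_in_chart[OF c] p by blast
  qed (use c W in auto)
  then show ?thesis using c by (simp add: chart_inv_left)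
qed

lemma critical_orbit: "p \<in> crit \<Longrightarrow> orb p = {p}"
  using field_zero_at_critical_point by (intro stationary_orbit) (auto simp: critical_points_def)

lemma critical_points_isolated:
  assumes p: "p \<in> crit"
  obtains N where "openin M N" "p \<in> N" "N \<inter> crit = {p}"
proof -
  obtain c where c: "c \<in> A" "p \<in> fst c"
    using obtain_chart p by (auto simp: critical_points_def)
  obtain e where e: "e > 0" "\<And>z. dist z (snd c p) < e \<Longrightarrow> z \<noteq> snd c p \<Longrightarrow>
      \<exists>u. frechet_derivative (f \<circ> chart_inv c) (at z) u \<noteq> 0"
    by (rule nondegenerate_critical_point_isolated[OF f_smooth[OF c(1)], of "snd c p"])
      (use c p critical_in_chart[OF c] hessian_invertible in auto)
  show ?thesis
  proof (rule that)
    show "openin M {x \<in> fst c. snd c x \<in> ball (snd c p) e}"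
      by (rule openin_chart_vimage[OF c(1) open_ball])
    show "{x \<in> fst c. snd c x \<in> ball (snd c p) e} \<inter> crit = {p}"
    proof (intro equalityI subsetI)
      fix x assume x: "x \<in> {x \<in> fst c. snd c x \<in> ball (snd c p) e} \<inter> crit"
      then have "snd c x = snd c p"
        using e(2)[of "snd c x"] critical_in_chart[OF c(1), of x] by (auto simp: dist_commute)
      then show "x \<in> {p}" using x c chart_inj[OF c(1)] by (auto dest: inj_onD)
    qed (use c e p in auto)
  qed (use c e in auto)
qed

lemma f_continuous: "continuous_map M euclideanreal f"
proof (rule continuous_map_if_continuous_in_charts)
  show "continuous_on (snd c ` fst c) (f \<circ> chart_inv c)" if "c \<in> A" for c
    using f_smooth[OF that] unfolding smooth_on_def by (metis Ck_on.simps(1))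
qed

lemma slope_continuous: "continuous_map M euclideanreal slope"
proof (rule continuous_map_if_continuous_in_charts)
  fix c assume c: "c \<in> A"
  let ?S = "snd c ` fst c"
  have "continuous_on ?S (\<lambda>y. frechet_derivative (f \<circ> chart_inv c) (at y) (v (chart_inv c y) c))"
    using derivative_along_field_has_derivative[OF f_smooth[OF c] field_smooth[OF c] chart_image_open[OF c]]
    by (intro continuous_at_imp_continuous_on) (blast intro: has_derivative_continuous)
  then show "continuous_on ?S (slope \<circ> chart_inv c)"
    by (rule continuous_on_cong[THEN iffD1, rotated 2])
      (auto simp: slope_in_chart[OF c] chart_inv_left[OF c])
qed

lemma openin_regular_points: "openin M (topspace M - crit)"
proof -
  have "openin M {x \<in> topspace M. slope x \<in> {0<..}}"
    using openin_continuous_map_preimage[OF slope_continuous, of "{0<..}"] by simp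
  moreover have "{x \<in> topspace M. slope x \<in> {0<..}} = topspace M - crit"
    using slope_pos slope_critical by fastforce
  ultimately show ?thesis by simp
qed

lemma f_derivative_along_curve:
  assumes \<gamma>: "integral_curve M A v J \<gamma>" and t: "t \<in> J"
  shows "((\<lambda>t. f (\<gamma> t)) has_real_derivative slope (\<gamma> t)) (at t)"
proof -
  obtain c where c: "c \<in> A" "\<gamma> t \<in> fst c"
    using obtain_chart integral_curve_in[OF \<gamma> t] by blast
  let ?F = "f \<circ> chart_inv c"
  have dF: "(?F has_derivative frechet_derivative ?F (at (snd c (\<gamma> t)))) (at ((snd c \<circ> \<gamma>) t))"
    using smooth_on_differentiable[OF f_smooth[OF c(1)], of "snd c (\<gamma> t)"] c(2)
    by (simp add: frechet_derivative_works)
  have "((?F \<circ> (snd c \<circ> \<gamma>)) has_derivative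
      frechet_derivative ?F (at (snd c (\<gamma> t))) \<circ> (\<lambda>h. h *\<^sub>R v (\<gamma> t) c)) (at t)"
    using diff_chain_at[OF integral_curve_derivative[OF \<gamma> t c, unfolded has_vector_derivative_def] dF] .
  moreover have "frechet_derivative ?F (at (snd c (\<gamma> t))) \<circ> (\<lambda>h. h *\<^sub>R v (\<gamma> t) c) = (\<lambda>h. slope (\<gamma> t) * h)"
    by (rule ext) (simp add: slope_in_chart[OF c] linear_scale[OF has_derivative_linear[OF dF]] mult.commute)
  ultimately have "((?F \<circ> (snd c \<circ> \<gamma>)) has_derivative (\<lambda>h. slope (\<gamma> t) * h)) (at t)" by simp
  then have "((\<lambda>t. f (\<gamma> t)) has_derivative (\<lambda>h. slope (\<gamma> t) * h)) (at t)"
  proof (rule has_derivative_transform_within_open)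
    show "open {s \<in> J. \<gamma> s \<in> fst c}"
      by (rule curve_preimage_open[OF integral_curve_continuous[OF \<gamma>] integral_curve_open[OF \<gamma>] chart_openin[OF c(1)]])
  qed (use t c in \<open>auto simp: chart_inv_left\<close>)
  then show ?thesis by (simp add: has_field_derivative_def)
qed

lemma interval_subset: "is_interval J \<Longrightarrow> s \<in> J \<Longrightarrow> t \<in> J \<Longrightarrow> s \<le> r \<Longrightarrow> r \<le> t \<Longrightarrow> r \<in> (J::real set)"
  unfolding is_interval_1 by blast

lemma f_mono_along_curve:
  assumes \<gamma>: "integral_curve M A v J \<gamma>" and st: "s \<in> J" "t \<in> J" "s \<le> t"
  shows "f (\<gamma> s) \<le> f (\<gamma> t)"
proof (rule DERIV_nonneg_imp_nondecreasing[OF st(3)])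
  fix r assume "s \<le> r" "r \<le> t"
  then have "r \<in> J" using interval_subset[OF integral_curve_interval[OF \<gamma>]] st by blast
  then show "\<exists>y. ((\<lambda>t. f (\<gamma> t)) has_real_derivative y) (at r) \<and> 0 \<le> y"
    using f_derivative_along_curve[OF \<gamma>] slope_nonneg integral_curve_in[OF \<gamma>] by blast
qed

lemma orbit_of_regular:
  assumes "x \<in> topspace M" "x \<notin> crit" "y \<in> topspace M" "orb y = orb x"
  shows "y \<notin> crit"
  using assms critical_orbit in_orbit_self by (metis singletonD)

lemma f_strict_mono_along_curve:
  assumes \<gamma>: "integral_curve M A v J \<gamma>" and st: "s \<in> J" "t \<in> J" "s < t" and reg: "\<gamma> s \<notin> crit"
  shows "f (\<gamma> s) < f (\<gamma> t)"
proof (rule DERIV_pos_imp_increasing[OF st(3)])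
  fix r assume "s \<le> r" "r \<le> t"
  then have r: "r \<in> J" using interval_subset[OF integral_curve_interval[OF \<gamma>]] st by blast
  then have "\<gamma> r \<notin> crit"
    using orbit_of_regular[OF integral_curve_in[OF \<gamma> st(1)] reg integral_curve_in[OF \<gamma> r]]
      orbit_integral_curve[OF \<gamma> r st(1)] by blast
  then show "\<exists>y. ((\<lambda>t. f (\<gamma> t)) has_real_derivative y) (at r) \<and> 0 < y"
    using f_derivative_along_curve[OF \<gamma> r] slope_pos integral_curve_in[OF \<gamma> r] by blast
qed

lemma obtain_flow_time:
  assumes "x \<in> topspace M" "y \<in> topspace M" "orb y = orb x"
  obtains t where "t \<in> flow_domain x" "y = flow x t"
  using assms in_orbit_self[OF assms(2)] by (auto simp: orbit_eq_flow_image)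

lemma f_inj_on_orbit:
  assumes xy: "x \<in> topspace M" "y \<in> topspace M" and orb: "orb x = orb y" and f: "f x = f y"
  shows "x = y"
proof (cases "x \<in> crit")
  case True
  then have "y \<in> {x}" using critical_orbit in_orbit_self[OF xy(2)] orb by metis
  then show ?thesis by simp
next
  case False
  obtain t where t: "t \<in> flow_domain x" "y = flow x t"
    using obtain_flow_time[OF xy] orb by metis
  have y: "y \<notin> crit" using orbit_of_regular[OF xy(1) False xy(2)] orb by simp
  have "\<not> 0 < t" "\<not> t < 0"
    using f_strict_mono_along_curve[OF flow_integral_curve zero_in_flow_domain[OF xy(1)] t(1)]
      f_strict_mono_along_curve[OF flow_integral_curve t(1) zero_in_flow_domain[OF xy(1)]]
      flow_zero[OF xy(1)] False y t(2) f by auto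
  then show ?thesis using t flow_zero[OF xy(1)] by auto
qed

text \<open>Follow the flow line of \<open>x0\<close> for a time \<open>\<tau>\<close> so short, backwards and forwards, that it stays in \<open>N\<close>:
  the end points lie strictly below and above the level of \<open>x0\<close>.  Both facts persist for starting points
  near \<open>x0\<close>, and the intermediate value theorem gives the levels in between.\<close>

lemma orbit_meets_nearby_levels:
  assumes x0: "x0 \<in> topspace M" "x0 \<notin> crit" and N: "openin M N" "x0 \<in> N"
  obtains W \<delta> where "openin M W" "x0 \<in> W" "\<delta> > 0"
    "\<And>x c. x \<in> W \<Longrightarrow> \<bar>c - f x0\<bar> < \<delta> \<Longrightarrow> \<exists>y\<in>N. orb y = orb x \<and> f y = c"
proof -
  obtain \<epsilon> U \<phi> where \<epsilon>: "\<epsilon> > 0" "openin M U" "x0 \<in> U" and \<phi>0: "\<And>x. x \<in> U \<Longrightarrow> \<phi> 0 x = x"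
    and \<phi>: "\<And>x. x \<in> U \<Longrightarrow> integral_curve M A v {-\<epsilon><..<\<epsilon>} (\<lambda>t. \<phi> t x)"
    and joint: "\<And>t0 x0 N. \<lbrakk>\<bar>t0\<bar> < \<epsilon>; x0 \<in> U; openin M N; \<phi> t0 x0 \<in> N\<rbrakk> \<Longrightarrow>
     \<exists>\<eta>>0. \<exists>U'. openin M U' \<and> x0 \<in> U' \<and> U' \<subseteq> U \<and> (\<forall>t x. \<bar>t - t0\<bar> < \<eta> \<longrightarrow> x \<in> U' \<longrightarrow> \<phi> t x \<in> N)"
    by (rule local_flow[OF x0(1)]) blast
  have near_flow: "\<exists>\<eta>>0. \<exists>U'. openin M U' \<and> x0 \<in> U' \<and> U' \<subseteq> U \<and> (\<forall>t x. \<bar>t - t0\<bar> < \<eta> \<longrightarrow> x \<in> U' \<longrightarrow> \<phi> t x \<in> N')"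
    if "\<bar>t0\<bar> < \<epsilon>" "openin M N'" "\<phi> t0 x0 \<in> N'" for t0 N'
    using joint[OF that(1) \<epsilon>(3) that(2,3)] .
  have "\<phi> 0 x0 \<in> N" using \<phi>0 \<epsilon>(3) N(2) by simp
  from near_flow[OF _ N(1) this] obtain \<eta> U0 where U0: "\<eta> > 0" "openin M U0" "x0 \<in> U0" "U0 \<subseteq> U"
    "\<And>t x. \<bar>t\<bar> < \<eta> \<Longrightarrow> x \<in> U0 \<Longrightarrow> \<phi> t x \<in> N" using \<epsilon>(1) by auto
  define \<tau> where "\<tau> = min \<eta> \<epsilon> / 2"
  have \<tau>: "0 < \<tau>" "\<tau> < \<eta>" "\<tau> < \<epsilon>" using U0(1) \<epsilon>(1) by (auto simp: \<tau>_def)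
  have tin: "\<tau> \<in> {-\<epsilon><..<\<epsilon>}" "-\<tau> \<in> {-\<epsilon><..<\<epsilon>}" "0 \<in> {-\<epsilon><..<\<epsilon>}" using \<tau> by auto
  have c0: "integral_curve M A v {-\<epsilon><..<\<epsilon>} (\<lambda>t. \<phi> t x0)" using \<phi> \<epsilon>(3) by blast
  have start: "\<phi> (-\<tau>) x0 \<notin> crit"
    using orbit_of_regular[OF x0 integral_curve_in[OF c0 tin(2)]] orbit_integral_curve[OF c0 tin(2,3)]
      \<phi>0[OF \<epsilon>(3)] by simp
  define \<delta> where "\<delta> = min (f (\<phi> \<tau> x0) - f x0) (f x0 - f (\<phi> (-\<tau>) x0)) / 2"
  have less: "f (\<phi> (-\<tau>) x0) < f x0" "f x0 < f (\<phi> \<tau> x0)"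
    using f_strict_mono_along_curve[OF c0 tin(2,3)] f_strict_mono_along_curve[OF c0 tin(3,1)]
      start x0(2) \<phi>0[OF \<epsilon>(3)] \<tau>(1) by auto
  have \<delta>: "\<delta> > 0" "f (\<phi> (-\<tau>) x0) < f x0 - \<delta>" "f x0 + \<delta> < f (\<phi> \<tau> x0)"
    using less unfolding \<delta>_def by (auto simp: min_def field_simps)
  have sub: "openin M {x \<in> topspace M. f x \<in> T}" if "open T" for T
    using openin_continuous_map_preimage[OF f_continuous, of T] that by simp
  have "\<phi> \<tau> x0 \<in> {x \<in> topspace M. f x \<in> {f x0 + \<delta><..}}"
    using \<delta> integral_curve_in[OF c0 tin(1)] by simp
  from near_flow[OF _ sub[OF open_greaterThan] this] \<tau>
  obtain U1 where U1: "openin M U1" "x0 \<in> U1" "\<And>x. x \<in> U1 \<Longrightarrow> f (\<phi> \<tau> x) > f x0 + \<delta>"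
    by fastforce
  have "\<phi> (-\<tau>) x0 \<in> {x \<in> topspace M. f x \<in> {..<f x0 - \<delta>}}"
    using \<delta> integral_curve_in[OF c0 tin(2)] by simp
  from near_flow[OF _ sub[OF open_lessThan] this] \<tau>
  obtain U2 where U2: "openin M U2" "x0 \<in> U2" "\<And>x. x \<in> U2 \<Longrightarrow> f (\<phi> (-\<tau>) x) < f x0 - \<delta>"
    by fastforce
  show ?thesis
  proof (rule that[of "U0 \<inter> U1 \<inter> U2" \<delta>])
    fix x c assume x: "x \<in> U0 \<inter> U1 \<inter> U2" and c: "\<bar>c - f x0\<bar> < \<delta>"
    then have cx: "integral_curve M A v {-\<epsilon><..<\<epsilon>} (\<lambda>t. \<phi> t x)" using \<phi> U0(4) by blast
    have "continuous_on {-\<tau>..\<tau>} (\<lambda>t. f (\<phi> t x))"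
      using f_derivative_along_curve[OF cx] \<tau>(3)
      by (intro DERIV_continuous_on[where D = "\<lambda>t. slope (\<phi> t x)"]) (auto intro: has_field_derivative_at_within)
    moreover have "f (\<phi> (-\<tau>) x) \<le> c" "c \<le> f (\<phi> \<tau> x)"
      using U1(3)[of x] U2(3)[of x] x c by auto
    ultimately obtain t where t: "-\<tau> \<le> t" "t \<le> \<tau>" "f (\<phi> t x) = c"
      using IVT'[of "\<lambda>t. f (\<phi> t x)" "-\<tau>" c \<tau>] \<tau>(1) by auto
    have "orb (\<phi> t x) = orb (\<phi> 0 x)"
      using t \<tau> by (intro orbit_integral_curve[OF cx]) auto
    moreover have "\<phi> t x \<in> N" using U0(5)[of t x] x t \<tau> by auto
    ultimately show "\<exists>y\<in>N. orb y = orb x \<and> f y = c"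
      using t(3) \<phi>0[of x] x U0(4) by (intro bexI[of _ "\<phi> t x"]) auto
  qed (use U0 U1 U2 \<delta> in auto)
qed

end

context manifold_with_field
begin

lemma chart_inv_continuous:
  assumes c: "c \<in> A"
  shows "continuous_map (top_of_set (snd c ` fst c)) M (chart_inv c)"
  unfolding continuous_map_def
proof (intro conjI allI impI)
  show "chart_inv c \<in> topspace (top_of_set (snd c ` fst c)) \<rightarrow> topspace M"
    using chart_subset[OF c] chart_inv_in[OF c] by auto
  fix N assume N: "openin M N"
  have "{y \<in> topspace (top_of_set (snd c ` fst c)). chart_inv c y \<in> N} = snd c ` (fst c \<inter> N)"
    by (auto simp: chart_inv_left[OF c])
  then show "openin (top_of_set (snd c ` fst c)) {y \<in> topspace (top_of_set (snd c ` fst c)). chart_inv c y \<in> N}"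
    using open_chart_image[OF c N] by (auto intro: open_subset)
qed

lemma closedin_chart_cball:
  assumes c: "c \<in> A" and sub: "cball y R \<subseteq> snd c ` fst c"
  shows "closedin M {x \<in> fst c. snd c x \<in> cball y R}"
proof -
  have "compactin (top_of_set (snd c ` fst c)) (cball y R)"
    using sub by (simp add: compactin_subtopology)
  then have "compactin M (chart_inv c ` cball y R)"
    by (rule image_compactin[OF _ chart_inv_continuous[OF c]])
  moreover have "chart_inv c ` cball y R = {x \<in> fst c. snd c x \<in> cball y R}"
  proof (intro equalityI subsetI)
    fix x assume "x \<in> chart_inv c ` cball y R"
    then obtain z where z: "z \<in> cball y R" "x = chart_inv c z" by blast
    then have "z \<in> snd c ` fst c" using sub by blast
    then show "x \<in> {x \<in> fst c. snd c x \<in> cball y R}"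
      using z chart_inv_in[OF c] chart_inv_right[OF c] by simp
  next
    fix x assume "x \<in> {x \<in> fst c. snd c x \<in> cball y R}"
    then show "x \<in> chart_inv c ` cball y R"
      using chart_inv_left[OF c] by (metis (mono_tags, lifting) image_eqI mem_Collect_eq)
  qed
  ultimately show ?thesis
    using compactin_imp_closedin[OF Hausdorff] by simp
qed

lemma chart_neighbourhood_basis:
  assumes p: "p \<in> topspace M"
  obtains N :: "nat \<Rightarrow> 'a set" where "\<And>n. openin M (N n)" "\<And>n. p \<in> N n"
    "\<And>W. openin M W \<Longrightarrow> p \<in> W \<Longrightarrow> \<exists>n. N n \<subseteq> W"
proof -
  obtain c where c: "c \<in> A" "p \<in> fst c" using obtain_chart[OF p] .
  define N where "N n = {x \<in> fst c. snd c x \<in> ball (snd c p) (inverse (real (Suc n)))}" for n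
  show ?thesis
  proof (rule that[of N])
    show "openin M (N n)" for n unfolding N_def by (rule openin_chart_vimage[OF c(1) open_ball])
    show "p \<in> N n" for n using c by (simp add: N_def)
    fix W assume W: "openin M W" "p \<in> W"
    obtain R where R: "R > 0" "cball (snd c p) R \<subseteq> snd c ` (fst c \<inter> W)"
      using chart_cball[OF c(1) W c(2)] .
    obtain n where n: "inverse (real (Suc n)) < R" using reals_Archimedean R(1) by blast
    have "N n \<subseteq> W"
    proof
      fix x assume x: "x \<in> N n"
      then have "snd c x \<in> snd c ` (fst c \<inter> W)" using R(2) n by (auto simp: N_def)
      then show "x \<in> W" using x chart_inj[OF c(1)] by (auto simp: N_def dest: inj_onD)
    qed
    then show "\<exists>n. N n \<subseteq> W" by blast
  qed
qed

end

context gradient_field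
begin

section \<open>Orbits near a critical point\<close>

text \<open>On an annulus around \<open>p\<close> that contains no critical point \<open>v(f)\<close> is at least some \<open>m > 0\<close> and the speed is at
  most \<open>b\<close> in a chart.  A curve that leaves from the inside has to cross the annulus of width \<open>R / 2\<close>, which
  takes at least the time \<open>R / (2 * b)\<close>.\<close>

lemma escape_gain:
  assumes p: "p \<in> crit" and N: "openin M N" "p \<in> N"
  obtains B \<eta> where "openin M B" "p \<in> B" "B \<subseteq> N" "\<eta> > 0"
    "\<And>J \<gamma> s t. \<lbrakk>integral_curve M A v J \<gamma>; s \<in> J; t \<in> J; s \<le> t; \<gamma> s \<in> B; \<gamma> t \<notin> N\<rbrakk> \<Longrightarrow>
       f (\<gamma> s) + \<eta> \<le> f (\<gamma> t)"
proof -
  have "p \<in> topspace M" using p by (simp add: critical_points_def)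
  then obtain c where c: "c \<in> A" "p \<in> fst c" using obtain_chart by blast
  obtain N0 where N0: "openin M N0" "p \<in> N0" "N0 \<inter> crit = {p}"
    using critical_points_isolated[OF p] .
  let ?y = "snd c p" and ?V = "\<lambda>y. v (chart_inv c y) c"
  obtain R where R: "R > 0" "cball ?y R \<subseteq> snd c ` (fst c \<inter> (N \<inter> N0))"
    using chart_cball[OF c(1), of "N \<inter> N0" p] N N0 c by auto
  have in_N: "x \<in> N \<inter> N0" if "x \<in> fst c" "snd c x \<in> cball ?y R" for x
    using that R(2) chart_inj[OF c(1)] by (auto dest: inj_onD)
  have sub: "cball ?y R \<subseteq> snd c ` fst c" using R(2) by blast
  define Ann where "Ann = cball ?y R - ball ?y (R / 2)"
  have "compact Ann" unfolding Ann_def by (intro compact_diff) auto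
  have contV: "continuous_on (cball ?y R) ?V"
    using field_smooth[OF c(1)] sub unfolding smooth_on_def by (metis Ck_on.simps(1) continuous_on_subset)
  have cont_slope: "continuous_on Ann (\<lambda>y. slope (chart_inv c y))"
    using continuous_map_compose[OF chart_inv_continuous[OF c(1)] slope_continuous] sub
    by (auto simp: Ann_def o_def elim: continuous_on_subset)
  have "\<exists>m>0. \<forall>y\<in>Ann. m \<le> slope (chart_inv c y)"
  proof (cases "Ann = {}")
    case False
    then obtain y where y: "y \<in> Ann" "\<And>z. z \<in> Ann \<Longrightarrow> slope (chart_inv c y) \<le> slope (chart_inv c z)"
      using continuous_attains_inf[OF \<open>compact Ann\<close> _ cont_slope] by blast
    define x where "x = chart_inv c y"
    have yS: "y \<in> snd c ` fst c" using y(1) sub by (auto simp: Ann_def)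
    then have x: "x \<in> fst c" "snd c x = y"
      using chart_inv_in[OF c(1)] chart_inv_right[OF c(1)] by (simp_all add: x_def)
    then have "x \<in> N0" "x \<noteq> p" using in_N[of x] y(1) R(1) by (auto simp: Ann_def)
    then have "slope x > 0"
      using N0(3) x(1) chart_subset[OF c(1)] by (intro slope_pos) auto
    then show ?thesis using y(2) by (auto simp: x_def)
  qed (auto intro: exI[of _ 1])
  then obtain m where m: "m > 0" "\<And>y. y \<in> Ann \<Longrightarrow> m \<le> slope (chart_inv c y)" by blast
  have "compact (?V ` cball ?y R)" using contV by (rule compact_continuous_image) simp
  then obtain b where b: "b > 0" "\<And>y. y \<in> cball ?y R \<Longrightarrow> norm (?V y) \<le> b"
    by (auto dest!: compact_imp_bounded simp: bounded_pos)
  let ?B = "{x \<in> fst c. snd c x \<in> ball ?y (R / 2)}"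
  let ?O = "{x \<in> fst c. snd c x \<in> ball ?y R}"
  let ?K = "{x \<in> fst c. snd c x \<in> cball ?y R}"
  have openO: "openin M ?O" by (rule openin_chart_vimage[OF c(1) open_ball])
  have closedK: "closedin M ?K" by (rule closedin_chart_cball[OF c(1) sub])
  show ?thesis
  proof (rule that[of ?B "m * (R / 2) / b"])
    show "openin M ?B" by (rule openin_chart_vimage[OF c(1) open_ball])
    show "p \<in> ?B" using c R by simp
    show "?B \<subseteq> N"
    proof
      fix x assume "x \<in> ?B"
      then have "x \<in> N \<inter> N0" using R(1) by (intro in_N) auto
      then show "x \<in> N" by blast
    qed
    show "m * (R / 2) / b > 0" using m b R by simp
    fix J \<gamma> s t
    assume \<gamma>: "integral_curve M A v J \<gamma>" and st: "s \<in> J" "t \<in> J" "s \<le> t"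
      and s: "\<gamma> s \<in> ?B" and t: "\<gamma> t \<notin> N"
    have J: "r \<in> J" if "s \<le> r" "r \<le> t" for r
      using interval_subset[OF integral_curve_interval[OF \<gamma>] st(1,2) that] .
    note preim = curve_preimage_open[OF integral_curve_continuous[OF \<gamma>] integral_curve_open[OF \<gamma>]]
    let ?E = "{s..t} - {r \<in> J. \<gamma> r \<in> ?O}"
    have "compact ?E" using preim[OF openO] by (intro compact_diff) auto
    moreover have "t \<in> ?E" using st t in_N[of "\<gamma> t"] by auto
    then have "?E \<noteq> {}" by (metis empty_iff)
    \<comment> \<open>the first time at which the curve leaves the ball\<close>
    ultimately have "\<exists>\<tau>\<in>?E. \<forall>r\<in>?E. \<tau> \<le> r" by (rule compact_attains_inf)
    then obtain \<tau> where \<tau>: "\<tau> \<in> ?E" "\<And>r. r \<in> ?E \<Longrightarrow> \<tau> \<le> r" by (elim bexE) (rule that, assumption, erule (1) bspec)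
    have \<tau>J: "\<tau> \<in> J" "s \<le> \<tau>" "\<tau> \<le> t" using \<tau>(1) J by auto
    have "s \<noteq> \<tau>" using \<tau>(1) s st(1) R(1) by auto
    then have "s < \<tau>" using \<tau>J by simp
    have before: "\<gamma> r \<in> ?O" if "s \<le> r" "r < \<tau>" for r
    proof (rule ccontr)
      assume "\<gamma> r \<notin> ?O"
      then have "r \<in> ?E" using that \<tau>J by auto
      then show False using \<tau>(2)[of r] that(2) by simp
    qed
    have \<tau>K: "\<gamma> \<tau> \<in> ?K"
    proof (rule ccontr)
      assume "\<gamma> \<tau> \<notin> ?K"
      then have "\<gamma> \<tau> \<in> topspace M - ?K" using integral_curve_in[OF \<gamma> \<tau>J(1)] by blast
      moreover have "openin M (topspace M - ?K)" using closedK by blast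
      ultimately obtain e where e: "e > 0" "\<And>r. \<bar>r - \<tau>\<bar> < e \<Longrightarrow> \<gamma> r \<in> topspace M - ?K"
        by (rule_tac curve_stays_near[OF integral_curve_continuous[OF \<gamma>] integral_curve_open[OF \<gamma>] _ \<tau>J(1)])
          blast+
      define r where "r = max s (\<tau> - e / 2)"
      have r: "s \<le> r" "r < \<tau>" "\<bar>r - \<tau>\<bar> < e" using e(1) \<open>s < \<tau>\<close> by (auto simp: r_def)
      have "?O \<subseteq> ?K" using ball_subset_cball by blast
      then show False using before[OF r(1,2)] e(2)[OF r(3)] by blast
    qed
    have inK: "\<gamma> r \<in> ?K" if "s \<le> r" "r \<le> \<tau>" for r
      using before[of r] \<tau>K that by (cases "r = \<tau>") auto
    define z where "z = snd c \<circ> \<gamma>"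
    have dz: "(z has_vector_derivative v (\<gamma> r) c) (at r)" if "s \<le> r" "r \<le> \<tau>" for r
      unfolding z_def using inK[OF that] that \<tau>J J by (intro integral_curve_derivative[OF \<gamma> _ c(1)]) auto
    have "continuous_on {s..\<tau>} z"
      using dz by (intro continuous_at_imp_continuous_on ballI has_vector_derivative_continuous) auto
    then have "continuous_on {s..\<tau>} (\<lambda>r. dist ?y (z r))"
      by (intro continuous_intros)
    moreover have "dist ?y (z s) \<le> R / 2" using s by (simp add: z_def)
    moreover have z\<tau>: "dist ?y (z \<tau>) = R" using \<tau>(1) \<tau>K \<tau>J by (auto simp: z_def)
    ultimately obtain \<sigma> where \<sigma>: "s \<le> \<sigma>" "\<sigma> \<le> \<tau>" "dist ?y (z \<sigma>) = R / 2"
      "\<And>r. \<sigma> \<le> r \<Longrightarrow> r \<le> \<tau> \<Longrightarrow> R / 2 \<le> dist ?y (z r)"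
      using last_crossing[of s \<tau> "\<lambda>r. dist ?y (z r)" "R / 2"] R(1) \<tau>J(2) by auto
    have "norm (z \<tau> - z \<sigma>) \<le> b * \<bar>\<tau> - \<sigma>\<bar>"
    proof (rule vector_derivative_bound[where S = "{\<sigma>..\<tau>}"])
      fix r assume r: "r \<in> {\<sigma>..\<tau>}"
      then have r': "s \<le> r" "r \<le> \<tau>" using \<sigma>(1) by auto
      show "(z has_vector_derivative v (\<gamma> r) c) (at r within {\<sigma>..\<tau>})"
        using dz[OF r'] by (rule has_vector_derivative_at_within)
      show "norm (v (\<gamma> r) c) \<le> b"
        using inK[OF r'] b(2)[of "snd c (\<gamma> r)"] chart_inv_left[OF c(1), of "\<gamma> r"] by simp
    qed (use \<sigma> in auto)
    moreover have "R - R / 2 \<le> norm (z \<tau> - z \<sigma>)"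
      using z\<tau> \<sigma>(3) dist_triangle[of ?y "z \<tau>" "z \<sigma>"] by (simp add: dist_norm norm_minus_commute)
    ultimately have "R / 2 \<le> b * (\<tau> - \<sigma>)" using \<sigma>(2) by simp
    then have "m * (R / 2) \<le> m * (b * (\<tau> - \<sigma>))" using m(1) by (intro mult_left_mono) auto
    then have "m * (R / 2) / b \<le> m * (\<tau> - \<sigma>)" using b(1) by (simp add: field_simps)
    also have "f (\<gamma> \<sigma>) - m * \<sigma> \<le> f (\<gamma> \<tau>) - m * \<tau>"
    proof (rule DERIV_nonneg_imp_nondecreasing[OF \<sigma>(2)])
      fix r assume r: "\<sigma> \<le> r" "r \<le> \<tau>"
      then have r': "s \<le> r" "r \<le> \<tau>" using \<sigma>(1) by auto
      have "z r \<in> Ann" using inK[OF r'] \<sigma>(4)[OF r] by (auto simp: Ann_def z_def)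
      then have "m \<le> slope (\<gamma> r)"
        using m(2)[of "z r"] inK[OF r'] chart_inv_left[OF c(1), of "\<gamma> r"] by (simp add: z_def)
      moreover have "((\<lambda>r. f (\<gamma> r) - m * r) has_real_derivative slope (\<gamma> r) - m * 1) (at r)"
        using r' \<tau>J J by (intro DERIV_diff DERIV_cmult DERIV_ident f_derivative_along_curve[OF \<gamma>]) auto
      ultimately show "\<exists>y. ((\<lambda>r. f (\<gamma> r) - m * r) has_real_derivative y) (at r) \<and> 0 \<le> y"
        by (intro exI[of _ "slope (\<gamma> r) - m * 1"]) simp
    qed
    then have "m * (\<tau> - \<sigma>) \<le> f (\<gamma> \<tau>) - f (\<gamma> \<sigma>)" by (simp add: algebra_simps)
    finally have "m * (R / 2) / b \<le> f (\<gamma> \<tau>) - f (\<gamma> \<sigma>)" .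
    moreover have "f (\<gamma> s) \<le> f (\<gamma> \<sigma>)" "f (\<gamma> \<tau>) \<le> f (\<gamma> t)"
      using f_mono_along_curve[OF \<gamma>] J \<sigma> \<tau>J st by auto
    ultimately show "f (\<gamma> s) + m * (R / 2) / b \<le> f (\<gamma> t)" by simp
  qed
qed

text \<open>The union of the orbit segments with both ends in \<open>B\<close>.  As \<open>f\<close> increases along orbits, the order
  on an orbit is expressed by levels, without reference to the flow.\<close>

definition orbit_hull :: "'a set \<Rightarrow> 'a set" where
  "orbit_hull B = {u \<in> topspace M. \<exists>a\<in>B. \<exists>b\<in>B. orb a = orb u \<and> orb b = orb u \<and> f a \<le> f u \<and> f u \<le> f b}"

lemma orbit_hull_mono: "B \<subseteq> B' \<Longrightarrow> orbit_hull B \<subseteq> orbit_hull B'"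
  unfolding orbit_hull_def by blast

lemma subset_orbit_hull: "B \<subseteq> topspace M \<Longrightarrow> B \<subseteq> orbit_hull B"
  unfolding orbit_hull_def by auto

lemma orbit_hull_convex:
  assumes "x \<in> orbit_hull B" "z \<in> orbit_hull B" "y \<in> topspace M" "orb x = orb y" "orb z = orb y"
    "f x \<le> f y" "f y \<le> f z"
  shows "y \<in> orbit_hull B"
proof -
  obtain a where "a \<in> B" "orb a = orb x" "f a \<le> f x"
    using assms(1) unfolding orbit_hull_def by blast
  moreover obtain b where "b \<in> B" "orb b = orb z" "f z \<le> f b"
    using assms(2) unfolding orbit_hull_def by blast
  ultimately have "orb a = orb y" "orb b = orb y" "f a \<le> f y" "f y \<le> f b" "a \<in> B" "b \<in> B"
    using assms(4-7) by auto
  then show ?thesis using assms(3) unfolding orbit_hull_def by blast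
qed

text \<open>A segment that leaves \<open>N\<close> gains at least \<open>\<eta>\<close>, more than the oscillation of \<open>f\<close> on \<open>B\<close>; so
  it does not end in \<open>B\<close>.\<close>

lemma small_orbit_hull:
  assumes p: "p \<in> crit" and N: "openin M N" "p \<in> N"
  obtains B where "openin M B" "p \<in> B" "orbit_hull B \<subseteq> N"
proof -
  obtain B0 \<eta> where B0: "openin M B0" "p \<in> B0" "B0 \<subseteq> N" "\<eta> > 0"
    and gain: "\<And>J \<gamma> s t. \<lbrakk>integral_curve M A v J \<gamma>; s \<in> J; t \<in> J; s \<le> t; \<gamma> s \<in> B0; \<gamma> t \<notin> N\<rbrakk> \<Longrightarrow>
       f (\<gamma> s) + \<eta> \<le> f (\<gamma> t)"
    using escape_gain[OF assms] by metis
  define B where "B = B0 \<inter> {x \<in> topspace M. f x \<in> ball (f p) (\<eta> / 2)}"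
  have "openin M {x \<in> topspace M. f x \<in> ball (f p) (\<eta> / 2)}"
    using openin_continuous_map_preimage[OF f_continuous, of "ball (f p) (\<eta> / 2)"] by simp
  then have B: "openin M B" using B0(1) unfolding B_def by blast
  moreover have "p \<in> B" using B0 p by (simp add: B_def critical_points_def)
  moreover have "orbit_hull B \<subseteq> N"
  proof
    fix u assume "u \<in> orbit_hull B"
    then obtain a b where ab: "a \<in> B" "b \<in> B" "orb a = orb u" "orb b = orb u" "f a \<le> f u" "f u \<le> f b"
      and u: "u \<in> topspace M" unfolding orbit_hull_def by blast
    have a: "a \<in> topspace M" using ab(1) by (simp add: B_def)
    have osc: "f b < f a + \<eta>" using ab(1,2) by (auto simp: B_def dist_real_def abs_if split: if_splits)
    show "u \<in> N"
    proof (rule ccontr)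
      assume uN: "u \<notin> N"
      have "u \<noteq> a" using uN ab(1) B0(3) by (auto simp: B_def)
      then have "f a < f u" using ab(3,5) f_inj_on_orbit[OF u a] by fastforce
      obtain t where t: "t \<in> flow_domain a" "u = flow a t"
        using obtain_flow_time[OF a u] ab(3) by metis
      have "0 \<le> t"
      proof (rule ccontr)
        assume "\<not> 0 \<le> t"
        then have "f u \<le> f a"
          using f_mono_along_curve[OF flow_integral_curve t(1) zero_in_flow_domain[OF a]]
            flow_zero[OF a] t(2) by simp
        then show False using \<open>f a < f u\<close> by simp
      qed
      then have "f a + \<eta> \<le> f u"
        using gain[OF flow_integral_curve zero_in_flow_domain[OF a] t(1)] flow_zero[OF a] t(2) uN ab(1)
        by (simp add: B_def)
      then show False using osc ab(6) by simp
    qed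
  qed
  ultimately show ?thesis using that by blast
qed

lemma shrinking_orbit_hulls:
  assumes p: "p \<in> crit"
  obtains B :: "nat \<Rightarrow> 'a set" where "\<And>n. openin M (B n)" "\<And>n. p \<in> B n" "\<And>m n. m \<le> n \<Longrightarrow> B n \<subseteq> B m"
    "\<And>W. openin M W \<Longrightarrow> p \<in> W \<Longrightarrow> \<exists>n. orbit_hull (B n) \<subseteq> W"
proof -
  have "p \<in> topspace M" using p by (simp add: critical_points_def)
  then obtain N :: "nat \<Rightarrow> 'a set" where N: "\<And>n. openin M (N n)" "\<And>n. p \<in> N n"
    "\<And>W. openin M W \<Longrightarrow> p \<in> W \<Longrightarrow> \<exists>n. N n \<subseteq> W"
    using chart_neighbourhood_basis by metis
  have "\<exists>B. openin M B \<and> p \<in> B \<and> orbit_hull B \<subseteq> N n" for n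
    using small_orbit_hull[OF p N(1,2)] by metis
  then obtain B where B: "\<And>n. openin M (B n)" "\<And>n. p \<in> B n" "\<And>n. orbit_hull (B n) \<subseteq> N n" by metis
  define B' where "B' n = (\<Inter>k\<in>{..n}. B k)" for n
  show ?thesis
  proof (rule that[of B'])
    show "openin M (B' n)" for n
      unfolding B'_def using B(1) by (intro openin_INT2) auto
    show "\<exists>n. orbit_hull (B' n) \<subseteq> W" if W: "openin M W" "p \<in> W" for W
    proof -
      obtain n where "N n \<subseteq> W" using N(3)[OF W] by blast
      moreover have "orbit_hull (B' n) \<subseteq> orbit_hull (B n)"
        by (rule orbit_hull_mono) (auto simp: B'_def)
      ultimately show ?thesis using B(3)[of n] by blast
    qed
  qed (use B in \<open>auto simp: B'_def\<close>)
qed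

section \<open>Lifting paths from the orbit space\<close>

lemma orbit_meets_intermediate_level:
  assumes x: "x \<in> topspace M" and z: "z \<in> topspace M" and orb: "orb x = orb z"
    and c: "f x \<le> c" "c \<le> f z"
  obtains y where "y \<in> topspace M" "orb y = orb x" "f y = c"
proof -
  obtain t where t: "t \<in> flow_domain x" "z = flow x t"
    using obtain_flow_time[OF x z] orb by metis
  let ?g = "\<lambda>t. f (flow x t)"
  have "continuous_on (flow_domain x) ?g"
    using f_derivative_along_curve[OF flow_integral_curve]
    by (intro DERIV_continuous_on[where D = "\<lambda>t. slope (flow x t)"]) (auto intro: has_field_derivative_at_within)
  then have "connected (?g ` flow_domain x)"
    using integral_curve_interval[OF flow_integral_curve] by (intro connected_continuous_image is_interval_connected)
  moreover have "f x \<in> ?g ` flow_domain x" "f z \<in> ?g ` flow_domain x"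
    using zero_in_flow_domain[OF x] flow_zero[OF x] t by (auto intro: rev_image_eqI)
  ultimately have "c \<in> ?g ` flow_domain x"
    using c unfolding connected_iff_interval by blast
  then obtain r where "r \<in> flow_domain x" "c = f (flow x r)" by blast
  then show ?thesis
    using that[of "flow x r"] flow_in orbit_flow[OF x] by simp
qed

context
  fixes \<alpha> :: "real \<Rightarrow> 'a set"
  assumes \<alpha>: "pathin (orbit_space M A v) \<alpha>"
begin

lemma path_in_orbit_space:
  assumes "t \<in> {0..1}" obtains x where "x \<in> topspace M" "orb x = \<alpha> t"
proof -
  have "\<alpha> t \<in> orb ` topspace M"
    using \<alpha> assms continuous_map_image_subset_topspace[of "top_of_set {0..1}" "orbit_space M A v" \<alpha>]
    unfolding pathin_def topspace_orbit_space by auto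
  then show ?thesis using that by auto
qed

lemma path_stays_in_saturation:
  assumes t0: "t0 \<in> {0..1}" and W: "openin M W" and "\<alpha> t0 \<in> orb ` W"
  obtains d where "d > 0" "\<And>t. t \<in> {0..1} \<Longrightarrow> \<bar>t - t0\<bar> < d \<Longrightarrow> \<alpha> t \<in> orb ` W"
proof -
  have "openin (orbit_space M A v) (orb ` W)"
    unfolding openin_orbit_space using openin_saturation[OF W] openin_subset[OF W] by blast
  then have "openin (top_of_set {0..1}) {t \<in> {0..1}. \<alpha> t \<in> orb ` W}"
    using \<alpha> openin_continuous_map_preimage[of "top_of_set {0..1}" "orbit_space M A v" \<alpha> "orb ` W"]
    unfolding pathin_def by simp
  moreover have "t0 \<in> {t \<in> {0..1}. \<alpha> t \<in> orb ` W}" using t0 assms(3) by simp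
  ultimately obtain d where "d > 0" "\<And>t. t \<in> {0..1} \<Longrightarrow> dist t t0 < d \<Longrightarrow> t \<in> {t \<in> {0..1}. \<alpha> t \<in> orb ` W}"
    unfolding openin_euclidean_subtopology_iff by meson
  then show ?thesis using that[of d] unfolding dist_real_def by simp
qed

lemma path_meets_nearby_levels:
  assumes t0: "t0 \<in> {0..1}" and x0: "x0 \<in> topspace M" "x0 \<notin> crit" "orb x0 = \<alpha> t0"
    and N: "openin M N" "x0 \<in> N"
  obtains d where "d > 0"
    "\<And>t c. t \<in> {0..1} \<Longrightarrow> \<bar>t - t0\<bar> < d \<Longrightarrow> \<bar>c - f x0\<bar> < d \<Longrightarrow> \<exists>y\<in>N. orb y = \<alpha> t \<and> f y = c"
proof -
  obtain W \<delta> where W: "openin M W" "x0 \<in> W" "\<delta> > 0"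
    "\<And>x c. x \<in> W \<Longrightarrow> \<bar>c - f x0\<bar> < \<delta> \<Longrightarrow> \<exists>y\<in>N. orb y = orb x \<and> f y = c"
    using orbit_meets_nearby_levels[OF x0(1,2) N] by metis
  obtain d where d: "d > 0" "\<And>t. t \<in> {0..1} \<Longrightarrow> \<bar>t - t0\<bar> < d \<Longrightarrow> \<alpha> t \<in> orb ` W"
    using path_stays_in_saturation[OF t0 W(1)] W(2) x0(3) by (metis imageI)
  show ?thesis
  proof (rule that[of "min d \<delta>"])
    fix t c assume t: "t \<in> {0..1}" "\<bar>t - t0\<bar> < min d \<delta>" and c: "\<bar>c - f x0\<bar> < min d \<delta>"
    then obtain x where "x \<in> W" "\<alpha> t = orb x" using d(2)[of t] by auto
    then show "\<exists>y\<in>N. orb y = \<alpha> t \<and> f y = c" using W(4)[of x c] c by auto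
  qed (use W d in auto)
qed

text \<open>The set \<open>Q t\<close> confines the lift at time \<open>t\<close>.  It is convex along \<open>\<alpha> t\<close>, so that the admissible levels
  form an interval, but may vary discontinuously with \<open>t\<close>; it is enough that near each time a fixed open set
  around a point of the orbit is admissible.\<close>

lemma lift_over_regular_times:
  assumes I: "I \<subseteq> {0..1}" and "a < b"
    and reg: "\<And>t x. t \<in> I \<Longrightarrow> x \<in> topspace M \<Longrightarrow> orb x = \<alpha> t \<Longrightarrow> x \<notin> crit"
    and conv: "\<And>t x y z. \<lbrakk>t \<in> I; x \<in> Q t; z \<in> Q t; y \<in> topspace M; orb x = \<alpha> t; orb y = \<alpha> t;
      orb z = \<alpha> t; f x \<le> f y; f y \<le> f z\<rbrakk> \<Longrightarrow> y \<in> Q t"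
    and loc: "\<And>t0. t0 \<in> I \<Longrightarrow> \<exists>x0 N d. d > 0 \<and> openin M N \<and> x0 \<in> N \<and> orb x0 = \<alpha> t0 \<and>
      (t0 = a \<longrightarrow> x0 = e\<^sub>a) \<and> (t0 = b \<longrightarrow> x0 = e\<^sub>b) \<and> (\<forall>t\<in>I. \<bar>t - t0\<bar> < d \<longrightarrow> N \<subseteq> Q t)"
  obtains \<beta> where "\<And>t. t \<in> I \<Longrightarrow> \<beta> t \<in> Q t" "\<And>t. t \<in> I \<Longrightarrow> \<beta> t \<in> topspace M"
    "\<And>t. t \<in> I \<Longrightarrow> orb (\<beta> t) = \<alpha> t" "a \<in> I \<Longrightarrow> \<beta> a = e\<^sub>a" "b \<in> I \<Longrightarrow> \<beta> b = e\<^sub>b"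
    "\<And>t0 N. \<lbrakk>t0 \<in> I; openin M N; \<beta> t0 \<in> N\<rbrakk> \<Longrightarrow> \<exists>d>0. \<forall>t\<in>I. \<bar>t - t0\<bar> < d \<longrightarrow> \<beta> t \<in> N"
proof -
  define C where "C t = {x \<in> Q t \<inter> topspace M. orb x = \<alpha> t \<and> (t = a \<longrightarrow> x = e\<^sub>a) \<and> (t = b \<longrightarrow> x = e\<^sub>b)}" for t
  have CI: "x \<in> C t" if "x \<in> Q t" "x \<in> topspace M" "orb x = \<alpha> t" "t = a \<Longrightarrow> x = e\<^sub>a" "t = b \<Longrightarrow> x = e\<^sub>b" for x t
    using that by (auto simp: C_def)
  have CD: "x \<in> Q t" "x \<in> topspace M" "orb x = \<alpha> t" "t = a \<Longrightarrow> x = e\<^sub>a" "t = b \<Longrightarrow> x = e\<^sub>b" if "x \<in> C t" for x t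
    using that by (auto simp: C_def)
  have convex: "convex (f ` C t)" if t: "t \<in> I" for t
    unfolding is_interval_convex_1[symmetric] is_interval_1
  proof (intro ballI allI impI)
    fix c1 c2 c assume "c1 \<in> f ` C t" "c2 \<in> f ` C t" and "c1 \<le> c \<and> c \<le> c2"
    then obtain x z where x: "x \<in> C t" and z: "z \<in> C t" and c: "f x \<le> c" "c \<le> f z" by auto
    obtain y where y: "y \<in> topspace M" "orb y = orb x" "f y = c"
      using orbit_meets_intermediate_level[OF CD(2)[OF x] CD(2)[OF z] _ c] CD(3)[OF x] CD(3)[OF z] by metis
    have "y \<in> C t"
    proof (rule CI)
      show "y \<in> Q t"
        using conv[OF t CD(1)[OF x] CD(1)[OF z] y(1) CD(3)[OF x] _ CD(3)[OF z]] y c CD(3)[OF x] by simp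
      \<comment> \<open>a prescribed value leaves only one level\<close>
      have "y = x" if "x = z"
        using f_inj_on_orbit[OF y(1) CD(2)[OF x] y(2)] y(3) c that by simp
      then show "t = a \<Longrightarrow> y = e\<^sub>a" "t = b \<Longrightarrow> y = e\<^sub>b" using CD(4,5)[OF x] CD(4,5)[OF z] by auto
    qed (use y CD(3)[OF x] in auto)
    then show "c \<in> f ` C t" using y(3) by blast
  qed
  have local: "\<exists>c. \<exists>d>0. \<forall>t\<in>I. \<bar>t - t0\<bar> < d \<longrightarrow> c \<in> f ` C t" if t0: "t0 \<in> I" for t0
  proof -
    obtain x0 N d where x0: "d > 0" "openin M N" "x0 \<in> N" "orb x0 = \<alpha> t0"
      "t0 = a \<longrightarrow> x0 = e\<^sub>a" "t0 = b \<longrightarrow> x0 = e\<^sub>b" "\<forall>t\<in>I. \<bar>t - t0\<bar> < d \<longrightarrow> N \<subseteq> Q t"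
      using loc[OF t0] by blast
    have N: "N \<subseteq> topspace M" using x0(2) by (rule openin_subset)
    then have x0M: "x0 \<in> topspace M" using x0(3) by blast
    obtain d' where d': "d' > 0"
      "\<And>t c. t \<in> {0..1} \<Longrightarrow> \<bar>t - t0\<bar> < d' \<Longrightarrow> \<bar>c - f x0\<bar> < d' \<Longrightarrow> \<exists>y\<in>N. orb y = \<alpha> t \<and> f y = c"
      by (rule path_meets_nearby_levels[OF subsetD[OF I t0] x0M reg[OF t0 x0M x0(4)] x0(4,2,3)]) blast
    \<comment> \<open>so small that no other time with a prescribed value interferes\<close>
    define d'' where "d'' = Min {d, d', if t0 = a then 1 else \<bar>a - t0\<bar>, if t0 = b then 1 else \<bar>b - t0\<bar>}"
    have d'': "d'' > 0" "d'' \<le> d" "d'' \<le> d'" "t0 \<noteq> a \<Longrightarrow> d'' \<le> \<bar>a - t0\<bar>" "t0 \<noteq> b \<Longrightarrow> d'' \<le> \<bar>b - t0\<bar>"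
      using x0(1) d'(1) by (auto simp: d''_def)
    show ?thesis
    proof (rule exI[of _ "f x0"], rule exI[of _ d''], intro conjI ballI impI d''(1))
      fix t assume t: "t \<in> I" "\<bar>t - t0\<bar> < d''"
      show "f x0 \<in> f ` C t"
      proof (cases "t = t0")
        case True
        then have "x0 \<in> C t" using x0 x0M t0 by (intro CI) auto
        then show ?thesis by blast
      next
        case False
        obtain y where y: "y \<in> N" "orb y = \<alpha> t" "f y = f x0"
          using d'(2)[of t "f x0"] t d'' d'(1) I by force
        have "t \<noteq> a" "t \<noteq> b" using d''(4,5) t(2) False by auto
        then have "y \<in> C t" using y x0(7) t d''(2) N by (intro CI) auto
        then show ?thesis using y(3) by (metis imageI)
      qed
    qed
  qed
  obtain h where h: "continuous_on I h" "\<And>t. t \<in> I \<Longrightarrow> h t \<in> f ` C t"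
    using continuous_selection_real[of I "\<lambda>t. f ` C t"] convex local by metis
  have "\<forall>t\<in>I. \<exists>x\<in>C t. f x = h t" using h(2) by force
  then obtain \<beta> where \<beta>: "\<And>t. t \<in> I \<Longrightarrow> \<beta> t \<in> C t" "\<And>t. t \<in> I \<Longrightarrow> f (\<beta> t) = h t" by metis
  show ?thesis
  proof (rule that[of \<beta>])
    fix t0 N assume t0: "t0 \<in> I" and N: "openin M N" "\<beta> t0 \<in> N"
    note b0 = CD[OF \<beta>(1)[OF t0]]
    obtain d where d: "d > 0"
      "\<And>t c. t \<in> {0..1} \<Longrightarrow> \<bar>t - t0\<bar> < d \<Longrightarrow> \<bar>c - f (\<beta> t0)\<bar> < d \<Longrightarrow> \<exists>y\<in>N. orb y = \<alpha> t \<and> f y = c"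
      by (rule path_meets_nearby_levels[OF subsetD[OF I t0] b0(2) reg[OF t0 b0(2,3)] b0(3) N]) blast
    obtain d' where d': "d' > 0" "\<And>t. t \<in> I \<Longrightarrow> dist t t0 < d' \<Longrightarrow> dist (h t) (h t0) < d"
      using h(1) t0 d(1) unfolding continuous_on_iff by metis
    show "\<exists>d>0. \<forall>t\<in>I. \<bar>t - t0\<bar> < d \<longrightarrow> \<beta> t \<in> N"
    proof (intro exI[of _ "min d d'"] conjI ballI impI)
      fix t assume t: "t \<in> I" "\<bar>t - t0\<bar> < min d d'"
      then obtain y where y: "y \<in> N" "orb y = \<alpha> t" "f y = h t"
        using d(2)[of t "h t"] d'(2)[of t] subsetD[OF I t(1)] \<beta>(2)[OF t0] by (auto simp: dist_real_def)
      have "y = \<beta> t"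
        using f_inj_on_orbit[of y "\<beta> t"] y CD[OF \<beta>(1)[OF t(1)]] \<beta>(2)[OF t(1)] openin_subset[OF N(1)] by auto
      then show "\<beta> t \<in> N" using y(1) by simp
    qed (use d d' in auto)
  qed (use CD[OF \<beta>(1)] in auto)
qed

text \<open>Freedom in both endpoints is what makes lifts over adjacent intervals fit together.\<close>

definition liftable :: "real \<Rightarrow> real \<Rightarrow> bool" where
  "liftable a b \<longleftrightarrow> (\<forall>e\<^sub>a e\<^sub>b. e\<^sub>a \<in> topspace M \<and> orb e\<^sub>a = \<alpha> a \<and> e\<^sub>b \<in> topspace M \<and> orb e\<^sub>b = \<alpha> b \<longrightarrow>
    (\<exists>\<beta>. continuous_map (top_of_set {a..b}) M \<beta> \<and> (\<forall>t\<in>{a..b}. orb (\<beta> t) = \<alpha> t) \<and> \<beta> a = e\<^sub>a \<and> \<beta> b = e\<^sub>b))"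

lemma continuous_map_interval_iff:
  "continuous_map (top_of_set I) M \<beta> \<longleftrightarrow> (\<forall>t\<in>I. \<beta> t \<in> topspace M) \<and>
    (\<forall>t0\<in>I. \<forall>N. openin M N \<longrightarrow> \<beta> t0 \<in> N \<longrightarrow> (\<exists>d>0. \<forall>t\<in>I. \<bar>t - t0\<bar> < d \<longrightarrow> \<beta> t \<in> N))"
    for I :: "real set"
proof -
  have "openin (top_of_set I) {t \<in> I. \<beta> t \<in> N} \<longleftrightarrow>
      (\<forall>t0\<in>I. \<beta> t0 \<in> N \<longrightarrow> (\<exists>d>0. \<forall>t\<in>I. \<bar>t - t0\<bar> < d \<longrightarrow> \<beta> t \<in> N))" for N
    unfolding openin_euclidean_subtopology_iff dist_real_def by blast
  then show ?thesis unfolding continuous_map_def by (auto simp: Pi_iff)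
qed

lemma liftable_trans:
  assumes "a < b" "b < c" "b \<in> {0..1}" and ab: "liftable a b" and bc: "liftable b c"
  shows "liftable a c"
  unfolding liftable_def
proof (intro allI impI)
  fix e\<^sub>a e\<^sub>c
  assume e: "e\<^sub>a \<in> topspace M \<and> orb e\<^sub>a = \<alpha> a \<and> e\<^sub>c \<in> topspace M \<and> orb e\<^sub>c = \<alpha> c"
  obtain e\<^sub>b where eb: "e\<^sub>b \<in> topspace M" "orb e\<^sub>b = \<alpha> b"
    using path_in_orbit_space[OF assms(3)] .
  obtain \<beta>1 where \<beta>1: "continuous_map (top_of_set {a..b}) M \<beta>1" "\<forall>t\<in>{a..b}. orb (\<beta>1 t) = \<alpha> t"
    "\<beta>1 a = e\<^sub>a" "\<beta>1 b = e\<^sub>b"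
    using ab e eb unfolding liftable_def by blast
  obtain \<beta>2 where \<beta>2: "continuous_map (top_of_set {b..c}) M \<beta>2" "\<forall>t\<in>{b..c}. orb (\<beta>2 t) = \<alpha> t"
    "\<beta>2 b = e\<^sub>b" "\<beta>2 c = e\<^sub>c"
    using bc e eb unfolding liftable_def by blast
  have "{a..c} \<inter> {t \<in> topspace (top_of_set {a..c}). t \<le> b} = {a..b}"
    "{a..c} \<inter> {t \<in> topspace (top_of_set {a..c}). b \<le> t} = {b..c}"
    using assms(1,2) by auto
  then have "subtopology (top_of_set {a..c}) {t \<in> topspace (top_of_set {a..c}). t \<le> b} = top_of_set {a..b}"
    "subtopology (top_of_set {a..c}) {t \<in> topspace (top_of_set {a..c}). b \<le> t} = top_of_set {b..c}"
    unfolding subtopology_subtopology by simp_all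
  then have "continuous_map (top_of_set {a..c}) M (\<lambda>t. if t \<le> b then \<beta>1 t else \<beta>2 t)"
    using \<beta>1(1,4) \<beta>2(1,3) by (intro continuous_map_cases_le) simp_all
  then show "\<exists>\<beta>. continuous_map (top_of_set {a..c}) M \<beta> \<and> (\<forall>t\<in>{a..c}. orb (\<beta> t) = \<alpha> t) \<and> \<beta> a = e\<^sub>a \<and> \<beta> c = e\<^sub>c"
    using \<beta>1 \<beta>2 assms(1,2) by (intro exI[of _ "\<lambda>t. if t \<le> b then \<beta>1 t else \<beta>2 t"]) auto
qed

lemma liftable_over_regular_interval:
  assumes "0 \<le> a" "a < b" "b \<le> 1"
    and reg: "\<And>t x. t \<in> {a..b} \<Longrightarrow> x \<in> topspace M \<Longrightarrow> orb x = \<alpha> t \<Longrightarrow> x \<notin> crit"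
  shows "liftable a b"
  unfolding liftable_def
proof (intro allI impI)
  fix e\<^sub>a e\<^sub>b
  assume e: "e\<^sub>a \<in> topspace M \<and> orb e\<^sub>a = \<alpha> a \<and> e\<^sub>b \<in> topspace M \<and> orb e\<^sub>b = \<alpha> b"
  have loc: "\<exists>x0 N d. d > 0 \<and> openin M N \<and> x0 \<in> N \<and> orb x0 = \<alpha> t0 \<and>
      (t0 = a \<longrightarrow> x0 = e\<^sub>a) \<and> (t0 = b \<longrightarrow> x0 = e\<^sub>b) \<and> (\<forall>t\<in>{a..b}. \<bar>t - t0\<bar> < d \<longrightarrow> N \<subseteq> topspace M)"
    if t0: "t0 \<in> {a..b}" for t0
  proof -
    obtain x where "x \<in> topspace M" "orb x = \<alpha> t0"
      using path_in_orbit_space[of t0] t0 assms by auto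
    then obtain x0 where "x0 \<in> topspace M" "orb x0 = \<alpha> t0" "t0 = a \<longrightarrow> x0 = e\<^sub>a" "t0 = b \<longrightarrow> x0 = e\<^sub>b"
      using e \<open>a < b\<close> by (metis less_irrefl)
    then show ?thesis by (intro exI[of _ x0] exI[of _ "topspace M"] exI[of _ 1]) auto
  qed
  have I: "{a..b} \<subseteq> {0..1}" using assms by auto
  obtain \<beta> where \<beta>: "\<And>t. t \<in> {a..b} \<Longrightarrow> \<beta> t \<in> topspace M"
    "\<And>t. t \<in> {a..b} \<Longrightarrow> orb (\<beta> t) = \<alpha> t" "a \<in> {a..b} \<Longrightarrow> \<beta> a = e\<^sub>a" "b \<in> {a..b} \<Longrightarrow> \<beta> b = e\<^sub>b"
    "\<And>t0 N. \<lbrakk>t0 \<in> {a..b}; openin M N; \<beta> t0 \<in> N\<rbrakk> \<Longrightarrow> \<exists>d>0. \<forall>t\<in>{a..b}. \<bar>t - t0\<bar> < d \<longrightarrow> \<beta> t \<in> N"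
    by (rule lift_over_regular_times[where Q = "\<lambda>t. topspace M", OF I \<open>a < b\<close> reg _ loc]) blast+
  then show "\<exists>\<beta>. continuous_map (top_of_set {a..b}) M \<beta> \<and> (\<forall>t\<in>{a..b}. orb (\<beta> t) = \<alpha> t) \<and> \<beta> a = e\<^sub>a \<and> \<beta> b = e\<^sub>b"
    unfolding continuous_map_interval_iff using \<open>a < b\<close> by (intro exI[of _ \<beta>]) auto
qed

text \<open>At the times in \<open>Z\<close> the lift is \<open>p\<close>.  Elsewhere it is confined to \<open>orbit_hull (B k)\<close> at distance less than
  \<open>\<delta> k\<close> from \<open>Z\<close>, which makes it converge to \<open>p\<close> at \<open>Z\<close>.\<close>

lemma liftable_near_critical_time:
  assumes ab: "0 \<le> a" "a < b" "b \<le> 1" and x: "x \<in> {a..b}" "\<alpha> x = {p}" and p: "p \<in> crit"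
    and only: "\<And>t y. t \<in> {a..b} \<Longrightarrow> y \<in> crit \<Longrightarrow> orb y = \<alpha> t \<Longrightarrow> y = p"
  shows "liftable a b"
  unfolding liftable_def
proof (intro allI impI)
  fix e\<^sub>a e\<^sub>b
  assume e: "e\<^sub>a \<in> topspace M \<and> orb e\<^sub>a = \<alpha> a \<and> e\<^sub>b \<in> topspace M \<and> orb e\<^sub>b = \<alpha> b"
  have pM: "p \<in> topspace M" using p by (simp add: critical_points_def)
  have orbp: "orb p = {p}" using critical_orbit[OF p] .
  define Z where "Z = {t \<in> {a..b}. \<alpha> t = {p}}"
  have xZ: "x \<in> Z" using x by (simp add: Z_def)
  have abI: "{a..b} \<subseteq> {0..1}" using ab by auto
  have cl: "closed {t \<in> {a..b}. \<alpha> t \<notin> orb ` W}" if W: "openin M W" for W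
  proof -
    have "openin (top_of_set {a..b}) {t \<in> {a..b}. \<alpha> t \<in> orb ` W}"
      unfolding openin_euclidean_subtopology_iff dist_real_def
    proof (intro conjI ballI)
      fix t0 assume "t0 \<in> {t \<in> {a..b}. \<alpha> t \<in> orb ` W}"
      then obtain d where "d > 0" "\<And>t. t \<in> {0..1} \<Longrightarrow> \<bar>t - t0\<bar> < d \<Longrightarrow> \<alpha> t \<in> orb ` W"
        using path_stays_in_saturation[OF _ W, of t0] abI by blast
      then show "\<exists>d>0. \<forall>t\<in>{a..b}. \<bar>t - t0\<bar> < d \<longrightarrow> t \<in> {t \<in> {a..b}. \<alpha> t \<in> orb ` W}"
        using abI by (intro exI[of _ d]) auto
    qed auto
    then have "closedin (top_of_set {a..b}) ({a..b} - {t \<in> {a..b}. \<alpha> t \<in> orb ` W})"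
      by (auto intro: closedin_diff)
    then have "closed ({a..b} - {t \<in> {a..b}. \<alpha> t \<in> orb ` W})"
      by (rule closedin_closed_trans) simp
    moreover have "{a..b} - {t \<in> {a..b}. \<alpha> t \<in> orb ` W} = {t \<in> {a..b}. \<alpha> t \<notin> orb ` W}" by auto
    ultimately show ?thesis by simp
  qed
  have "Z = {t \<in> {a..b}. \<alpha> t \<notin> orb ` (topspace M - {p})}"
  proof -
    have "\<alpha> t = {p} \<longleftrightarrow> \<alpha> t \<notin> orb ` (topspace M - {p})" if t: "t \<in> {a..b}" for t
    proof -
      obtain y where y: "y \<in> topspace M" "orb y = \<alpha> t" using path_in_orbit_space t abI by blast
      have only_p: "z = p" if "z \<in> topspace M" "orb z = {p}" for z
        using in_orbit_self[OF that(1)] that(2) by simp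
      show ?thesis
      proof
        assume "\<alpha> t = {p}"
        then show "\<alpha> t \<notin> orb ` (topspace M - {p})" using only_p by auto
      next
        assume "\<alpha> t \<notin> orb ` (topspace M - {p})"
        then have "y = p" using y by (metis Diff_iff imageI singletonD)
        then show "\<alpha> t = {p}" using y(2) orbp by simp
      qed
    qed
    then show ?thesis by (auto simp: Z_def)
  qed
  moreover have "openin M (topspace M - {p})"
    using closedin_Hausdorff_sing_eq[OF Hausdorff] pM by (auto simp: closedin_def)
  ultimately have closedZ: "closed Z" using cl by simp
  have infpos: "infdist t Z > 0" if "t \<notin> Z" for t
    using in_closed_iff_infdist_zero[OF closedZ] xZ that infdist_nonneg[of t Z] by (metis empty_iff less_eq_real_def)
  obtain B :: "nat \<Rightarrow> 'a set" where B: "\<And>n. openin M (B n)" "\<And>n. p \<in> B n" "\<And>m n. m \<le> n \<Longrightarrow> B n \<subseteq> B m"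
    "\<And>W. openin M W \<Longrightarrow> p \<in> W \<Longrightarrow> \<exists>n. orbit_hull (B n) \<subseteq> W"
    using shrinking_orbit_hulls[OF p] by metis
  \<comment> \<open>The bound \<open>1 / Suc k\<close> leaves finitely many conditions near each time outside \<open>Z\<close>.  The factor \<open>2\<close>
    makes a condition that is in force at a nearby time satisfiable at the given time.  The last clause
    exempts endpoints outside \<open>Z\<close>, where the value of the lift is prescribed.\<close>
  have "\<exists>\<delta>>0. \<delta> \<le> 1 / real (Suc k) \<and> (\<forall>s\<in>{a..b}. infdist s Z < 2 * \<delta> \<longrightarrow> \<alpha> s \<in> orb ` B k) \<and>
      (\<forall>s\<in>{a,b} - Z. 2 * \<delta> \<le> infdist s Z)" for k
  proof -
    let ?T = "{t \<in> {a..b}. \<alpha> t \<notin> orb ` B k} \<union> ({a,b} - Z)"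
    have "compact ({t \<in> {a..b}. \<alpha> t \<notin> orb ` B k})"
      using cl[OF B(1)] by (rule compact_eq_bounded_closed[THEN iffD2, OF conjI[rotated]])
        (auto intro: bounded_subset[OF bounded_closed_interval])
    then have T: "compact ?T" by (rule compact_Un) (simp add: finite_imp_compact)
    have TZ: "t \<notin> Z" if "t \<in> ?T" for t
      using that imageI[OF B(2)[of k], of orb] orbp by (auto simp: Z_def)
    have "\<exists>\<mu>>0. \<forall>t\<in>?T. \<mu> \<le> infdist t Z"
    proof (cases "?T = {}")
      case False
      have "continuous_on ?T (\<lambda>t. infdist t Z)" by (intro continuous_intros)
      from continuous_attains_inf[OF T False this]
      obtain t where t: "t \<in> ?T" "\<forall>s\<in>?T. infdist t Z \<le> infdist s Z" by (elim bexE) (rule that)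
      show ?thesis by (intro exI[of _ "infdist t Z"] conjI infpos TZ t)
    qed (auto intro: exI[of _ 1])
    then obtain \<mu> where \<mu>: "\<mu> > 0" "\<forall>t\<in>?T. \<mu> \<le> infdist t Z" by blast
    define \<delta> where "\<delta> = min (\<mu> / 2) (1 / real (Suc k))"
    have \<delta>: "\<delta> > 0" "\<delta> \<le> 1 / real (Suc k)" "2 * \<delta> \<le> \<mu>" using \<mu>(1) by (auto simp: \<delta>_def)
    show ?thesis
    proof (rule exI[of _ \<delta>], intro conjI ballI impI \<delta>(1,2))
      show "\<alpha> s \<in> orb ` B k" if "s \<in> {a..b}" "infdist s Z < 2 * \<delta>" for s
      proof (rule ccontr)
        assume "\<alpha> s \<notin> orb ` B k"
        then have "s \<in> ?T" using that(1) by blast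
        from bspec[OF \<mu>(2) this] show False using \<delta>(3) that(2) by linarith
      qed
      show "2 * \<delta> \<le> infdist s Z" if "s \<in> {a, b} - Z" for s
        using \<mu>(2) \<delta>(3) that by (meson UnI2 order_trans)
    qed
  qed
  then obtain \<delta> where \<delta>: "\<And>k. \<delta> k > 0" "\<And>k. \<delta> k \<le> 1 / real (Suc k)"
    "\<And>k s. s \<in> {a..b} \<Longrightarrow> infdist s Z < 2 * \<delta> k \<Longrightarrow> \<alpha> s \<in> orb ` B k"
    "\<And>k s. s \<in> {a,b} - Z \<Longrightarrow> 2 * \<delta> k \<le> infdist s Z" by metis
  define I where "I = {a..b} - Z"
  have I: "I \<subseteq> {0..1}" using abI by (auto simp: I_def)
  define Q where "Q t = {y \<in> topspace M. \<forall>k. infdist t Z < \<delta> k \<longrightarrow> y \<in> orbit_hull (B k)}" for t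
  have reg: "y \<notin> crit" if "t \<in> I" "y \<in> topspace M" "orb y = \<alpha> t" for t y
    using only[of t y] that orbp by (auto simp: I_def Z_def)
  have conv: "y \<in> Q t" if "t \<in> I" "x \<in> Q t" "z \<in> Q t" "y \<in> topspace M" "orb x = \<alpha> t" "orb y = \<alpha> t"
      "orb z = \<alpha> t" "f x \<le> f y" "f y \<le> f z" for t x y z
    using that orbit_hull_convex[of x _ z y] by (auto simp: Q_def)
  have loc: "\<exists>x0 N d. d > 0 \<and> openin M N \<and> x0 \<in> N \<and> orb x0 = \<alpha> t0 \<and>
      (t0 = a \<longrightarrow> x0 = e\<^sub>a) \<and> (t0 = b \<longrightarrow> x0 = e\<^sub>b) \<and> (\<forall>t\<in>I. \<bar>t - t0\<bar> < d \<longrightarrow> N \<subseteq> Q t)"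
    if t0: "t0 \<in> I" for t0
  proof -
    define D where "D = infdist t0 Z"
    have D: "D > 0" using t0 infpos by (auto simp: I_def D_def)
    have near: "D / 2 < infdist t Z" "D < 2 * infdist t Z" if "\<bar>t - t0\<bar> < D / 2" for t
      using infdist_triangle[of t0 Z t] that by (auto simp: D_def dist_real_def abs_minus_commute)
    show ?thesis
    proof (cases "t0 = a \<or> t0 = b")
      case True
      have "N \<subseteq> Q t" if "N \<subseteq> topspace M" "\<bar>t - t0\<bar> < D / 2" for t N
      proof -
        have "\<not> infdist t Z < \<delta> k" for k
          using \<delta>(4)[of t0 k] near[OF that(2)] True t0 by (auto simp: I_def D_def)
        then show ?thesis using that(1) by (auto simp: Q_def)
      qed
      then show ?thesis
        using True e ab D
        by (intro exI[of _ "if t0 = a then e\<^sub>a else e\<^sub>b"] exI[of _ "topspace M"] exI[of _ "D / 2"]) auto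
    next
      case False
      \<comment> \<open>all the conditions that can be in force within \<open>D / 2\<close> of \<open>t0\<close>; the strictest is the largest\<close>
      define K where "K = {k. real (Suc k) < 2 / D \<and> \<alpha> t0 \<in> orb ` B k}"
      have active: "k \<in> K" if t: "\<bar>t - t0\<bar> < D / 2" "infdist t Z < \<delta> k" for t k
      proof -
        have "D / 2 < 1 / real (Suc k)" using near(1)[OF t(1)] t(2) \<delta>(2)[of k] by linarith
        then have "real (Suc k) < 2 / D" using D by (simp add: field_simps)
        moreover have "infdist t0 Z < 2 * \<delta> k" using near(2)[OF t(1)] t(2) by (simp add: D_def)
        ultimately show ?thesis using \<delta>(3)[of t0 k] t0 by (auto simp: K_def I_def)
      qed
      have "finite K"
      proof (rule finite_subset)
        show "K \<subseteq> {k. k < nat \<lceil>2 / D\<rceil>}"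
          by (auto simp: K_def) linarith
      qed simp
      obtain N where N: "openin M N" "\<alpha> t0 \<in> orb ` N" "\<And>k. k \<in> K \<Longrightarrow> N \<subseteq> B k"
      proof (cases "K = {}")
        case True
        have "\<alpha> t0 \<in> orb ` topspace M"
          using path_in_orbit_space[OF subsetD[OF I t0]] by (metis imageI)
        with True show ?thesis by (intro that[of "topspace M"]) simp_all
      next
        case nonempty: False
        have "Max K \<in> K" using \<open>finite K\<close> nonempty by (rule Max_in)
        then have "\<alpha> t0 \<in> orb ` B (Max K)" by (simp add: K_def)
        then show ?thesis
          using B(1) B(3)[OF Max_ge[OF \<open>finite K\<close>]] by (intro that[of "B (Max K)"]) blast+
      qed
      obtain x0 where "x0 \<in> N" "orb x0 = \<alpha> t0" using N(2) by auto
      moreover have "N \<subseteq> Q t" if "\<bar>t - t0\<bar> < D / 2" for t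
        using openin_subset[OF N(1)] active[OF that] N(3) subset_orbit_hull[OF openin_subset[OF B(1)]]
        unfolding Q_def by blast
      ultimately show ?thesis
        using False N(1) D by (intro exI[of _ x0] exI[of _ N] exI[of _ "D / 2"]) auto
    qed
  qed
  obtain \<beta> where \<beta>: "\<And>t. t \<in> I \<Longrightarrow> \<beta> t \<in> Q t" "\<And>t. t \<in> I \<Longrightarrow> \<beta> t \<in> topspace M"
    "\<And>t. t \<in> I \<Longrightarrow> orb (\<beta> t) = \<alpha> t" "a \<in> I \<Longrightarrow> \<beta> a = e\<^sub>a" "b \<in> I \<Longrightarrow> \<beta> b = e\<^sub>b"
    "\<And>t0 N. \<lbrakk>t0 \<in> I; openin M N; \<beta> t0 \<in> N\<rbrakk> \<Longrightarrow> \<exists>d>0. \<forall>t\<in>I. \<bar>t - t0\<bar> < d \<longrightarrow> \<beta> t \<in> N"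
    by (rule lift_over_regular_times[where Q = Q, OF I \<open>a < b\<close> reg conv loc]) blast+
  define \<beta>' where "\<beta>' t = (if t \<in> Z then p else \<beta> t)" for t
  have "continuous_map (top_of_set {a..b}) M \<beta>'"
    unfolding continuous_map_interval_iff
  proof (intro conjI ballI allI impI)
    show "\<beta>' t \<in> topspace M" if "t \<in> {a..b}" for t
      using that \<beta>(2) pM by (auto simp: \<beta>'_def I_def)
    fix t0 N assume t0: "t0 \<in> {a..b}" and N: "openin M N" "\<beta>' t0 \<in> N"
    show "\<exists>d>0. \<forall>t\<in>{a..b}. \<bar>t - t0\<bar> < d \<longrightarrow> \<beta>' t \<in> N"
    proof (cases "t0 \<in> Z")
      case True
      then have "p \<in> N" using N(2) by (simp add: \<beta>'_def)
      then obtain k where k: "orbit_hull (B k) \<subseteq> N" using B(4) N(1) by blast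
      have "\<beta>' t \<in> N" if t: "t \<in> {a..b}" "\<bar>t - t0\<bar> < \<delta> k" for t
      proof (cases "t \<in> Z")
        case False
        have "infdist t Z < \<delta> k"
          using infdist_le[OF True, of t] t(2) by (simp add: dist_real_def)
        then have "\<beta> t \<in> orbit_hull (B k)"
          using \<beta>(1)[of t] t(1) False by (auto simp: I_def Q_def)
        then show ?thesis using k False by (auto simp: \<beta>'_def)
      qed (simp add: \<beta>'_def \<open>p \<in> N\<close>)
      then show ?thesis using \<delta>(1)[of k] by blast
    next
      case False
      then have t0I: "t0 \<in> I" using t0 by (simp add: I_def)
      obtain d where d: "d > 0" "\<forall>t\<in>I. \<bar>t - t0\<bar> < d \<longrightarrow> \<beta> t \<in> N"
        using \<beta>(6)[OF t0I N(1)] N(2) False by (auto simp: \<beta>'_def)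
      have "\<beta>' t \<in> N" if t: "t \<in> {a..b}" "\<bar>t - t0\<bar> < min d (infdist t0 Z)" for t
      proof -
        have "t \<notin> Z" using infdist_le[of t Z t0] t(2) by (auto simp: dist_real_def abs_minus_commute)
        then show ?thesis using d(2) t by (auto simp: \<beta>'_def I_def)
      qed
      then show ?thesis using d(1) infpos[OF False] by (intro exI[of _ "min d (infdist t0 Z)"]) auto
    qed
  qed
  moreover have "\<forall>t\<in>{a..b}. orb (\<beta>' t) = \<alpha> t"
    using \<beta>(3) orbp by (auto simp: \<beta>'_def Z_def I_def)
  moreover have "\<beta>' a = e\<^sub>a" "\<beta>' b = e\<^sub>b"
  proof -
    have "p = e" if "e \<in> topspace M" "orb e = {p}" for e
      using in_orbit_self[OF that(1)] that(2) by simp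
    then show "\<beta>' a = e\<^sub>a" "\<beta>' b = e\<^sub>b" using \<beta>(4,5) e ab by (auto simp: \<beta>'_def Z_def I_def)
  qed
  ultimately show "\<exists>\<beta>. continuous_map (top_of_set {a..b}) M \<beta> \<and> (\<forall>t\<in>{a..b}. orb (\<beta> t) = \<alpha> t) \<and> \<beta> a = e\<^sub>a \<and> \<beta> b = e\<^sub>b"
    by blast
qed

lemma locally_liftable:
  assumes x: "x \<in> {0..1}"
  obtains d where "d > 0" "\<And>a b. \<lbrakk>0 \<le> a; a < b; b \<le> 1; a \<le> x; x \<le> b; b - a < d\<rbrakk> \<Longrightarrow> liftable a b"
proof -
  obtain p where p: "p \<in> topspace M" "orb p = \<alpha> x" using path_in_orbit_space[OF x] .
  show ?thesis
  proof (cases "p \<in> crit")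
    case False
    then have "\<alpha> x \<in> orb ` (topspace M - crit)" using p by (metis DiffI imageI)
    then obtain d where d: "d > 0" "\<And>t. t \<in> {0..1} \<Longrightarrow> \<bar>t - x\<bar> < d \<Longrightarrow> \<alpha> t \<in> orb ` (topspace M - crit)"
      using path_stays_in_saturation[OF x openin_regular_points] by blast
    show ?thesis
    proof (rule that[OF d(1)])
      fix a b assume ab: "0 \<le> a" "a < b" "b \<le> 1" "a \<le> x" "x \<le> b" "b - a < d"
      show "liftable a b"
      proof (rule liftable_over_regular_interval[OF ab(1-3)])
        fix t y assume t: "t \<in> {a..b}" and y: "y \<in> topspace M" "orb y = \<alpha> t"
        have "\<alpha> t \<in> orb ` (topspace M - crit)" using t ab by (intro d(2)) auto
        then show "y \<notin> crit" using orbit_of_regular[OF _ _ y(1)] y(2) by auto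
      qed
    qed
  next
    case True
    obtain N where N: "openin M N" "p \<in> N" "N \<inter> crit = {p}" using critical_points_isolated[OF True] .
    then have "\<alpha> x \<in> orb ` N" using p by (metis imageI)
    then obtain d where d: "d > 0" "\<And>t. t \<in> {0..1} \<Longrightarrow> \<bar>t - x\<bar> < d \<Longrightarrow> \<alpha> t \<in> orb ` N"
      using path_stays_in_saturation[OF x N(1)] by blast
    show ?thesis
    proof (rule that[OF d(1)])
      fix a b assume ab: "0 \<le> a" "a < b" "b \<le> 1" "a \<le> x" "x \<le> b" "b - a < d"
      show "liftable a b"
      proof (rule liftable_near_critical_time[OF ab(1-3) _ _ True])
        show "\<alpha> x = {p}" using p(2) critical_orbit[OF True] by simp
        fix t y assume t: "t \<in> {a..b}" and y: "y \<in> crit" "orb y = \<alpha> t"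
        have "\<alpha> t \<in> orb ` N" using t ab by (intro d(2)) auto
        then obtain z where z: "z \<in> N" "orb z = {y}" using y critical_orbit by auto
        then have "z = y" using in_orbit_self[of z] openin_subset[OF N(1)] by auto
        then show "y = p" using z(1) y(1) N(3) by blast
      qed (use ab in auto)
    qed
  qed
qed

lemma liftable_unit_interval: "liftable 0 1"
proof -
  have "0 \<le> (0::real) \<longrightarrow> (1::real) \<le> 1 \<longrightarrow> (0::real) < 1 \<longrightarrow> liftable 0 1"
  proof (rule Bolzano[where P = "\<lambda>a b. 0 \<le> a \<longrightarrow> b \<le> 1 \<longrightarrow> a < b \<longrightarrow> liftable a b"])
    fix a b c :: real
    assume *: "0 \<le> a \<longrightarrow> b \<le> 1 \<longrightarrow> a < b \<longrightarrow> liftable a b" "0 \<le> b \<longrightarrow> c \<le> 1 \<longrightarrow> b < c \<longrightarrow> liftable b c"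
      and abc: "a \<le> b" "b \<le> c"
    show "0 \<le> a \<longrightarrow> c \<le> 1 \<longrightarrow> a < c \<longrightarrow> liftable a c"
    proof (intro impI)
      assume ac: "0 \<le> a" "c \<le> 1" "a < c"
      consider "a = b" | "b = c" | "a < b" "b < c" using abc by linarith
      then show "liftable a c"
      proof cases
        case 3
        then have "liftable a b" "liftable b c" "b \<in> {0..1}" using * ac by simp_all
        then show ?thesis using liftable_trans[OF 3] by blast
      qed (use * ac in simp_all)
    qed
  next
    fix x :: real assume "0 \<le> x" "x \<le> 1"
    then show "\<exists>d>0. \<forall>a b. a \<le> x \<and> x \<le> b \<and> b - a < d \<longrightarrow> 0 \<le> a \<longrightarrow> b \<le> 1 \<longrightarrow> a < b \<longrightarrow> liftable a b"
      using locally_liftable[of x] by (metis atLeastAtMost_iff)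
  qed simp
  then show ?thesis by simp
qed

end

lemma orbit_space_lift:
  assumes "pathin (orbit_space M A v) \<alpha>"
    and "e\<^sub>0 \<in> topspace M" "orb e\<^sub>0 = \<alpha> 0" "e\<^sub>1 \<in> topspace M" "orb e\<^sub>1 = \<alpha> 1"
  shows "\<exists>\<beta>. pathin M \<beta> \<and> (\<forall>t\<in>{0..1}. orb (\<beta> t) = \<alpha> t) \<and> \<beta> 0 = e\<^sub>0 \<and> \<beta> 1 = e\<^sub>1"
  using liftable_unit_interval[OF assms(1)] assms(2-) unfolding liftable_def[OF assms(1)] pathin_def by blast

end

theorem theorem3p7:
  fixes M :: "'a topology" and A :: "('a, 'm::finite) chart set"
    and f :: "'a \<Rightarrow> real" and v :: "'a \<Rightarrow> ('a, 'm) tangent_vector"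
  assumes "smooth_manifold M A" and "connected_space M"
    and "morse_function M A f" and "is_gradient M A f v"
  shows "path_lifting M (orbit_space M A v) (orbit M A v) \<and>
    (\<forall>\<alpha> e\<^sub>0 e\<^sub>1. pathin (orbit_space M A v) \<alpha> \<and>
       e\<^sub>0 \<in> topspace M \<and> orbit M A v e\<^sub>0 = \<alpha> 0 \<and> e\<^sub>1 \<in> topspace M \<and> orbit M A v e\<^sub>1 = \<alpha> 1 \<longrightarrow>
       (\<exists>\<beta>. pathin M \<beta> \<and> (\<forall>t\<in>{0..1}. orbit M A v (\<beta> t) = \<alpha> t) \<and> \<beta> 0 = e\<^sub>0 \<and> \<beta> 1 = e\<^sub>1))"
proof -
  interpret gradient_field M A v f
    using assms by unfold_locales (simp_all add: is_gradient_def)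
  show ?thesis
  proof (intro conjI allI impI)
    show "path_lifting M (orbit_space M A v) (orbit M A v)"
      unfolding path_lifting_def
    proof (intro allI impI)
      fix \<alpha> e\<^sub>0
      assume *: "pathin (orbit_space M A v) \<alpha> \<and> e\<^sub>0 \<in> topspace M \<and> orb e\<^sub>0 = \<alpha> 0"
      then obtain e\<^sub>1 where "e\<^sub>1 \<in> topspace M" "orb e\<^sub>1 = \<alpha> 1"
        using path_in_orbit_space[of \<alpha> 1] by auto
      then show "\<exists>\<beta>. pathin M \<beta> \<and> (\<forall>t\<in>{0..1}. orb (\<beta> t) = \<alpha> t) \<and> \<beta> 0 = e\<^sub>0"
        using orbit_space_lift[of \<alpha> e\<^sub>0 e\<^sub>1] * by blast
    qed
  next
    fix \<alpha> e\<^sub>0 e\<^sub>1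
    assume "pathin (orbit_space M A v) \<alpha> \<and> e\<^sub>0 \<in> topspace M \<and> orb e\<^sub>0 = \<alpha> 0 \<and> e\<^sub>1 \<in> topspace M \<and> orb e\<^sub>1 = \<alpha> 1"
    then show "\<exists>\<beta>. pathin M \<beta> \<and> (\<forall>t\<in>{0..1}. orb (\<beta> t) = \<alpha> t) \<and> \<beta> 0 = e\<^sub>0 \<and> \<beta> 1 = e\<^sub>1"
      using orbit_space_lift[of \<alpha> e\<^sub>0 e\<^sub>1] by blast
  qed
qed

end
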